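(* Assume that conditions (H1), (H2), (H3) (stated in the context) hold with $F_0\in L^1(W_0\bar\mu)$, and that conditions (W1), (W2) (stated in the context) hold with $W_1\in \mathcal W^{2,p_1}_{\bar\mu}$ for some $p_1\ge \frac{q}{q-1}$. Then the map $\hat{\mathcal T}\circ\mathscr I$ has a fixed point in $\mathcal W^{1,p}_{q,\bar\mu}\cap L^\infty\cap L^1(W\bar\mu)$; that is, there is $f\ge 0$ with $\bar\mu(f)=1$, $f\in\mathcal W^{1,p}_{q,\bar\mu}\cap L^\infty\cap L^1(W\bar\mu)$, and $f=\hat{\mathcal T}(\cdot,f\bar\mu)$.
   Context: Notation. $L^p$, $W^{k,p}$, $L^p_{loc}$, $W^{k,p}_{loc}$ are the usual (local) Lebesgue and Sobolev spaces on $\mathbb R^d$ with Lebesgue measure; $L^p(\mu)$ is the Lebesgue space of a measure $\mu$; $\mu(f)=\int f\,d\mu$; $f\mu$ is the measure $f(x)\mu(dx)$. For a probability measure $\mu$, $\mathcal W^{k,p}_{q,\mu}=\{f\in W^{k,p}_{loc}: \nabla f,\dots,\nabla^k f\in L^q(\mu)\}$ and $\mathcal W^{k,p}_{\mu}:=\mathcal W^{k,p}_{p,\mu}$. $\mathscr P(\mathbb R^d)$ is the set of Borel probability measures on $\mathbb R^d$. For measurable $U\ge1$, $\mathscr P_U=\{\mu\in\mathscr P(\mathbb R^d):\|\mu\|_U:=\mu(U)<\infty\}$, with the distance $\|\mu-\nu\|_U=\sup_{|f|\le U}|\mu(f)-\nu(f)|$. For $q=1$, $\frac q{q-1}=+\infty$.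 Reference measure: $\bar\mu(dx)=\frac{e^{-\bar V(x)}dx}{\int_{\mathbb R^d}e^{-\bar V(x)}dx}$. (H1) $V_0,\bar V:\mathbb R^d\to\mathbb R$ are measurable with $e^{-V_0},e^{-\bar V}\in L^1$, and there exist $p\in(d,+\infty]$, $q\ge1$ such that $V_0,\bar V\in\mathcal W^{1,p}_{q,\bar\mu}$. (H2) There is a measurable $W_0\ge1$ with $W_0\in L^1(\bar\mu)$; $V:\mathbb R^d\times\mathscr P_{W_0}\to\mathbb R$ is measurable and $V(\cdot,\mu)\in W^{1,p}_{loc}$ for all $\mu\in\mathscr P_{W_0}$. There exist nonnegative functions $F_0,F_1,F_2,F_3$ ($F_0,F_2$ on $\mathbb R^d$, $F_1,F_3$ on $[0,\infty)$) with $F_0\in L^\infty_{loc}$, $F_2\in L^q(\bar\mu)\cap L^p_{loc}$, $F_1,F_3$ increasing on $[0,+\infty)$, $\lim_{r\to0^+}F_1(r)=0$, and a constant $C$, such that for all $\mu,\nu\in\mathscr P_{W_0}$: $|V(x,\mu)-V(x,\nu)|\le F_0(x)F_1(\|\mu-\nu\|_{W_0})$, $|V(x,\bar\mu)|\le C(F_0(x)+1)$, $|\nabla V(x,\mu)|\le F_2(x)F_3(\|\mu\|_{W_0})$ ($\nabla$ is the gradient in $x$). (H3) There is a nonnegative increasing function $F_4$ on $[0,+\infty)$ such that $-V_0(x)+\beta F_0(x)\le-\bar V(x)+F_4(\beta)$ for all $\beta\ge0$. Maps: $\psi(x,\mu)=\exp\{-V_0(x)-V(x,\mu)+\bar V(x)\}$,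 $\hat{\mathcal T}(x,\mu)=\frac{\psi(x,\mu)}{\bar\mu(\psi(\cdot,\mu))}$, and $\hat{\mathcal T}:\mu\mapsto\hat{\mathcal T}(\cdot,\mu)$. For $0\le f\in L^1(\bar\mu)$ with $\bar\mu(f)=1$, $\mathscr I(f)=f\bar\mu$. For $\mu\in\mathscr P_{W_0}$, $L_\mu g=\Delta g-\langle\nabla(V_0+V(\cdot,\mu)),\nabla g\rangle$ (the same formula is used, a.e., for $g\in W^{2,1}_{loc}$). (W1) There is a measurable $W\ge1$ with $\lim_{|x|\to\infty}W(x)=+\infty$, $\sup_{x}\frac{W_0(x)}{W(x)}<\infty$ and $\limsup_{|x|\to\infty}\frac{W_0(x)}{W(x)}=0$ (so $\mathscr P_W\subset\mathscr P_{W_0}$). (W2) There exist a positive measurable function $W_1\in W^{2,1}_{loc}$ and strictly increasing functions $G_1,G_2$ on $[0,+\infty)$ such that $G_2$ is convex, $\limsup_{r\to+\infty}\frac{G_1(r)}{G_2(r)}<1$, and $L_\mu W_1\le G_1(\|\mu\|_W)-G_2(W)$ for all $\mu\in\mathscr P_W$. *)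

theory Defs
  imports "HOL-Probability.Probability"
begin

section \<open>Lebesgue spaces\<close>

text \<open>
  The space $\<real>^d$ is an arbitrary type of class \<^class>\<open>euclidean_space\<close>, with
  $d$ its dimension. Exponents range over \<^typ>\<open>ennreal\<close>, so that $p = \<infinity>$ is allowed;
  the definitions are only used for $p \<ge> 1$. Elements are functions, not equivalence classes;
  every class of Lebesgue measurable functions has a Borel measurable representative.
\<close>

definition Lp :: "'a measure \<Rightarrow> ennreal \<Rightarrow> ('a \<Rightarrow> real) set" where
  "Lp M p = {f \<in> borel_measurable M.
     if p = \<infinity> then (\<exists>C. AE x in M. \<bar>f x\<bar> \<le> C)
     else (\<integral>\<^sup>+x. ennreal (\<bar>f x\<bar> powr enn2real p) \<partial>M) < \<infinity>}"

definition Lp_loc :: "ennreal \<Rightarrow> ('a::euclidean_space \<Rightarrow> real) set" where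
  "Lp_loc p = {f \<in> borel_measurable borel.
     \<forall>K. compact K \<longrightarrow> f \<in> Lp (restrict_space lborel K) p}"

section \<open>Weak derivatives and Sobolev spaces\<close>

text \<open>
  A mixed partial derivative is indexed by the list of the coordinate directions (elements of
  \<^term>\<open>Basis\<close>) in which one differentiates, instead of by a multi-index; the order of
  differentiation is the length of the list.
\<close>

primrec partials :: "'a::euclidean_space list \<Rightarrow> ('a \<Rightarrow> real) \<Rightarrow> 'a \<Rightarrow> real" where
  "partials [] f = f"
| "partials (i # is) f = (\<lambda>x. frechet_derivative (partials is f) (at x) i)"

definition smooth :: "('a::euclidean_space \<Rightarrow> real) \<Rightarrow> bool" where
  "smooth f \<longleftrightarrow> (\<forall>is. set is \<subseteq> Basis \<longrightarrow> (\<forall>x. partials is f differentiable at x))"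

definition test_functions :: "('a::euclidean_space \<Rightarrow> real) set" where
  "test_functions = {\<phi>. smooth \<phi> \<and> compact (closure {x. \<phi> x \<noteq> 0})}"

definition has_weak_deriv ::
    "('a::euclidean_space \<Rightarrow> real) \<Rightarrow> 'a list \<Rightarrow> ('a \<Rightarrow> real) \<Rightarrow> bool" where
  "has_weak_deriv f is g \<longleftrightarrow> f \<in> Lp_loc 1 \<and> g \<in> Lp_loc 1 \<and>
     (\<forall>\<phi>\<in>test_functions.
        (\<integral>x. f x * partials is \<phi> x \<partial>lborel) = (-1) ^ length is * (\<integral>x. g x * \<phi> x \<partial>lborel))"

text \<open>
  Weak derivatives are unique only up to Lebesgue null sets; \<open>weak_deriv\<close> picks one of them, and
  is only used in statements that do not depend on the choice.
\<close>

definition weak_deriv :: "'a::euclidean_space list \<Rightarrow> ('a \<Rightarrow> real) \<Rightarrow> 'a \<Rightarrow> real" where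
  "weak_deriv is f = (SOME g. has_weak_deriv f is g)"

definition weak_grad :: "('a::euclidean_space \<Rightarrow> real) \<Rightarrow> 'a \<Rightarrow> 'a" where
  "weak_grad f x = (\<Sum>i\<in>Basis. weak_deriv [i] f x *\<^sub>R i)"

definition weak_laplace :: "('a::euclidean_space \<Rightarrow> real) \<Rightarrow> 'a \<Rightarrow> real" where
  "weak_laplace f x = (\<Sum>i\<in>Basis. weak_deriv [i, i] f x)"

definition sobolev_loc :: "nat \<Rightarrow> ennreal \<Rightarrow> ('a::euclidean_space \<Rightarrow> real) set" where
  "sobolev_loc k p = {f \<in> Lp_loc p.
     \<forall>is. set is \<subseteq> Basis \<and> length is \<in> {1..k} \<longrightarrow> (\<exists>g. has_weak_deriv f is g \<and> g \<in> Lp_loc p)}"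

text \<open>
  The space $\mathcal W^{k,p}_{q,\mu}$. The tensor $\nabla^j f$ lies in $L^q(\mu)$ iff its
  components do. The measure is meant to be absolutely continuous, so that the condition does not
  depend on the representatives of the weak derivatives.
\<close>

definition sobolev_wt ::
    "nat \<Rightarrow> ennreal \<Rightarrow> ennreal \<Rightarrow> 'a::euclidean_space measure \<Rightarrow> ('a \<Rightarrow> real) set" where
  "sobolev_wt k p q \<mu> = {f \<in> sobolev_loc k p.
     \<forall>is. set is \<subseteq> Basis \<and> length is \<in> {1..k} \<longrightarrow> (\<exists>g. has_weak_deriv f is g \<and> g \<in> Lp \<mu> q)}"

section \<open>Weighted spaces of probability measures\<close>

definition prob_wt :: "('a::euclidean_space \<Rightarrow> real) \<Rightarrow> 'a measure set" where
  "prob_wt U = {\<mu>. prob_space \<mu> \<and> sets \<mu> = sets borel \<and> integrable \<mu> U}"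

definition wt_norm :: "('a::euclidean_space \<Rightarrow> real) \<Rightarrow> 'a measure \<Rightarrow> real" where
  "wt_norm U \<mu> = (\<integral>x. U x \<partial>\<mu>)"

definition wt_dist :: "('a::euclidean_space \<Rightarrow> real) \<Rightarrow> 'a measure \<Rightarrow> 'a measure \<Rightarrow> real" where
  "wt_dist U \<mu> \<nu> =
     (SUP f\<in>{f \<in> borel_measurable borel. \<forall>x. \<bar>f x\<bar> \<le> U x}. (\<integral>x. f x \<partial>\<mu>) - (\<integral>x. f x \<partial>\<nu>))"

text \<open>
  The Borel $\sigma$-algebra of the metric space $(\mathscr P_U, \|\cdot-\cdot\|_U)$, which contains
  the $\sigma$-algebra generated by the evaluations $\mu \mapsto \mu(A)$. Since $\<real>^d$ is second
  countable, its product with \<^term>\<open>borel\<close> is the Borel $\sigma$-algebra of the product space.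
\<close>

definition prob_wt_borel :: "('a::euclidean_space \<Rightarrow> real) \<Rightarrow> 'a measure measure" where
  "prob_wt_borel U = sigma (prob_wt U)
     {S. S \<subseteq> prob_wt U \<and> (\<forall>\<mu>\<in>S. \<exists>e>0. \<forall>\<nu>\<in>prob_wt U. wt_dist U \<mu> \<nu> < e \<longrightarrow> \<nu> \<in> S)}"

section \<open>The reference measure and the maps\<close>

definition ref_measure :: "('a::euclidean_space \<Rightarrow> real) \<Rightarrow> 'a measure" where
  "ref_measure Vb = density lborel (\<lambda>x. ennreal (exp (- Vb x) / (\<integral>y. exp (- Vb y) \<partial>lborel)))"

definition psi ::
    "('a::euclidean_space \<Rightarrow> real) \<Rightarrow> ('a \<Rightarrow> real) \<Rightarrow> ('a \<Rightarrow> 'a measure \<Rightarrow> real) \<Rightarrow> 'a \<Rightarrow> 'a measure \<Rightarrow> real"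
  where "psi V0 Vb V x \<mu> = exp (- V0 x - V x \<mu> + Vb x)"

definition T_hat ::
    "('a::euclidean_space \<Rightarrow> real) \<Rightarrow> ('a \<Rightarrow> real) \<Rightarrow> ('a \<Rightarrow> 'a measure \<Rightarrow> real) \<Rightarrow> 'a measure \<Rightarrow> 'a \<Rightarrow> real"
  where "T_hat V0 Vb V \<mu> x = psi V0 Vb V x \<mu> / (\<integral>y. psi V0 Vb V y \<mu> \<partial>ref_measure Vb)"

definition I_map :: "('a::euclidean_space \<Rightarrow> real) \<Rightarrow> ('a \<Rightarrow> real) \<Rightarrow> 'a measure" where
  "I_map Vb f = density (ref_measure Vb) (\<lambda>x. ennreal (f x))"

definition L_op ::
    "('a::euclidean_space \<Rightarrow> real) \<Rightarrow> ('a \<Rightarrow> 'a measure \<Rightarrow> real) \<Rightarrow> 'a measure \<Rightarrow> ('a \<Rightarrow> real) \<Rightarrow> 'a \<Rightarrow> real"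
  where "L_op V0 V \<mu> g x = weak_laplace g x - weak_grad (\<lambda>y. V0 y + V y \<mu>) x \<bullet> weak_grad g x"

section \<open>The conditions\<close>

text \<open>
  Functions on $[0,\infty)$ are total functions whose values on the negative axis are irrelevant.
  Inequalities hold pointwise, except those involving weak derivatives, which hold almost everywhere.
\<close>

definition H1 ::
    "ennreal \<Rightarrow> real \<Rightarrow> ('a::euclidean_space \<Rightarrow> real) \<Rightarrow> ('a \<Rightarrow> real) \<Rightarrow> bool" where
  "H1 p q V0 Vb \<longleftrightarrow>
     V0 \<in> borel_measurable borel \<and> Vb \<in> borel_measurable borel \<and>
     integrable lborel (\<lambda>x. exp (- V0 x)) \<and> integrable lborel (\<lambda>x. exp (- Vb x)) \<and>
     of_nat DIM('a) < p \<and> 1 \<le> q \<and>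
     V0 \<in> sobolev_wt 1 p (ennreal q) (ref_measure Vb) \<and>
     Vb \<in> sobolev_wt 1 p (ennreal q) (ref_measure Vb)"

definition H2 ::
    "ennreal \<Rightarrow> real \<Rightarrow> ('a::euclidean_space \<Rightarrow> real) \<Rightarrow> ('a \<Rightarrow> real) \<Rightarrow>
     ('a \<Rightarrow> 'a measure \<Rightarrow> real) \<Rightarrow> ('a \<Rightarrow> real) \<Rightarrow> bool" where
  "H2 p q Vb W0 V F0 \<longleftrightarrow>
     W0 \<in> borel_measurable borel \<and> (\<forall>x. 1 \<le> W0 x) \<and> integrable (ref_measure Vb) W0 \<and>
     (\<lambda>(x, \<mu>). V x \<mu>) \<in> borel_measurable (borel \<Otimes>\<^sub>M prob_wt_borel W0) \<and>
     (\<forall>\<mu>\<in>prob_wt W0. (\<lambda>x. V x \<mu>) \<in> sobolev_loc 1 p) \<and>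
     (\<forall>x. 0 \<le> F0 x) \<and> F0 \<in> Lp_loc \<infinity> \<and>
     (\<exists>F1 F2 F3 C.
        (\<forall>x. 0 \<le> F2 x) \<and> F2 \<in> Lp (ref_measure Vb) (ennreal q) \<and> F2 \<in> Lp_loc p \<and>
        (\<forall>r\<ge>0. 0 \<le> F1 r) \<and> mono_on {0..} F1 \<and> (F1 \<longlongrightarrow> 0) (at_right 0) \<and>
        (\<forall>r\<ge>0. 0 \<le> F3 r) \<and> mono_on {0..} F3 \<and>
        (\<forall>\<mu>\<in>prob_wt W0. \<forall>\<nu>\<in>prob_wt W0. \<forall>x. \<bar>V x \<mu> - V x \<nu>\<bar> \<le> F0 x * F1 (wt_dist W0 \<mu> \<nu>)) \<and>
        (\<forall>x. \<bar>V x (ref_measure Vb)\<bar> \<le> C * (F0 x + 1)) \<and>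
        (\<forall>\<mu>\<in>prob_wt W0. AE x in lborel.
           norm (weak_grad (\<lambda>y. V y \<mu>) x) \<le> F2 x * F3 (wt_norm W0 \<mu>)))"

definition H3 ::
    "('a::euclidean_space \<Rightarrow> real) \<Rightarrow> ('a \<Rightarrow> real) \<Rightarrow> ('a \<Rightarrow> real) \<Rightarrow> bool" where
  "H3 V0 Vb F0 \<longleftrightarrow>
     (\<exists>F4 :: real \<Rightarrow> real. (\<forall>r\<ge>0. 0 \<le> F4 r) \<and> mono_on {0..} F4 \<and>
        (\<forall>\<beta>\<ge>0. \<forall>x. - V0 x + \<beta> * F0 x \<le> - Vb x + F4 \<beta>))"

definition cond_W1 :: "('a::euclidean_space \<Rightarrow> real) \<Rightarrow> ('a \<Rightarrow> real) \<Rightarrow> bool" where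
  "cond_W1 W0 W \<longleftrightarrow>
     W \<in> borel_measurable borel \<and> (\<forall>x. 1 \<le> W x) \<and>
     filterlim W at_top at_infinity \<and>
     bdd_above (range (\<lambda>x. W0 x / W x)) \<and>
     Limsup at_infinity (\<lambda>x. ereal (W0 x / W x)) = 0"

text \<open>Here \<open>W1\<close> is the Lyapunov function $W_1$, not to be confused with the name of the condition (W1).\<close>

definition cond_W2 ::
    "('a::euclidean_space \<Rightarrow> real) \<Rightarrow> ('a \<Rightarrow> 'a measure \<Rightarrow> real) \<Rightarrow> ('a \<Rightarrow> real) \<Rightarrow> ('a \<Rightarrow> real) \<Rightarrow> bool"
  where
  "cond_W2 V0 V W W1 \<longleftrightarrow>
     W1 \<in> borel_measurable borel \<and> (\<forall>x. 0 < W1 x) \<and> W1 \<in> sobolev_loc 2 1 \<and>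
     (\<exists>G1 G2 :: real \<Rightarrow> real.
        strict_mono_on {0..} G1 \<and> strict_mono_on {0..} G2 \<and> convex_on {0..} G2 \<and>
        Limsup at_top (\<lambda>r. ereal (G1 r / G2 r)) < 1 \<and>
        (\<forall>\<mu>\<in>prob_wt W. AE x in lborel. L_op V0 V \<mu> W1 x \<le> G1 (wt_norm W \<mu>) - G2 (W x)))"

text \<open>The conjugate exponent $q/(q-1)$, equal to $\infty$ for $q = 1$.\<close>

definition conj_exponent :: "real \<Rightarrow> ennreal" where
  "conj_exponent q = (if q = 1 then \<infinity> else ennreal (q / (q - 1)))"

end

theory Submission
  imports Defs "HOL-Library.Diagonal_Subsequence"
begin

text \<open>
  Schauder's theorem is applied in $L^1(W_0\bar\mu)$ to the set of densities $f$ with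
  $\bar\mu(fW) \le M$. For $\mu = f\bar\mu$ put $\nu = \hat T(\cdot,\mu)\bar\mu$, whose Lebesgue density
  is proportional to $e^{-V_0-V(\cdot,\mu)}$. Integration by parts against cutoff functions gives
  $\nu(L_\mu W_1) = 0$, so (W2) and Jensen's inequality yield
  $G_2(\nu(W)) \le \nu(G_2(W)) \le G_1(\mu(W))$, and the set is invariant once $G_1(M) < G_2(M)$.

  By (H3) the densities $\hat T(\cdot,\mu)$ are bounded uniformly on this set. Since $W_0 \in L^1(\bar\mu)$,
  continuity and compactness of the map therefore reduce, by dominated convergence, to almost everywhere
  convergence of $V(\cdot,\mu_n)$. For a subsequence this follows from the local bounds on $V(\cdot,\mu_n)$ and
  its gradient: mollifications converge along a diagonal sequence, and they are close to
  $V(\cdot,\mu_n)$ in $L^1_{loc}$ uniformly in $n$.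

  Schauder's theorem itself comes from Kuhn's lemma on the cube $[0,1]^n \subseteq R^n$, because
  $n$ is the size of an $\varepsilon$-net and hence not available as the dimension of a type.
\<close>

section \<open>A fixed point theorem in $L^1$\<close>

text \<open>The continuity step and the compactness step share one limit lemma, stated for an
  arbitrary almost everywhere limit v of the interactions: along a compactness sequence no measure
  \<mu> with v = V(., \<mu>) is known. Accordingly the bounds on Gibbs densities are proved for
  every v inside the envelope |C| + \<beta> F0. The moment bound cannot be carried to limits by
  convergence in L^1(W0 mub), which does not control W; Fatou's lemma preserves it. Jensen's
  inequality needs W to be integrable against the new measure. This is derived: (W2) dominates G2(W)
  by G1 - L W1, which is integrable because the condition on p1 makes the product of the drift and
  the gradient of W1 integrable by Hoelder's inequality, and a convex strictly increasing G2 grows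
  at least linearly. Schauder's theorem yields the fixed point only up to a null set. Since T f
  depends on f through its measure alone, one more application of T turns this into equality at
  every point.\<close>

lemma convergent_subseq_finite:
  fixes z :: "nat \<Rightarrow> nat \<Rightarrow> real"
  assumes "\<And>k i. i < n \<Longrightarrow> \<bar>z k i\<bar> \<le> B"
  shows "\<exists>r. strict_mono r \<and> (\<forall>i<n. convergent (\<lambda>k. z (r k) i))"
  using assms
proof (induction n)
  case 0
  then show ?case using strict_mono_id by auto
next
  case (Suc n)
  then obtain r where r: "strict_mono r" "\<forall>i<n. convergent (\<lambda>k. z (r k) i)"
    using less_Suc_eq by blast
  have "bounded (range (\<lambda>k. z (r k) n))"
    using Suc.prems[of n] by (auto simp: bounded_iff)
  from bounded_imp_convergent_subsequence[OF this]
  obtain l s where s: "strict_mono s" "((\<lambda>k. z (r k) n) \<circ> s) \<longlonglongrightarrow> l" by blast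
  have "convergent (\<lambda>k. z ((r \<circ> s) k) i)" if "i < Suc n" for i
  proof (cases "i = n")
    case True
    then show ?thesis using s by (auto simp: convergent_def o_def)
  next
    case False
    then have "convergent (\<lambda>k. z (r k) i)" using r that by auto
    then show ?thesis using convergent_subseq_convergent[OF _ s(1)] by (auto simp: o_def)
  qed
  then show ?case using strict_mono_o[OF r(1) s(1)] by blast
qed

section \<open>Brouwer's theorem on the unit cube of R^n with n a variable\<close>

definition cube_near :: "nat \<Rightarrow> real \<Rightarrow> (nat \<Rightarrow> real) \<Rightarrow> (nat \<Rightarrow> real) \<Rightarrow> bool" where
  "cube_near n e z u \<longleftrightarrow> (\<forall>j<n. 0 \<le> u j \<and> u j \<le> 1 \<and> \<bar>u j - z j\<bar> \<le> e)"

text \<open>Grid points of mesh 1/p are labelled, in each coordinate, by whether f moves that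
  coordinate up (0) or down (1). Kuhn's lemma supplies a cell that carries both labels in every
  coordinate. The witnesses a and b depend on i, so no single approximate fixed point is claimed
  here; continuity merges them in the limit.\<close>

lemma kuhn_approx_fixpoint:
  fixes f :: "(nat \<Rightarrow> real) \<Rightarrow> nat \<Rightarrow> real"
  assumes self: "\<And>x i. (\<And>j. j < n \<Longrightarrow> 0 \<le> x j \<and> x j \<le> 1) \<Longrightarrow> i < n \<Longrightarrow> 0 \<le> f x i \<and> f x i \<le> 1"
    and p: "0 < (p::nat)"
  shows "\<exists>z. (\<forall>i<n. 0 \<le> z i \<and> z i \<le> 1) \<and>
     (\<forall>i<n. \<exists>a b. cube_near n (1 / p) z a \<and> cube_near n (1 / p) z b \<and> a i \<le> f a i \<and> f b i \<le> b i)"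
proof -
  define c where "c x = (\<lambda>i. real (x i) / real p)" for x :: "nat \<Rightarrow> nat"
  \<comment> \<open>The test \<open>x i \<noteq> p\<close> forces label 1 on the upper face, as
    Kuhn's lemma demands, even where f keeps that coordinate fixed. It is consistent with the
    meaning "not increased" because f stays below 1.\<close>
  define lab where "lab x i = (if x i \<noteq> p \<and> f (c x) i \<ge> c x i then 0 else 1::nat)" for x i
  have cube: "0 \<le> c x j \<and> c x j \<le> 1" if "\<forall>i<n. x i \<le> p" "j < n" for x j
    using that p by (auto simp: c_def)
  have l1: "\<forall>x. (\<forall>i<n. x i \<le> p) \<longrightarrow> (\<forall>i<n. lab x i = 0 \<or> lab x i = 1)"
    by (auto simp: lab_def)
  have l2: "\<forall>x. (\<forall>i<n. x i \<le> p) \<longrightarrow> (\<forall>i<n. x i = 0 \<longrightarrow> lab x i = 0)"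
    using self cube p by (auto simp: lab_def c_def)
  have l3: "\<forall>x. (\<forall>i<n. x i \<le> p) \<longrightarrow> (\<forall>i<n. x i = p \<longrightarrow> lab x i = 1)"
    by (auto simp: lab_def)
  obtain q where q: "\<forall>i<n. q i < p"
    "\<forall>i<n. \<exists>r s. (\<forall>j<n. q j \<le> r j \<and> r j \<le> q j + 1) \<and> (\<forall>j<n. q j \<le> s j \<and> s j \<le> q j + 1) \<and> lab r i \<noteq> lab s i"
    using kuhn_lemma[OF p l1 l2 l3] by blast
  have near: "cube_near n (1 / p) (c q) (c r)"
    if "\<forall>j<n. q j \<le> r j \<and> r j \<le> q j + 1" for r
    unfolding cube_near_def
  proof (intro allI impI)
    fix j assume "j < n"
    then have "r j \<le> q j + 1" "q j \<le> r j" "q j < p" using that q by auto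
    then have "\<bar>real (r j) - real (q j)\<bar> \<le> 1" "real (r j) \<le> p" by linarith+
    then show "0 \<le> c r j \<and> c r j \<le> 1 \<and> \<bar>c r j - c q j\<bar> \<le> 1 / p"
      using p by (auto simp: c_def diff_divide_distrib[symmetric] abs_divide divide_right_mono)
  qed
  have l0: "c r i \<le> f (c r) i" if "lab r i = 0" for r i
    using that by (auto simp: lab_def split: if_splits)
  have l1: "f (c r) i \<le> c r i" if "lab r i = 1" "\<forall>j<n. q j \<le> r j \<and> r j \<le> q j + 1" "i < n" for r i
  proof (cases "r i = p")
    case True
    then have "c r i = 1" using p by (simp add: c_def)
    moreover have "f (c r) i \<le> 1" using self[of "c r" i] near[OF that(2)] that(3) unfolding cube_near_def by blast
    ultimately show ?thesis by simp
  next
    case False then show ?thesis using that by (auto simp: lab_def split: if_splits)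
  qed
  have "\<exists>a b. cube_near n (1 / p) (c q) a \<and> cube_near n (1 / p) (c q) b \<and> a i \<le> f a i \<and> f b i \<le> b i"
    if i: "i < n" for i
  proof -
    obtain r s where rs: "\<forall>j<n. q j \<le> r j \<and> r j \<le> q j + 1" "\<forall>j<n. q j \<le> s j \<and> s j \<le> q j + 1" "lab r i \<noteq> lab s i"
      using q(2) i by blast
    have dis: "(lab r i = 0 \<and> lab s i = 1) \<or> (lab r i = 1 \<and> lab s i = 0)"
      using rs(3) by (auto simp: lab_def split: if_splits)
    then show ?thesis
    proof
      assume "lab r i = 0 \<and> lab s i = 1"
      then show ?thesis using near[OF rs(1)] near[OF rs(2)] l0 l1[OF _ rs(2) i]
        by (intro exI[of _ "c r"] exI[of _ "c s"]) auto
    next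
      assume "lab r i = 1 \<and> lab s i = 0"
      then show ?thesis using near[OF rs(1)] near[OF rs(2)] l0 l1[OF _ rs(1) i]
        by (intro exI[of _ "c s"] exI[of _ "c r"]) auto
    qed
  qed
  moreover have "0 \<le> c q j \<and> c q j \<le> 1" if "j < n" for j
    using cube[of q j] q(1) that by (auto simp: less_imp_le)
  ultimately show ?thesis by (intro exI[of _ "c q"] conjI) blast+
qed

text \<open>As the mesh shrinks, the base points z have a convergent subsequence, and for every
  coordinate i both witnesses converge to the same limit x. The inequalities at the two witnesses
  then become the two halves of \<open>f x i = x i\<close>. Continuity is sequential and
  coordinatewise, since only the first n coordinates of a point count.\<close>

lemma brouwer_cube_nat:
  fixes f :: "(nat \<Rightarrow> real) \<Rightarrow> nat \<Rightarrow> real"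
  assumes self: "\<And>x i. (\<And>j. j < n \<Longrightarrow> 0 \<le> x j \<and> x j \<le> 1) \<Longrightarrow> i < n \<Longrightarrow> 0 \<le> f x i \<and> f x i \<le> 1"
    and cont: "\<And>X x i. (\<And>k j. j < n \<Longrightarrow> 0 \<le> X k j \<and> X k j \<le> 1) \<Longrightarrow> (\<And>j. j < n \<Longrightarrow> 0 \<le> x j \<and> x j \<le> 1) \<Longrightarrow>
       (\<And>j. j < n \<Longrightarrow> (\<lambda>k. X k j) \<longlonglongrightarrow> x j) \<Longrightarrow> i < n \<Longrightarrow> (\<lambda>k. f (X k) i) \<longlonglongrightarrow> f x i"
  shows "\<exists>x. (\<forall>i<n. 0 \<le> x i \<and> x i \<le> 1 \<and> f x i = x i)"
proof -
  have "\<forall>k. \<exists>z. (\<forall>i<n. 0 \<le> z i \<and> z i \<le> 1) \<and>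
     (\<forall>i<n. \<exists>a b. cube_near n (1 / real (Suc k)) z a \<and> cube_near n (1 / real (Suc k)) z b \<and> a i \<le> f a i \<and> f b i \<le> b i)"
    by (intro allI kuhn_approx_fixpoint self) auto
  then obtain z where z: "\<And>k i. i < n \<Longrightarrow> 0 \<le> z k i \<and> z k i \<le> 1"
    and ab: "\<And>k i. i < n \<Longrightarrow> \<exists>a b. cube_near n (1 / real (Suc k)) (z k) a \<and> cube_near n (1 / real (Suc k)) (z k) b \<and> a i \<le> f a i \<and> f b i \<le> b i"
    unfolding choice_iff by blast
  from ab have "\<forall>k i. \<exists>a b. i < n \<longrightarrow> cube_near n (1 / real (Suc k)) (z k) a \<and>
      cube_near n (1 / real (Suc k)) (z k) b \<and> a i \<le> f a i \<and> f b i \<le> b i"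
    by blast
  then obtain a b where "\<And>k i. i < n \<Longrightarrow> cube_near n (1 / real (Suc k)) (z k) (a k i) \<and>
      cube_near n (1 / real (Suc k)) (z k) (b k i) \<and> a k i i \<le> f (a k i) i \<and> f (b k i) i \<le> b k i i"
    unfolding choice_iff by blast
  then have a: "\<And>k i j. i < n \<Longrightarrow> j < n \<Longrightarrow> 0 \<le> a k i j \<and> a k i j \<le> 1 \<and> \<bar>a k i j - z k j\<bar> \<le> 1 / real (Suc k)"
    and b: "\<And>k i j. i < n \<Longrightarrow> j < n \<Longrightarrow> 0 \<le> b k i j \<and> b k i j \<le> 1 \<and> \<bar>b k i j - z k j\<bar> \<le> 1 / real (Suc k)"
    and fa: "\<And>k i. i < n \<Longrightarrow> a k i i \<le> f (a k i) i" and fb: "\<And>k i. i < n \<Longrightarrow> f (b k i) i \<le> b k i i"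
    unfolding cube_near_def by blast+
  obtain r where r: "strict_mono r" "\<forall>i<n. convergent (\<lambda>k. z (r k) i)"
    using convergent_subseq_finite[of n z 1] z by force
  then obtain x where x: "\<And>i. i < n \<Longrightarrow> (\<lambda>k. z (r k) i) \<longlonglongrightarrow> x i"
    unfolding convergent_def by metis
  have x01: "0 \<le> x i \<and> x i \<le> 1" if "i < n" for i
    using z[OF that] x[OF that] by (meson LIMSEQ_le_const LIMSEQ_le_const2)
  have sm: "(\<lambda>k. 1 / real (Suc (r k))) \<longlonglongrightarrow> 0"
    using LIMSEQ_subseq_LIMSEQ[OF LIMSEQ_inverse_real_of_nat r(1)] by (simp add: o_def inverse_eq_divide)
  have conv: "(\<lambda>k. c (r k) i j) \<longlonglongrightarrow> x j"
    if c: "\<And>k i j. i < n \<Longrightarrow> j < n \<Longrightarrow> \<bar>c k i j - z k j\<bar> \<le> 1 / real (Suc k)" and ij: "i < n" "j < n"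
    for c :: "nat \<Rightarrow> nat \<Rightarrow> nat \<Rightarrow> real" and i j
  proof -
    have "(\<lambda>k. c (r k) i j - z (r k) j) \<longlonglongrightarrow> 0"
      by (rule Lim_null_comparison[OF _ sm]) (use c[OF ij] in auto)
    from tendsto_add[OF this x[OF ij(2)]] show ?thesis by simp
  qed
  have "f x i = x i" if i: "i < n" for i
  proof (rule antisym)
    have cb: "(\<lambda>k. b (r k) i j) \<longlonglongrightarrow> x j" if "j < n" for j by (rule conv) (use b i that in auto)
    have "(\<lambda>k. f (b (r k) i) i) \<longlonglongrightarrow> f x i"
      by (rule cont) (use b x01 cb i in auto)
    then show "f x i \<le> x i" using cb[OF i] fb[OF i] by (meson LIMSEQ_le)
    have ca: "(\<lambda>k. a (r k) i j) \<longlonglongrightarrow> x j" if "j < n" for j by (rule conv) (use a i that in auto)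
    have "(\<lambda>k. f (a (r k) i) i) \<longlonglongrightarrow> f x i"
      by (rule cont) (use a x01 ca i in auto)
    then show "x i \<le> f x i" using ca[OF i] fa[OF i] by (meson LIMSEQ_le)
  qed
  with x01 show ?thesis by blast
qed


section \<open>Schauder's theorem in L^1\<close>

definition L1_dist :: "'b measure \<Rightarrow> ('b \<Rightarrow> real) \<Rightarrow> ('b \<Rightarrow> real) \<Rightarrow> real" where
  "L1_dist M f g = (\<integral>x. \<bar>f x - g x\<bar> \<partial>M)"

lemma L1_dist_nonneg: "0 \<le> L1_dist M f g"
  by (simp add: L1_dist_def)

lemma L1_dist_commute: "L1_dist M f g = L1_dist M g f"
  by (simp add: L1_dist_def abs_minus_commute)

lemma L1_dist_triangle:
  assumes "integrable M f" "integrable M g" "integrable M h"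
  shows "L1_dist M f h \<le> L1_dist M f g + L1_dist M g h"
proof -
  have "L1_dist M f h \<le> (\<integral>x. \<bar>f x - g x\<bar> + \<bar>g x - h x\<bar> \<partial>M)"
    unfolding L1_dist_def using assms by (intro integral_mono) auto
  also have "\<dots> = L1_dist M f g + L1_dist M g h"
    unfolding L1_dist_def using assms by (intro Bochner_Integration.integral_add) auto
  finally show ?thesis .
qed

lemma convex_combination_mem:
  fixes K :: "('b \<Rightarrow> real) set" and w :: "nat \<Rightarrow> real"
  assumes conv: "\<And>f g t. f \<in> K \<Longrightarrow> g \<in> K \<Longrightarrow> 0 \<le> t \<Longrightarrow> t \<le> 1 \<Longrightarrow> (\<lambda>x. (1 - t) * f x + t * g x) \<in> K"
    and "\<And>i. i < m \<Longrightarrow> y i \<in> K" "\<And>i. i < m \<Longrightarrow> 0 \<le> w i" "(\<Sum>i<m. w i) = 1"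
  shows "(\<lambda>x. \<Sum>i<m. w i * y i x) \<in> K"
  using assms(2-)
proof (induction m arbitrary: w)
  case 0
  then show ?case by simp
next
  case (Suc m)
  define s where "s = (\<Sum>i<m. w i)"
  have s: "0 \<le> s" "s + w m = 1" "0 \<le> w m" using Suc.prems by (auto simp: s_def intro: sum_nonneg)
  show ?case
  \<comment> \<open>The first m points are renormalised by their total weight s; if s vanishes, the
    combination is the last point.\<close>
  proof (cases "s = 0")
    case True
    then have "\<forall>i<m. w i = 0"
      using Suc.prems(2) unfolding s_def by (subst (asm) sum_nonneg_eq_0_iff) auto
    then show ?thesis using True s Suc.prems(1)[of m] by simp
  next
    case False
    have "(\<Sum>i<m. w i / s) = 1" using False by (simp add: s_def flip: sum_divide_distrib)
    then have "(\<lambda>x. \<Sum>i<m. w i / s * y i x) \<in> K"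
      using Suc.prems s by (intro Suc.IH) auto
    from conv[OF this Suc.prems(1)[of m], of "w m"]
    have "(\<lambda>x. (1 - w m) * (\<Sum>i<m. w i / s * y i x) + w m * y m x) \<in> K" using s by auto
    moreover have "1 - w m = s" using s by simp
    ultimately show ?thesis using False by (simp add: sum_distrib_left)
  qed
qed

text \<open>Schauder projection. The weight \<omega> i z is positive exactly when y i lies within e
  of T z, so the normalised weights replace T z by a convex combination of nearby net points. In
  terms of coefficient vectors this is a self-map of a cube, to which Brouwer's theorem applies. The
  net approximates the image of T only, because K itself need not be precompact.\<close>

lemma schauder_approx:
  fixes M :: "'b measure" and K :: "('b \<Rightarrow> real) set"
  assumes int: "\<And>f. f \<in> K \<Longrightarrow> integrable M f"
    and conv: "\<And>f g t. f \<in> K \<Longrightarrow> g \<in> K \<Longrightarrow> 0 \<le> t \<Longrightarrow> t \<le> 1 \<Longrightarrow> (\<lambda>x. (1 - t) * f x + t * g x) \<in> K"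
    and T: "\<And>f. f \<in> K \<Longrightarrow> T f \<in> K"
    and cont: "\<And>X z. (\<And>k. X k \<in> K) \<Longrightarrow> z \<in> K \<Longrightarrow> (\<lambda>k. L1_dist M (X k) z) \<longlonglongrightarrow> 0 \<Longrightarrow>
          (\<lambda>k. L1_dist M (T (X k)) (T z)) \<longlonglongrightarrow> 0"
    and y: "\<And>i. i < m \<Longrightarrow> y i \<in> K"
    and net: "\<And>z. z \<in> K \<Longrightarrow> \<exists>i<m. L1_dist M (T z) (y i) < e"
    and m: "0 < (m::nat)"
  shows "\<exists>z\<in>K. L1_dist M (T z) z \<le> e"
proof -
  \<comment> \<open>The second summand keeps the total weight \<open>D x\<close> at least 1 on the whole cube; it vanishes
    at a fixed point, whose coordinates sum to 1.\<close>
  define c where "c x i = x i + max 0 (1 - (\<Sum>j<m. x j)) / real m" for x :: "nat \<Rightarrow> real" and i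
  define D where "D x = (\<Sum>j<m. c x j)" for x
  define \<phi> where "\<phi> x = (\<lambda>t. \<Sum>i<m. c x i / D x * y i t)" for x
  define \<omega> where "\<omega> i z = max 0 (e - L1_dist M (T z) (y i))" for i z
  define S where "S z = (\<Sum>i<m. \<omega> i z)" for z
  define f where "f x i = \<omega> i (\<phi> x) / S (\<phi> x)" for x i
  have D: "D x = max 1 (\<Sum>j<m. x j)" for x
    using m by (simp add: D_def c_def sum.distrib)
  have D1: "1 \<le> D x" for x by (simp add: D)
  have \<phi>K: "\<phi> x \<in> K" if "\<And>j. j < m \<Longrightarrow> 0 \<le> x j" for x
    unfolding \<phi>_def
  proof (rule convex_combination_mem[OF conv y])
    show "(\<Sum>i<m. c x i / D x) = 1" using D1[of x] by (simp add: D_def flip: sum_divide_distrib)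
    show "0 \<le> c x i / D x" if "i < m" for i
      using D1[of x] that \<open>\<And>j. j < m \<Longrightarrow> 0 \<le> x j\<close>[of i] by (simp add: c_def)
  qed auto
  have \<omega>0: "0 \<le> \<omega> i z" for i z by (simp add: \<omega>_def)
  have S: "0 < S z" if "z \<in> K" for z
  proof -
    obtain i where "i < m" "L1_dist M (T z) (y i) < e" using net[OF \<open>z \<in> K\<close>] by blast
    then show ?thesis unfolding S_def by (intro sum_pos2[of _ i]) (auto simp: \<omega>_def)
  qed
  have "\<exists>x. (\<forall>i<m. 0 \<le> x i \<and> x i \<le> 1 \<and> f x i = x i)"
  proof (rule brouwer_cube_nat)
    fix x i assume x: "\<And>j. j < m \<Longrightarrow> 0 \<le> x j \<and> x j \<le> (1::real)" and i: "i < m"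
    have K: "\<phi> x \<in> K" using x by (intro \<phi>K) auto
    have "\<omega> i (\<phi> x) \<le> S (\<phi> x)"
      unfolding S_def by (rule member_le_sum) (use \<omega>0 i in auto)
    then show "0 \<le> f x i \<and> f x i \<le> 1" using S[OF K] \<omega>0 by (simp add: f_def)
  next
    fix X x i
    assume X: "\<And>k j. j < m \<Longrightarrow> 0 \<le> X k j \<and> X k j \<le> (1::real)"
      and x: "\<And>j. j < m \<Longrightarrow> 0 \<le> x j \<and> x j \<le> (1::real)"
      and lim: "\<And>j. j < m \<Longrightarrow> (\<lambda>k. X k j) \<longlonglongrightarrow> x j" and i: "i < m"
    have XK: "\<phi> (X k) \<in> K" for k using X by (intro \<phi>K) auto
    have xK: "\<phi> x \<in> K" using x by (intro \<phi>K) auto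
    have cl: "(\<lambda>k. c (X k) j) \<longlonglongrightarrow> c x j" if "j < m" for j
      unfolding c_def by (intro tendsto_intros lim that) (use m in auto)
    have Dl: "(\<lambda>k. D (X k)) \<longlonglongrightarrow> D x"
      unfolding D_def by (intro tendsto_sum cl) auto
    have "(\<lambda>k. \<Sum>j<m. \<bar>c (X k) j / D (X k) - c x j / D x\<bar> * (\<integral>t. \<bar>y j t\<bar> \<partial>M)) \<longlonglongrightarrow> (\<Sum>j<m. \<bar>c x j / D x - c x j / D x\<bar> * (\<integral>t. \<bar>y j t\<bar> \<partial>M))"
      by (intro tendsto_intros cl Dl) (use D1[of x] in auto)
    then have l0: "(\<lambda>k. \<Sum>j<m. \<bar>c (X k) j / D (X k) - c x j / D x\<bar> * (\<integral>t. \<bar>y j t\<bar> \<partial>M)) \<longlonglongrightarrow> 0" by simp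
    have "L1_dist M (\<phi> (X k)) (\<phi> x) \<le> (\<Sum>j<m. \<bar>c (X k) j / D (X k) - c x j / D x\<bar> * (\<integral>t. \<bar>y j t\<bar> \<partial>M))" for k
    proof -
      have "L1_dist M (\<phi> (X k)) (\<phi> x) \<le> (\<integral>t. (\<Sum>j<m. \<bar>c (X k) j / D (X k) - c x j / D x\<bar> * \<bar>y j t\<bar>) \<partial>M)"
        unfolding L1_dist_def
      proof (rule integral_mono)
        show "integrable M (\<lambda>t. \<bar>\<phi> (X k) t - \<phi> x t\<bar>)" using int[OF XK] int[OF xK] by auto
        show "integrable M (\<lambda>t. \<Sum>j<m. \<bar>c (X k) j / D (X k) - c x j / D x\<bar> * \<bar>y j t\<bar>)"
          using int[OF y] by (auto intro!: Bochner_Integration.integrable_sum)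
        show "\<bar>\<phi> (X k) t - \<phi> x t\<bar> \<le> (\<Sum>j<m. \<bar>c (X k) j / D (X k) - c x j / D x\<bar> * \<bar>y j t\<bar>)" for t
        proof -
          have "\<phi> (X k) t - \<phi> x t = (\<Sum>j<m. (c (X k) j / D (X k) - c x j / D x) * y j t)"
            unfolding \<phi>_def by (simp only: sum_subtractf[symmetric] left_diff_distrib[symmetric])
          also have "\<bar>\<dots>\<bar> \<le> (\<Sum>j<m. \<bar>(c (X k) j / D (X k) - c x j / D x) * y j t\<bar>)" by (rule sum_abs)
          finally show ?thesis by (simp only: abs_mult)
        qed
      qed
      also have "\<dots> = (\<Sum>j<m. \<bar>c (X k) j / D (X k) - c x j / D x\<bar> * (\<integral>t. \<bar>y j t\<bar> \<partial>M))"
        using int[OF y] by (subst Bochner_Integration.integral_sum) auto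
      finally show ?thesis .
    qed
    then have "(\<lambda>k. L1_dist M (\<phi> (X k)) (\<phi> x)) \<longlonglongrightarrow> 0"
      by (intro tendsto_sandwich[OF _ _ tendsto_const l0]) (auto simp: L1_dist_nonneg)
    from cont[OF XK xK this] have Tl: "(\<lambda>k. L1_dist M (T (\<phi> (X k))) (T (\<phi> x))) \<longlonglongrightarrow> 0" .
    have dl: "(\<lambda>k. L1_dist M (T (\<phi> (X k))) (y j)) \<longlonglongrightarrow> L1_dist M (T (\<phi> x)) (y j)" if "j < m" for j
    proof -
      have "\<bar>L1_dist M (T (\<phi> (X k))) (y j) - L1_dist M (T (\<phi> x)) (y j)\<bar> \<le> L1_dist M (T (\<phi> (X k))) (T (\<phi> x))" for k
        using L1_dist_triangle[of M "T (\<phi> (X k))" "T (\<phi> x)" "y j"] L1_dist_triangle[of M "T (\<phi> x)" "T (\<phi> (X k))" "y j"]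
          int[OF T[OF XK]] int[OF T[OF xK]] int[OF y[OF that]]
          L1_dist_commute[of M "T (\<phi> (X k))" "T (\<phi> x)"] by fastforce
      then have "(\<lambda>k. L1_dist M (T (\<phi> (X k))) (y j) - L1_dist M (T (\<phi> x)) (y j)) \<longlonglongrightarrow> 0"
        by (intro Lim_null_comparison[OF _ Tl]) auto
      then show ?thesis by (simp add: LIM_zero_iff)
    qed
    have \<omega>l: "(\<lambda>k. \<omega> j (\<phi> (X k))) \<longlonglongrightarrow> \<omega> j (\<phi> x)" if "j < m" for j
      unfolding \<omega>_def by (intro tendsto_intros dl that)
    show "(\<lambda>k. f (X k) i) \<longlonglongrightarrow> f x i"
      unfolding f_def by (intro tendsto_divide \<omega>l i) (use S[OF xK] \<omega>l in \<open>auto simp: S_def intro!: tendsto_sum\<close>)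
  qed
  then obtain x where x: "\<And>i. i < m \<Longrightarrow> 0 \<le> x i \<and> x i \<le> 1 \<and> f x i = x i" by blast
  define z where "z = \<phi> x"
  have zK: "z \<in> K" unfolding z_def using x by (intro \<phi>K) auto
  have xz: "x i = \<omega> i z / S z" if "i < m" for i using x[OF that] by (simp add: f_def z_def)
  have sx: "(\<Sum>i<m. x i) = 1"
    using xz S[OF zK] by (simp add: S_def flip: sum_divide_distrib)
  have z: "z t = (\<Sum>i<m. x i * y i t)" for t
    unfolding z_def \<phi>_def by (simp add: c_def D sx)
  have "L1_dist M (T z) z \<le> (\<integral>t. (\<Sum>i<m. x i * \<bar>T z t - y i t\<bar>) \<partial>M)"
    unfolding L1_dist_def
  proof (rule integral_mono)
    show "integrable M (\<lambda>t. \<bar>T z t - z t\<bar>)" using int[OF zK] int[OF T[OF zK]] by auto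
    show "integrable M (\<lambda>t. \<Sum>i<m. x i * \<bar>T z t - y i t\<bar>)"
      using int[OF y] int[OF T[OF zK]] by (auto intro!: Bochner_Integration.integrable_sum)
    fix t
    have "T z t - z t = (\<Sum>i<m. x i * (T z t - y i t))"
      using sx by (simp add: z right_diff_distrib sum_subtractf flip: sum_distrib_right)
    also have "\<bar>\<dots>\<bar> \<le> (\<Sum>i<m. \<bar>x i * (T z t - y i t)\<bar>)" by (rule sum_abs)
    also have "\<dots> = (\<Sum>i<m. x i * \<bar>T z t - y i t\<bar>)" using x by (auto simp: abs_mult)
    finally show "\<bar>T z t - z t\<bar> \<le> (\<Sum>i<m. x i * \<bar>T z t - y i t\<bar>)" .
  qed
  also have "\<dots> = (\<Sum>i<m. x i * L1_dist M (T z) (y i))"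
    unfolding L1_dist_def using int[OF y] int[OF T[OF zK]] by (subst Bochner_Integration.integral_sum) auto
  \<comment> \<open>A net point at distance at least e from T z has weight 0, so its term
    vanishes.\<close>
  also have "\<dots> \<le> (\<Sum>i<m. x i * e)"
  proof (rule sum_mono)
    fix i assume "i \<in> {..<m}"
    then show "x i * L1_dist M (T z) (y i) \<le> x i * e"
    proof (cases "L1_dist M (T z) (y i) < e")
      case True
      then show ?thesis using x[of i] \<open>i \<in> {..<m}\<close> by (intro mult_left_mono) auto
    next
      case False
      then show ?thesis using xz[of i] \<open>i \<in> {..<m}\<close> by (simp add: \<omega>_def)
    qed
  qed
  also have "\<dots> = e" using sx by (simp flip: sum_distrib_right)
  finally show ?thesis using zK by blast
qed

text \<open>Compactness is required of images only, and the limit is required to lie in K, which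
  takes the place of closedness. Failure of finite nets would produce a sequence with uniformly
  separated images, against \<open>comp\<close>; approximate fixed points with error 1/(k+1) then
  accumulate. As \<open>L1_dist\<close> is only a pseudometric on functions, the conclusion is an
  identity up to a null set.\<close>

theorem schauder_L1:
  fixes M :: "'b measure" and K :: "('b \<Rightarrow> real) set"
  assumes int: "\<And>f. f \<in> K \<Longrightarrow> integrable M f" and ne: "K \<noteq> {}"
    and conv: "\<And>f g t. f \<in> K \<Longrightarrow> g \<in> K \<Longrightarrow> 0 \<le> t \<Longrightarrow> t \<le> 1 \<Longrightarrow> (\<lambda>x. (1 - t) * f x + t * g x) \<in> K"
    and T: "\<And>f. f \<in> K \<Longrightarrow> T f \<in> K"
    and cont: "\<And>X z. (\<And>k. X k \<in> K) \<Longrightarrow> z \<in> K \<Longrightarrow> (\<lambda>k. L1_dist M (X k) z) \<longlonglongrightarrow> 0 \<Longrightarrow>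
          (\<lambda>k. L1_dist M (T (X k)) (T z)) \<longlonglongrightarrow> 0"
    and comp: "\<And>X. (\<And>k. X k \<in> K) \<Longrightarrow> \<exists>r y. strict_mono (r :: nat \<Rightarrow> nat) \<and> y \<in> K \<and>
          (\<lambda>k. L1_dist M (T (X (r k))) y) \<longlonglongrightarrow> 0"
  shows "\<exists>y\<in>K. L1_dist M (T y) y = 0"
proof -
  let ?d = "L1_dist M"
  have tri: "?d f h \<le> ?d f g + ?d g h" if "f \<in> K" "g \<in> K" "h \<in> K" for f g h
    using that by (intro L1_dist_triangle int)
  have net: "\<exists>m y. 0 < m \<and> (\<forall>i<m. y i \<in> K) \<and> (\<forall>z\<in>K. \<exists>i<(m::nat). ?d (T z) (y i) < e)" if e: "0 < e" for e
  proof (rule ccontr)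
    assume no: "\<not> ?thesis"
    \<comment> \<open>Images of earlier points are themselves admissible net points, so without a
      finite net every finite list can be prolonged by a point whose image is at distance at least e
      from all earlier images.\<close>
    have far: "\<exists>z\<in>K. \<forall>i<n. e \<le> ?d (T z) (T (X i))" if "\<forall>i<n. X i \<in> K" for n :: nat and X
    proof (rule ccontr)
      assume *: "\<not> ?thesis"
      then have "0 < n" using ne by (cases n) auto
      moreover have "\<forall>i<n. T (X i) \<in> K" using that T by blast
      moreover have "\<forall>z\<in>K. \<exists>i<n. ?d (T z) (T (X i)) < e" using * by (meson not_le)
      ultimately show False
        using no[unfolded not_ex, THEN spec, of n, THEN spec, of "\<lambda>i. T (X i)"] by blast
    qed
    have "\<exists>X::nat \<Rightarrow> 'b \<Rightarrow> real. \<forall>n. X n \<in> K \<and> (\<forall>i<n. e \<le> ?d (T (X n)) (T (X i)))"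
    proof (rule dependent_wellorder_choice)
      fix n and X :: "nat \<Rightarrow> 'b \<Rightarrow> real"
      assume "\<And>y. y < n \<Longrightarrow> X y \<in> K \<and> (\<forall>i<y. e \<le> ?d (T (X y)) (T (X i)))"
      then show "\<exists>r. r \<in> K \<and> (\<forall>i<n. e \<le> ?d (T r) (T (X i)))" using far[of n X] by blast
    qed simp
    then obtain X :: "nat \<Rightarrow> 'b \<Rightarrow> real" where X: "\<And>n. X n \<in> K"
      and sep: "\<And>i n. i < n \<Longrightarrow> e \<le> ?d (T (X n)) (T (X i))"
      by blast
    obtain r y where r: "strict_mono (r :: nat \<Rightarrow> nat)" and y: "y \<in> K" and l: "(\<lambda>k. ?d (T (X (r k))) y) \<longlonglongrightarrow> 0"
      using comp[of X, OF X] by (elim exE conjE) (rule that)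
    have "eventually (\<lambda>k. ?d (T (X (r k))) y < e / 2) sequentially"
      using l e by (intro order_tendstoD(2)[OF l]) auto
    then obtain N where N: "\<And>k. N \<le> k \<Longrightarrow> ?d (T (X (r k))) y < e / 2"
      by (auto simp: eventually_sequentially)
    have "e \<le> ?d (T (X (r (Suc N)))) (T (X (r N)))"
      by (rule sep) (use r in \<open>auto simp: strict_mono_def\<close>)
    also have "\<dots> \<le> ?d (T (X (r (Suc N)))) y + ?d y (T (X (r N)))"
      by (intro tri T X y)
    also have "\<dots> < e / 2 + e / 2"
      using N[of "Suc N"] N[of N] by (intro add_strict_mono) (auto simp: L1_dist_commute)
    finally show False by simp
  qed
  have "\<exists>z\<in>K. ?d (T z) z \<le> 1 / real (Suc k)" for k
  proof -
    have "0 < 1 / real (Suc k)" by simp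
    from net[OF this] obtain m :: nat and y :: "nat \<Rightarrow> 'b \<Rightarrow> real" where m: "0 < m" and yK: "\<forall>i<m. y i \<in> K"
      and n: "\<forall>z\<in>K. \<exists>i<m. ?d (T z) (y i) < 1 / real (Suc k)" by (elim exE conjE) (rule that)
    show ?thesis by (rule schauder_approx[OF int conv T cont, where m = m and y = y]) (use m yK n in auto)
  qed
  then obtain Z where Z: "\<And>k. Z k \<in> K" and dZ: "\<And>k. ?d (T (Z k)) (Z k) \<le> 1 / real (Suc k)"
    by metis
  obtain r y where r: "strict_mono (r :: nat \<Rightarrow> nat)" and y: "y \<in> K" and l: "(\<lambda>k. ?d (T (Z (r k))) y) \<longlonglongrightarrow> 0"
    using comp[of Z, OF Z] by (elim exE conjE) (rule that)
  have sm: "(\<lambda>k. 1 / real (Suc (r k))) \<longlonglongrightarrow> 0"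
    using LIMSEQ_subseq_LIMSEQ[OF LIMSEQ_inverse_real_of_nat r] by (simp add: o_def inverse_eq_divide)
  \<comment> \<open>\<open>comp\<close> only gives convergence of the images; the points follow
    because they are within 1/(r k + 1) of their images.\<close>
  have "(\<lambda>k. ?d (Z (r k)) y) \<longlonglongrightarrow> 0"
  proof (rule tendsto_sandwich[OF _ _ tendsto_const])
    show "(\<lambda>k. 1 / real (Suc (r k)) + ?d (T (Z (r k))) y) \<longlonglongrightarrow> 0"
      using tendsto_add[OF sm l] by simp
    have "?d (Z (r k)) y \<le> 1 / real (Suc (r k)) + ?d (T (Z (r k))) y" for k
      using tri[OF Z T[OF Z] y, of "r k" "r k"] dZ[of "r k"] by (simp add: L1_dist_commute)
    then show "eventually (\<lambda>k. ?d (Z (r k)) y \<le> 1 / real (Suc (r k)) + ?d (T (Z (r k))) y) sequentially" by auto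
  qed (auto simp: L1_dist_nonneg)
  from cont[OF Z y this] have l2: "(\<lambda>k. ?d (T (Z (r k))) (T y)) \<longlonglongrightarrow> 0" .
  have "?d (T y) y \<le> ?d (T (Z (r k))) (T y) + ?d (T (Z (r k))) y" for k
    using tri[OF T[OF y] T[OF Z] y, of "r k"] by (simp add: L1_dist_commute)
  then have "?d (T y) y \<le> 0 + 0"
    by (intro LIMSEQ_le_const[OF tendsto_add[OF l2 l]]) auto
  then show ?thesis using y L1_dist_nonneg[of M "T y" y] by (intro bexI[of _ y]) auto
qed

section \<open>Test functions and mollifiers\<close>

text \<open>A class of differentiable functions closed under coordinate derivatives contains all
  iterated partial derivatives of its members. Each smoothness proof below exhibits such a class,
  which avoids formulas for higher derivatives.\<close>

lemma smooth_coinduct: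
  assumes "f \<in> S"
    and diff: "\<And>f x. f \<in> S \<Longrightarrow> f differentiable (at x)"
    and step: "\<And>f i. f \<in> S \<Longrightarrow> i \<in> Basis \<Longrightarrow> (\<lambda>x. frechet_derivative f (at x) i) \<in> S"
  shows "smooth f"
proof -
  have "partials is f \<in> S" if "set is \<subseteq> Basis" for "is"
    using that by (induction "is") (auto intro: assms)
  then show ?thesis unfolding smooth_def using diff by blast
qed

lemma smooth_differentiable: "smooth f \<Longrightarrow> f differentiable (at x)"
  unfolding smooth_def by (metis empty_subsetI list.set(1) partials.simps(1))

lemma partials_append: "partials (is @ js) f = partials is (partials js f)"
  by (induction "is") auto

lemma smooth_partials: "smooth f \<Longrightarrow> set is \<subseteq> Basis \<Longrightarrow> smooth (partials is f)"
  unfolding smooth_def partials_append[symmetric] by auto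

lemma smooth_frechet_derivative:
  "smooth f \<Longrightarrow> i \<in> Basis \<Longrightarrow> smooth (\<lambda>x. frechet_derivative f (at x) i)"
  using smooth_partials[of f "[i]"] by simp

lemma smooth_has_derivative: "smooth f \<Longrightarrow> (f has_derivative frechet_derivative f (at x)) (at x)"
  using smooth_differentiable frechet_derivative_works by blast

lemma smooth_const: "smooth (\<lambda>x. c)"
proof (rule smooth_coinduct[where S = "range (\<lambda>c x. c)"])
  fix f :: "'a \<Rightarrow> real" and i :: 'a assume "f \<in> range (\<lambda>c x. c)"
  then show "(\<lambda>x. frechet_derivative f (at x) i) \<in> range (\<lambda>c x. c)"
    by (auto simp: frechet_derivative_const)
qed auto

text \<open>The product rule leads out of the set of products of two smooth functions, but not out
  of their finite sums, so this is the class to which coinduction applies.\<close>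

inductive smooth_product_sum :: "('a::euclidean_space \<Rightarrow> real) \<Rightarrow> bool" where
  prod: "smooth f \<Longrightarrow> smooth g \<Longrightarrow> smooth_product_sum (\<lambda>x. f x * g x)"
| add: "smooth_product_sum f \<Longrightarrow> smooth_product_sum g \<Longrightarrow> smooth_product_sum (\<lambda>x. f x + g x)"

lemma smooth_product_sum_deriv:
  assumes "smooth_product_sum f"
  shows "f differentiable (at x)"
    and "i \<in> Basis \<Longrightarrow> smooth_product_sum (\<lambda>x. frechet_derivative f (at x) i)"
proof -
  have "(\<forall>x. f differentiable (at x)) \<and> (\<forall>i\<in>Basis. smooth_product_sum (\<lambda>x. frechet_derivative f (at x) i))"
    using assms
  proof induction
    case (prod f g)
    have d: "((\<lambda>x. f x * g x) has_derivative
        (\<lambda>h. f x * frechet_derivative g (at x) h + frechet_derivative f (at x) h * g x)) (at x)" for x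
      by (intro has_derivative_mult smooth_has_derivative prod)
    have "smooth_product_sum (\<lambda>x. frechet_derivative (\<lambda>x. f x * g x) (at x) i)" if "i \<in> Basis" for i
      unfolding frechet_derivative_at[OF d, symmetric]
      by (intro smooth_product_sum.intros smooth_frechet_derivative prod that)
    then show ?case using d differentiableI by blast
  next
    case (add f g)
    then have d: "((\<lambda>x. f x + g x) has_derivative
        (\<lambda>h. frechet_derivative f (at x) h + frechet_derivative g (at x) h)) (at x)" for x
      by (intro has_derivative_add) (simp_all flip: frechet_derivative_works)
    have "smooth_product_sum (\<lambda>x. frechet_derivative (\<lambda>x. f x + g x) (at x) i)" if "i \<in> Basis" for i
      unfolding frechet_derivative_at[OF d, symmetric]
      by (intro smooth_product_sum.add) (use add that in auto)
    then show ?case using d differentiableI by blast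
  qed
  then show "f differentiable (at x)"
    and "i \<in> Basis \<Longrightarrow> smooth_product_sum (\<lambda>x. frechet_derivative f (at x) i)" by auto
qed

lemma smooth_mult: "smooth f \<Longrightarrow> smooth g \<Longrightarrow> smooth (\<lambda>x. f x * g x)"
  by (rule smooth_coinduct[where S = "Collect smooth_product_sum"])
     (auto intro: smooth_product_sum_deriv smooth_product_sum.prod)

lemma smooth_prod: "finite A \<Longrightarrow> (\<And>a. a \<in> A \<Longrightarrow> smooth (f a)) \<Longrightarrow> smooth (\<lambda>x. \<Prod>a\<in>A. f a x)"
  by (induction A rule: finite_induct) (auto intro: smooth_const smooth_mult)

lemma smooth_affine_compose:
  fixes f :: "real \<Rightarrow> real" and v :: "'a::euclidean_space"
  assumes "smooth f"
  shows "smooth (\<lambda>x. f (c + v \<bullet> x))"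
\<comment> \<open>The scalar k absorbs the factor v . i that the chain rule produces at each
  differentiation.\<close>
proof (rule smooth_coinduct[where S = "{\<lambda>x. k * f (c + v \<bullet> x) | k f. smooth f}"])
  show "(\<lambda>x. f (c + v \<bullet> x)) \<in> {\<lambda>x. k * f (c + v \<bullet> x) | k f. smooth f}"
    using assms by (auto intro!: exI[of _ 1] exI[of _ f])
  have d: "((\<lambda>x. k * f (c + v \<bullet> x)) has_derivative
       (\<lambda>h. k * (frechet_derivative f (at (c + v \<bullet> x)) (v \<bullet> h)))) (at x)"
    if "smooth f" for f k x
  proof -
    have "((\<lambda>x. c + v \<bullet> x) has_derivative (\<lambda>h. v \<bullet> h)) (at x)"
      by (auto intro!: derivative_eq_intros)
    from has_derivative_compose[OF this smooth_has_derivative[OF that]]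
    show ?thesis by (intro has_derivative_mult_right) (simp add: o_def)
  qed
  fix g and x assume g: "g \<in> {\<lambda>x. k * f (c + v \<bullet> x) | k f. smooth f}"
  then show "g differentiable (at x)" using d by (auto intro: differentiableI)
  fix i :: 'a assume i: "i \<in> Basis"
  obtain k f where f: "smooth f" "g = (\<lambda>x. k * f (c + v \<bullet> x))" using g by blast
  have lin: "frechet_derivative f (at s) (v \<bullet> i) = (v \<bullet> i) * frechet_derivative f (at s) 1" for s
    using linear_cmul[OF linear_frechet_derivative[OF smooth_differentiable[OF f(1)]], of _ "v \<bullet> i" 1] by simp
  have "(\<lambda>x. frechet_derivative g (at x) i) =
      (\<lambda>x. (k * (v \<bullet> i)) * (\<lambda>s. frechet_derivative f (at s) 1) (c + v \<bullet> x))"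
    unfolding f(2) frechet_derivative_at[OF d[OF f(1)], symmetric] lin by (simp add: mult.assoc)
  then show "(\<lambda>x. frechet_derivative g (at x) i) \<in> {\<lambda>x. k * f (c + v \<bullet> x) | k f. smooth f}"
    using smooth_frechet_derivative[OF f(1), of 1] unfolding Basis_real_def
    by (intro CollectI exI[of _ "k * (v \<bullet> i)"] exI[of _ "\<lambda>s. frechet_derivative f (at s) 1"]) simp
qed

text \<open>Reflection is what turns a test function into the kernel y |-> \<phi>(a - y) of a
  convolution. The sign (-1)^length later cancels the one in the definition of a weak
  derivative.\<close>

lemma smooth_reflect:
  fixes f :: "'a::euclidean_space \<Rightarrow> real"
  assumes "smooth f"
  shows "smooth (\<lambda>y. f (a - y))"
    and "set is \<subseteq> Basis \<Longrightarrow> partials is (\<lambda>y. f (a - y)) = (\<lambda>y. (-1) ^ length is * partials is f (a - y))"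
proof -
  have d: "((\<lambda>y. k * g (a - y)) has_derivative (\<lambda>h. k * (- frechet_derivative g (at (a - y)) h))) (at y)"
    if "smooth g" for g :: "'a \<Rightarrow> real" and k y
  proof -
    have "((\<lambda>y. a - y) has_derivative (\<lambda>h. - h)) (at y)" by (auto intro!: derivative_eq_intros)
    from has_derivative_compose[OF this smooth_has_derivative[OF that]]
    show ?thesis
      using linear_neg[OF linear_frechet_derivative[OF smooth_differentiable[OF that]]]
      by (intro has_derivative_mult_right) (simp add: o_def)
  qed
  have fd: "frechet_derivative (\<lambda>y. k * g (a - y)) (at y) i = - k * frechet_derivative g (at (a - y)) i"
    if "smooth g" for g :: "'a \<Rightarrow> real" and k y i
    unfolding frechet_derivative_at[OF d[OF that], symmetric] by simp
  show "smooth (\<lambda>y. f (a - y))"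
  proof (rule smooth_coinduct[where S = "{\<lambda>y. k * g (a - y) | k g. smooth g}"])
    show "(\<lambda>y. f (a - y)) \<in> {\<lambda>y. k * g (a - y) | k g. smooth g}"
      using assms by (auto intro!: exI[of _ 1] exI[of _ f])
    fix h and i :: 'a assume h: "h \<in> {\<lambda>y. k * g (a - y) | k g. smooth g}"
    then show "h differentiable (at x)" for x using d by (auto intro: differentiableI)
    assume "i \<in> Basis"
    obtain k g where g: "smooth g" "h = (\<lambda>y. k * g (a - y))" using h by blast
    have "(\<lambda>x. frechet_derivative h (at x) i) = (\<lambda>y. - k * (\<lambda>x. frechet_derivative g (at x) i) (a - y))"
      using fd[OF g(1)] by (simp add: g(2))
    then show "(\<lambda>x. frechet_derivative h (at x) i) \<in> {\<lambda>y. k * g (a - y) | k g. smooth g}"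
      using smooth_frechet_derivative[OF g(1) \<open>i \<in> Basis\<close>]
      by (intro CollectI exI[of _ "- k"] exI[of _ "\<lambda>x. frechet_derivative g (at x) i"]) simp
  qed
  show "partials is (\<lambda>y. f (a - y)) = (\<lambda>y. (-1) ^ length is * partials is f (a - y))" if "set is \<subseteq> Basis"
    using that
  proof (induction "is")
    case (Cons i "is")
    then show ?case using fd[OF smooth_partials[OF assms, of "is"]] by simp
  qed simp
qed

section \<open>A smooth bump function\<close>

lemma tendsto_poly_exp_at_top: "((\<lambda>x. poly P x * exp (- x)) \<longlongrightarrow> 0) at_top" for P :: "real poly"
proof -
  have "((\<lambda>x. \<Sum>i\<le>degree P. coeff P i * (x ^ i / exp x)) \<longlongrightarrow> (\<Sum>i\<le>degree P. coeff P i * 0)) at_top"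
    by (intro tendsto_intros tendsto_power_div_exp_0)
  then show ?thesis
    by (simp add: poly_altdef sum_distrib_right exp_minus divide_inverse mult.assoc)
qed

text \<open>The functions P(1/s) exp(-1/s), extended by 0 to s <= 0, are closed under
  differentiation: the derivative belongs to the polynomial (P - P') X^2, where X^2 is the factor
  1/s^2 from differentiating 1/s.\<close>

lemma poly_exp_inverse_deriv:
  fixes P :: "real poly"
  defines "E \<equiv> \<lambda>(P :: real poly) s. if 0 < s then poly P (inverse s) * exp (- inverse s) else 0"
  shows "(E P has_real_derivative E ((P - pderiv P) * [:0, 0, 1:]) s) (at s)"
proof -
  consider "0 < s" | "s < 0" | "s = 0" by linarith
  then show ?thesis
  proof cases
    case 1
    have "((\<lambda>s. poly P (inverse s) * exp (- inverse s)) has_real_derivative E ((P - pderiv P) * [:0, 0, 1:]) s) (at s)"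
      using 1 unfolding E_def
      by (auto intro!: derivative_eq_intros DERIV_chain2[OF poly_DERIV] simp: power2_eq_square algebra_simps)
    then show ?thesis
      by (rule has_field_derivative_transform_within_open[of _ _ _ "{0<..}"]) (use 1 in \<open>auto simp: E_def\<close>)
  next
    case 2
    have "((\<lambda>s. 0) has_real_derivative E ((P - pderiv P) * [:0, 0, 1:]) s) (at s)"
      using 2 by (auto simp: E_def)
    then show ?thesis
      by (rule has_field_derivative_transform_within_open[of _ _ _ "{..<0}"]) (use 2 in \<open>auto simp: E_def\<close>)
  next
    case 3
    have "((\<lambda>h. E P h / h) \<longlongrightarrow> 0) (at 0)"
    proof (rule filterlim_split_at)
      show "((\<lambda>h. E P h / h) \<longlongrightarrow> 0) (at_left 0)"
        by (rule tendsto_eventually) (auto simp: E_def eventually_at_filter)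
      \<comment> \<open>The difference quotient at 0 divides by h; in terms of 1/h this is one more
        power, hence \<open>pCons 0 P\<close>.\<close>
      have "((\<lambda>h. poly (pCons 0 P) (inverse h) * exp (- inverse h)) \<longlongrightarrow> 0) (at_right (0::real))"
        by (rule filterlim_compose[OF tendsto_poly_exp_at_top filterlim_inverse_at_top_right])
      then show "((\<lambda>h. E P h / h) \<longlongrightarrow> 0) (at_right 0)"
        by (rule Lim_transform_eventually) (auto simp: E_def eventually_at_filter divide_inverse)
    qed
    then show ?thesis using 3 by (simp add: DERIV_def E_def cong: if_cong)
  qed
qed

definition bump_half :: "real \<Rightarrow> real" where
  "bump_half s = (if 0 < s then exp (- inverse s) else 0)"

lemma smooth_bump_half: "smooth bump_half"
proof -
  define E where "E \<equiv> \<lambda>(P :: real poly) s. if 0 < s then poly P (inverse s) * exp (- inverse s) else (0::real)"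
  have d: "(E P has_derivative (*) (E ((P - pderiv P) * [:0, 0, 1:]) s)) (at s)" for P s
    using poly_exp_inverse_deriv[of P s] by (simp only: E_def has_field_derivative_def)
  show ?thesis
  proof (rule smooth_coinduct[where S = "range E"])
    have "bump_half = E 1" by (auto simp: bump_half_def E_def fun_eq_iff)
    then show "bump_half \<in> range E" by auto
    fix f assume f: "f \<in> range E"
    then show "f differentiable (at x)" for x using d by (auto intro: differentiableI)
    show "(\<lambda>x. frechet_derivative f (at x) i) \<in> range E" if "i \<in> Basis" for i
    proof -
      obtain P where P: "f = E P" using f by blast
      have "(\<lambda>x. frechet_derivative f (at x) i) = E ((P - pderiv P) * [:0, 0, 1:])"
        unfolding P frechet_derivative_at[OF d, of P, symmetric] using that by simp
      then show ?thesis by blast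
    qed
  qed
qed


section \<open>Test functions: derivatives, supports, uniform bounds\<close>

lemma test_functionD:
  assumes "\<phi> \<in> test_functions"
  shows "smooth \<phi>" "compact (closure {x. \<phi> x \<noteq> 0})"
  using assms by (auto simp: test_functions_def)

lemma test_function_partials:
  assumes "\<phi> \<in> test_functions" "i \<in> Basis"
  shows "partials [i] \<phi> \<in> test_functions"
proof -
  let ?S = "closure {x. \<phi> x \<noteq> 0}"
  have z: "partials [i] \<phi> x = 0" if "x \<notin> ?S" for x
  proof -
    have "(\<phi> has_derivative (\<lambda>h. 0)) (at x)"
      by (rule has_derivative_transform_within_open[of "\<lambda>_. 0" _ _ _ "- ?S"])
         (use that closure_subset[of "{x. \<phi> x \<noteq> 0}"] in auto)
    from frechet_derivative_at[OF this] show ?thesis by (metis partials.simps)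
  qed
  then have "closure {x. partials [i] \<phi> x \<noteq> 0} \<subseteq> ?S"
    by (intro closure_minimal) auto
  then have "compact (closure {x. partials [i] \<phi> x \<noteq> 0})"
    using compact_Int_closed[OF test_functionD(2)[OF assms(1)] closed_closure] by (metis Int_absorb1)
  then show ?thesis
    using smooth_partials[of \<phi> "[i]"] test_functionD[OF assms(1)] assms(2) by (simp add: test_functions_def)
qed

lemma test_function_reflect:
  fixes \<phi> :: "'a::euclidean_space \<Rightarrow> real"
  assumes "\<phi> \<in> test_functions"
  shows "(\<lambda>y. \<phi> (a - y)) \<in> test_functions"
proof -
  have "{y. \<phi> (a - y) \<noteq> 0} = (\<lambda>x. a - x) ` {x. \<phi> x \<noteq> 0}"
    by (auto simp: image_iff) (metis diff_diff_eq2 add_diff_cancel_left')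
  also have "closure \<dots> \<subseteq> (\<lambda>x. a - x) ` closure {x. \<phi> x \<noteq> 0}"
    using test_functionD(2)[OF assms]
    by (intro closure_minimal image_mono closure_subset compact_imp_closed compact_continuous_image continuous_intros)
  finally have "closure {y. \<phi> (a - y) \<noteq> 0} \<subseteq> (\<lambda>x. a - x) ` closure {x. \<phi> x \<noteq> 0}" .
  moreover have "compact ((\<lambda>x. a - x) ` closure {x. \<phi> x \<noteq> 0})"
    using test_functionD(2)[OF assms] by (intro compact_continuous_image continuous_intros)
  ultimately have "compact (closure {y. \<phi> (a - y) \<noteq> 0})"
    using compact_Int_closed[OF _ closed_closure] by (metis Int_absorb1)
  then show ?thesis using smooth_reflect(1)[OF test_functionD(1)[OF assms]] by (simp add: test_functions_def)
qed

lemma test_function_support: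
  assumes "\<phi> \<in> test_functions"
  obtains R where "0 < R" "\<And>x. \<phi> x \<noteq> 0 \<Longrightarrow> norm x \<le> R"
proof -
  have "bounded {x. \<phi> x \<noteq> 0}"
    using test_functionD(2)[OF assms] closure_subset by (metis bounded_subset compact_imp_bounded)
  then show ?thesis using that by (auto simp: bounded_pos)
qed

lemma test_function_continuous: "\<phi> \<in> test_functions \<Longrightarrow> continuous_on S \<phi>"
  using smooth_differentiable test_functionD(1)
  by (intro continuous_at_imp_continuous_on ballI differentiable_imp_continuous_within) blast

lemma test_function_borel: "\<phi> \<in> test_functions \<Longrightarrow> \<phi> \<in> borel_measurable borel"
  by (intro borel_measurable_continuous_onI test_function_continuous)

lemma test_function_bounded:
  assumes "\<phi> \<in> test_functions"
  obtains B where "0 < B" "\<And>x. \<bar>\<phi> x\<bar> \<le> B"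
proof -
  let ?S = "closure {x. \<phi> x \<noteq> 0}"
  have "bounded (\<phi> ` ?S)"
    using test_functionD(2)[OF assms] test_function_continuous[OF assms]
    by (intro compact_imp_bounded compact_continuous_image)
  then obtain B where B: "0 < B" "\<And>x. x \<in> ?S \<Longrightarrow> \<bar>\<phi> x\<bar> \<le> B" by (auto simp: bounded_pos)
  have "\<bar>\<phi> x\<bar> \<le> B" for x
    using B closure_subset[of "{x. \<phi> x \<noteq> 0}"] by (cases "\<phi> x = 0") auto
  with B(1) show ?thesis by (rule that)
qed

lemma bounded_support_integrable:
  fixes f :: "'a::euclidean_space \<Rightarrow> real"
  assumes [measurable]: "f \<in> borel_measurable borel" and "\<And>x. \<bar>f x\<bar> \<le> B" "\<And>x. f x \<noteq> 0 \<Longrightarrow> norm x \<le> R"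
  shows "integrable lborel f"
proof (rule Bochner_Integration.integrable_bound)
  show "integrable lborel (\<lambda>x. indicator (cball 0 R) x * B)"
    using emeasure_lborel_cball_finite[of 0 R] by (intro integrable_mult_left) (simp add: integrable_indicator_iff)
  have "norm (f x) \<le> norm (indicator (cball 0 R) x * B)" for x
    using assms(2)[of x] assms(3)[of x] by (auto simp: indicator_def)
  then show "AE x in lborel. norm (f x) \<le> norm (indicator (cball 0 R) x * B)" by simp
qed simp

lemma test_function_integrable: "\<phi> \<in> test_functions \<Longrightarrow> integrable lborel \<phi>"
  using bounded_support_integrable test_function_borel test_function_bounded test_function_support
  by metis

lemma test_function_deriv:
  fixes \<phi> :: "'a::euclidean_space \<Rightarrow> real"
  assumes "\<phi> \<in> test_functions"
  shows "(\<phi> has_derivative (\<lambda>h. \<Sum>i\<in>Basis. (h \<bullet> i) * partials [i] \<phi> x)) (at x)"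
proof -
  note d = smooth_has_derivative[OF test_functionD(1)[OF assms], of x]
  have "frechet_derivative \<phi> (at x) h = (\<Sum>i\<in>Basis. (h \<bullet> i) * partials [i] \<phi> x)" for h
  proof -
    have lin: "linear (frechet_derivative \<phi> (at x))" using d has_derivative_linear by blast
    have "frechet_derivative \<phi> (at x) h = frechet_derivative \<phi> (at x) (\<Sum>i\<in>Basis. (h \<bullet> i) *\<^sub>R i)"
      by (simp add: euclidean_representation)
    also have "\<dots> = (\<Sum>i\<in>Basis. (h \<bullet> i) * frechet_derivative \<phi> (at x) i)"
      using lin by (simp add: linear_sum linear_cmul)
    finally show ?thesis by simp
  qed
  then have "frechet_derivative \<phi> (at x) = (\<lambda>h. \<Sum>i\<in>Basis. (h \<bullet> i) * partials [i] \<phi> x)" by (rule ext)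
  then show ?thesis using d by (simp only:)
qed

lemma test_function_lipschitz:
  fixes \<phi> :: "'a::euclidean_space \<Rightarrow> real"
  assumes "\<phi> \<in> test_functions"
  obtains L where "0 < L" "\<And>x y. \<bar>\<phi> x - \<phi> y\<bar> \<le> L * norm (x - y)"
proof -
  have "\<forall>i\<in>Basis. \<exists>B. 0 < B \<and> (\<forall>x. \<bar>partials [i] \<phi> x\<bar> \<le> B)"
    using test_function_bounded[OF test_function_partials[OF assms]] by metis
  then obtain B where B: "\<And>i. i \<in> Basis \<Longrightarrow> 0 < B i" "\<And>i x. i \<in> Basis \<Longrightarrow> \<bar>partials [i] \<phi> x\<bar> \<le> B i"
    by metis
  define L where "L = (\<Sum>i\<in>Basis. B i)"
  have L: "0 < L" unfolding L_def using B by (intro sum_pos) auto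
  have "norm (\<phi> x - \<phi> y) \<le> L * norm (x - y)" for x y
  proof (rule differentiable_bound[of UNIV _ "\<lambda>z h. \<Sum>i\<in>Basis. (h \<bullet> i) * partials [i] \<phi> z"])
    show "onorm (\<lambda>h. \<Sum>i\<in>Basis. (h \<bullet> i) * partials [i] \<phi> z) \<le> L" for z
    proof (rule onorm_bound)
      fix h :: 'a
      have "norm (\<Sum>i\<in>Basis. (h \<bullet> i) * partials [i] \<phi> z) \<le> (\<Sum>i\<in>Basis. norm h * B i)"
        using B(2) by (intro order_trans[OF norm_sum] sum_mono) (auto simp: abs_mult Basis_le_norm intro!: mult_mono)
      then show "norm (\<Sum>i\<in>Basis. (h \<bullet> i) * partials [i] \<phi> z) \<le> L * norm h"
        by (simp add: L_def sum_distrib_left mult.commute)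
    qed (use L in simp)
    show "(\<phi> has_derivative (\<lambda>h. \<Sum>i\<in>Basis. (h \<bullet> i) * partials [i] \<phi> z)) (at z within UNIV)" for z
      using test_function_deriv[OF assms] by simp
  qed auto
  with L show ?thesis using that by auto
qed

section \<open>Mollifiers\<close>

definition mollifier :: "('a::euclidean_space \<Rightarrow> real) \<Rightarrow> real \<Rightarrow> bool" where
  "mollifier \<eta> \<delta> \<longleftrightarrow> \<eta> \<in> test_functions \<and> (\<forall>x. 0 \<le> \<eta> x) \<and> (\<integral>x. \<eta> x \<partial>lborel) = 1 \<and> (\<forall>x. \<eta> x \<noteq> 0 \<longrightarrow> norm x \<le> \<delta>)"

lemma mollifier_exists:
  assumes "0 < \<delta>"
  shows "\<exists>\<eta> :: 'a::euclidean_space \<Rightarrow> real. mollifier \<eta> \<delta>"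
proof -
  \<comment> \<open>The support is a box of half side r, and the Euclidean norm is at most the sum
    of the coordinates, so this r keeps the box inside the ball of radius \<delta>. On the open ball
    of radius r all factors are positive, which makes the integral nonzero.\<close>
  define r where "r = \<delta> / DIM('a)"
  have r: "0 < r" using assms by (simp add: r_def)
  define h :: "'a \<Rightarrow> real" where "h x = (\<Prod>i\<in>Basis. bump_half (r + i \<bullet> x) * bump_half (r + (- i) \<bullet> x))" for x
  have bh: "0 \<le> bump_half s" "bump_half s \<noteq> 0 \<longleftrightarrow> 0 < s" for s by (auto simp: bump_half_def)
  have sm: "smooth h"
    unfolding h_def by (intro smooth_prod smooth_mult smooth_affine_compose smooth_bump_half) auto
  have h0: "0 \<le> h x" for x unfolding h_def by (intro prod_nonneg mult_nonneg_nonneg bh ballI)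
  have supp: "norm x \<le> \<delta>" if "h x \<noteq> 0" for x
  proof -
    have "\<bar>x \<bullet> i\<bar> \<le> r" if "i \<in> Basis" for i
      using \<open>h x \<noteq> 0\<close> that bh(2)[of "r + i \<bullet> x"] bh(2)[of "r + (- i) \<bullet> x"] by (auto simp: h_def inner_commute)
    then have "(\<Sum>i\<in>Basis. \<bar>x \<bullet> i\<bar>) \<le> (\<Sum>i\<in>(Basis::'a set). r)" by (rule sum_mono)
    then show ?thesis using norm_le_l1[of x] by (simp add: r_def)
  qed
  have "bounded {x. h x \<noteq> 0}" using supp by (auto simp: bounded_iff)
  then have "compact (closure {x. h x \<noteq> 0})" by (simp add: compact_eq_bounded_closed bounded_closure)
  with sm have t: "h \<in> test_functions" by (simp add: test_functions_def)
  note int = test_function_integrable[OF t]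
  have "(\<integral>x. h x \<partial>lborel) \<noteq> 0"
  proof
    assume "(\<integral>x. h x \<partial>lborel) = 0"
    then have "AE x in lborel. h x = 0" using integral_nonneg_eq_0_iff_AE[OF int] h0 by simp
    moreover have "h x \<noteq> 0" if "x \<in> ball 0 r" for x
    proof -
      have "\<bar>i \<bullet> x\<bar> < r" if "i \<in> Basis" for i
        using Basis_le_norm[OF that, of x] \<open>x \<in> ball 0 r\<close> by (simp add: inner_commute)
      then show ?thesis using bh(2) by (fastforce simp: h_def)
    qed
    ultimately have "AE x in lborel. x \<notin> ball (0::'a) r" by auto
    then have "ball (0::'a) r \<in> null_sets lborel" by (subst (asm) AE_iff_null) (auto simp: ball_def)
    then show False using content_ball_pos[OF r, of "0::'a"] by (simp add: measure_def null_setsD1)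
  qed
  moreover have "0 \<le> (\<integral>x. h x \<partial>lborel)" using h0 by simp
  ultimately have pos: "0 < (\<integral>x. h x \<partial>lborel)" by linarith
  define c where "c = inverse (\<integral>x. h x \<partial>lborel)"
  have c: "0 < c" using pos by (simp add: c_def)
  have "(\<lambda>x. c * h x) \<in> test_functions"
    using smooth_mult[OF smooth_const sm, of c] t c by (simp add: test_functions_def)
  moreover have "(\<integral>x. c * h x \<partial>lborel) = 1" using pos by (simp add: c_def)
  ultimately have "mollifier (\<lambda>x. c * h x) \<delta>" using h0 supp c by (auto simp: mollifier_def)
  then show ?thesis by blast
qed

lemma mollifierD:
  assumes "mollifier \<eta> \<delta>"
  shows "\<eta> \<in> test_functions" "0 \<le> \<eta> x" "(\<integral>x. \<eta> x \<partial>lborel) = 1" "\<eta> x \<noteq> 0 \<Longrightarrow> norm x \<le> \<delta>"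
  using assms by (auto simp: mollifier_def)

section \<open>Convolution\<close>

lemma distr_lborel_reflect: "distr lborel borel (\<lambda>y. a - y) = (lborel :: 'a::euclidean_space measure)"
proof -
  have "lborel = density (distr lborel borel (\<lambda>y :: 'a. a + (- 1) *\<^sub>R y)) (\<lambda>_. ennreal (\<bar>- 1\<bar> ^ DIM('a)))"
    by (rule lborel_affine) simp
  also have "\<dots> = density (distr lborel borel (\<lambda>y. a - y)) (\<lambda>_. 1)"
    by simp
  finally show ?thesis by (simp add: density_1)
qed

lemma nn_integral_lborel_reflect:
  fixes f :: "'a::euclidean_space \<Rightarrow> ennreal"
  assumes "f \<in> borel_measurable borel"
  shows "(\<integral>\<^sup>+y. f (a - y) \<partial>lborel) = (\<integral>\<^sup>+y. f y \<partial>lborel)"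
  using nn_integral_distr[of "\<lambda>y. a - y" lborel borel f] assms
  unfolding distr_lborel_reflect by simp

lemma nn_integral_lborel_shift:
  fixes f :: "'a::euclidean_space \<Rightarrow> ennreal"
  assumes "f \<in> borel_measurable borel"
  shows "(\<integral>\<^sup>+y. f (a + y) \<partial>lborel) = (\<integral>\<^sup>+y. f y \<partial>lborel)"
  using nn_integral_distr[of "\<lambda>y. a + y" lborel borel f] assms
  unfolding lborel_distr_plus by simp

lemma integral_lborel_shift:
  fixes f :: "'a::euclidean_space \<Rightarrow> real"
  assumes "f \<in> borel_measurable borel"
  shows "(\<integral>y. f (a + y) \<partial>lborel) = (\<integral>y. f y \<partial>lborel)"
  using integral_distr[of "\<lambda>y. a + y" lborel borel f] assms
  unfolding lborel_distr_plus by simp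

section \<open>Local L^1 seminorms\<close>

lemma cball_sets_borel [measurable]: "cball (c::'a::euclidean_space) R \<in> sets borel"
  by simp

text \<open>The L^1 seminorm on a ball about the origin. Values in \<open>ennreal\<close> allow all
  estimates to be stated before integrability is known.\<close>

definition bnorm :: "real \<Rightarrow> ('a::euclidean_space \<Rightarrow> real) \<Rightarrow> ennreal" where
  "bnorm R f = (\<integral>\<^sup>+x. ennreal \<bar>f x\<bar> * indicator (cball 0 R) x \<partial>lborel)"

definition loc_int :: "('a::euclidean_space \<Rightarrow> real) \<Rightarrow> bool" where
  "loc_int f \<longleftrightarrow> f \<in> borel_measurable borel \<and> (\<forall>R. bnorm R f < \<infinity>)"

lemma loc_int_borel: "loc_int f \<Longrightarrow> f \<in> borel_measurable borel"
  by (simp add: loc_int_def)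

lemma loc_int_bnorm: "loc_int f \<Longrightarrow> bnorm R f < \<infinity>"
  by (simp add: loc_int_def)

text \<open>Every compact set lies in a ball about the origin, and these balls are compact, so
  testing balls is enough.\<close>

lemma Lp_loc_1_iff: "f \<in> Lp_loc 1 \<longleftrightarrow> loc_int f"
proof -
  have eq: "(\<integral>\<^sup>+x. ennreal (\<bar>f x\<bar> powr enn2real 1) \<partial>restrict_space lborel K) = (\<integral>\<^sup>+x. ennreal \<bar>f x\<bar> * indicator K x \<partial>lborel)"
    if "compact K" for K
    using that by (subst nn_integral_restrict_space) (auto simp: borel_compact)
  have Lp: "f \<in> Lp (restrict_space lborel K) 1 \<longleftrightarrow> (\<integral>\<^sup>+x. ennreal \<bar>f x\<bar> * indicator K x \<partial>lborel) < \<infinity>"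
    if "f \<in> borel_measurable borel" "compact K" for K
  proof -
    have "f \<in> borel_measurable (restrict_space lborel K)"
      by (rule measurable_restrict_space1) (use that in simp)
    then show ?thesis unfolding Lp_def mem_Collect_eq eq[OF that(2)] by simp
  qed
  have "f \<in> Lp_loc 1 \<longleftrightarrow> f \<in> borel_measurable borel \<and> (\<forall>K. compact K \<longrightarrow> (\<integral>\<^sup>+x. ennreal \<bar>f x\<bar> * indicator K x \<partial>lborel) < \<infinity>)"
    unfolding Lp_loc_def mem_Collect_eq using Lp by blast
  also have "\<dots> \<longleftrightarrow> loc_int f"
  proof -
    have "(\<integral>\<^sup>+x. ennreal \<bar>f x\<bar> * indicator K x \<partial>lborel) < \<infinity>" if K: "compact K" and R: "\<forall>R. bnorm R f < \<infinity>" for K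
    proof -
      obtain R where "K \<subseteq> cball 0 R" using compact_imp_bounded[OF K] unfolding bounded_iff by (metis mem_cball_0 subsetI)
      then have "(\<integral>\<^sup>+x. ennreal \<bar>f x\<bar> * indicator K x \<partial>lborel) \<le> bnorm R f"
        unfolding bnorm_def by (intro nn_integral_mono) (auto simp: indicator_def)
      then show ?thesis using R by (meson le_less_trans)
    qed
    then show ?thesis by (auto simp: loc_int_def bnorm_def)
  qed
  finally show ?thesis .
qed

lemma bnorm_mono_radius: "R \<le> R' \<Longrightarrow> bnorm R f \<le> bnorm R' f"
  unfolding bnorm_def by (intro nn_integral_mono) (auto simp: indicator_def)

lemma bnorm_mono_AE: "AE x in lborel. \<bar>f x\<bar> \<le> \<bar>g x\<bar> \<Longrightarrow> bnorm R f \<le> bnorm R g"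
  unfolding bnorm_def by (intro nn_integral_mono_AE) (auto simp: indicator_def intro: ennreal_leI)

lemma bnorm_triangle:
  assumes [measurable]: "f \<in> borel_measurable borel" "g \<in> borel_measurable borel"
    and "\<And>x. norm x \<le> R \<Longrightarrow> \<bar>h x\<bar> \<le> \<bar>f x\<bar> + \<bar>g x\<bar>"
  shows "bnorm R h \<le> bnorm R f + bnorm R g"
proof -
  have "bnorm R h \<le> (\<integral>\<^sup>+x. ennreal \<bar>f x\<bar> * indicator (cball 0 R) x + ennreal \<bar>g x\<bar> * indicator (cball 0 R) x \<partial>lborel)"
    unfolding bnorm_def
    by (intro nn_integral_mono) (auto simp: assms(3) indicator_def ennreal_leI simp flip: ennreal_plus)
  also have "\<dots> = bnorm R f + bnorm R g"
    unfolding bnorm_def by (intro nn_integral_add) measurable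
  finally show ?thesis .
qed

lemma bnorm_add:
  assumes "f \<in> borel_measurable borel" "g \<in> borel_measurable borel"
  shows "bnorm R (\<lambda>x. f x + g x) \<le> bnorm R f + bnorm R g"
  by (rule bnorm_triangle[OF assms]) simp

lemma bnorm_diff:
  assumes "f \<in> borel_measurable borel" "g \<in> borel_measurable borel"
  shows "bnorm R (\<lambda>x. f x - g x) \<le> bnorm R f + bnorm R g"
  by (rule bnorm_triangle[OF assms]) simp

lemma bnorm_bound:
  fixes f :: "'a::euclidean_space \<Rightarrow> real"
  assumes "\<And>x. norm x \<le> R \<Longrightarrow> \<bar>f x\<bar> \<le> c"
  shows "bnorm R f \<le> ennreal c * emeasure lborel (cball 0 R :: 'a set)"
proof -
  have "bnorm R f \<le> (\<integral>\<^sup>+x. ennreal c * indicator (cball 0 R :: 'a set) x \<partial>lborel)"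
    unfolding bnorm_def by (intro nn_integral_mono) (auto simp: indicator_def assms intro: ennreal_leI)
  also have "\<dots> = ennreal c * emeasure lborel (cball 0 R :: 'a set)" by (subst nn_integral_cmult_indicator) auto
  finally show ?thesis .
qed

lemma loc_int_diff:
  assumes "loc_int f" "loc_int g"
  shows "loc_int (\<lambda>x. f x - g x)"
  unfolding loc_int_def
proof (intro conjI allI)
  show "(\<lambda>x. f x - g x) \<in> borel_measurable borel"
    using assms[THEN loc_int_borel] by simp
  fix R
  have "bnorm R f + bnorm R g < \<infinity>" using assms by (simp add: loc_int_def)
  then show "bnorm R (\<lambda>x. f x - g x) < \<infinity>"
    using bnorm_diff[OF loc_int_borel[OF assms(1)] loc_int_borel[OF assms(2)]] by (rule le_less_trans[rotated])
qed

lemma loc_int_add: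
  assumes "loc_int f" "loc_int g"
  shows "loc_int (\<lambda>x. f x + g x)"
  unfolding loc_int_def
proof (intro conjI allI)
  show "(\<lambda>x. f x + g x) \<in> borel_measurable borel"
    using assms[THEN loc_int_borel] by simp
  fix R
  have "bnorm R f + bnorm R g < \<infinity>" using assms by (simp add: loc_int_def)
  then show "bnorm R (\<lambda>x. f x + g x) < \<infinity>"
    using bnorm_add[OF loc_int_borel[OF assms(1)] loc_int_borel[OF assms(2)]] by (rule le_less_trans[rotated])
qed

lemma loc_int_mono:
  assumes "loc_int g" "f \<in> borel_measurable borel" "AE x in lborel. \<bar>f x\<bar> \<le> \<bar>g x\<bar>"
  shows "loc_int f"
  using assms bnorm_mono_AE[OF assms(3)] unfolding loc_int_def by (meson le_less_trans)

lemma loc_int_bounded: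
  assumes "f \<in> borel_measurable borel" "\<And>x. \<bar>f x\<bar> \<le> c"
  shows "loc_int f"
  unfolding loc_int_def
proof (intro conjI allI assms)
  fix R
  show "bnorm R f < \<infinity>"
    using bnorm_bound[of R f c] assms(2) emeasure_lborel_cball_finite[of 0 R]
    by (auto simp: ennreal_mult_less_top intro: le_less_trans)
qed

lemma integrable_loc_int:
  assumes "integrable lborel f" shows "loc_int f"
proof -
  have "bnorm R f \<le> (\<integral>\<^sup>+x. ennreal (norm (f x)) \<partial>lborel)" for R
    unfolding bnorm_def by (intro nn_integral_mono) (auto simp: indicator_def)
  then show ?thesis using assms by (auto simp: loc_int_def integrable_iff_bounded intro: le_less_trans)
qed

lemma loc_int_indicator_integrable:
  assumes "loc_int f" shows "integrable lborel (\<lambda>x. indicator (cball 0 R) x * f x)"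
  unfolding integrable_iff_bounded
proof
  note [measurable] = loc_int_borel[OF assms]
  show "(\<lambda>x. indicator (cball 0 R) x * f x) \<in> borel_measurable lborel" by measurable
  have "(\<integral>\<^sup>+x. ennreal (norm (indicator (cball 0 R) x * f x)) \<partial>lborel) = bnorm R f"
    unfolding bnorm_def by (intro nn_integral_cong) (auto simp: indicator_def)
  then show "(\<integral>\<^sup>+x. ennreal (norm (indicator (cball 0 R) x * f x)) \<partial>lborel) < \<infinity>"
    using loc_int_bnorm[OF assms, of R] by simp
qed

lemma loc_int_mult_integrable:
  assumes "loc_int f" and [measurable]: "w \<in> borel_measurable borel"
    and "\<And>x. \<bar>w x\<bar> \<le> B" "\<And>x. w x \<noteq> 0 \<Longrightarrow> norm x \<le> R"
  shows "integrable lborel (\<lambda>x. f x * w x)"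
proof (rule Bochner_Integration.integrable_bound)
  show "integrable lborel (\<lambda>x. B * (indicator (cball 0 R) x * f x))"
    using loc_int_indicator_integrable[OF assms(1)] by (rule integrable_mult_right)
  note [measurable] = loc_int_borel[OF assms(1)]
  show "(\<lambda>x. f x * w x) \<in> borel_measurable lborel" by measurable
  have "norm (f x * w x) \<le> norm (B * (indicator (cball 0 R) x * f x))" for x
    using assms(3)[of x] assms(4)[of x] mult_left_mono[of "\<bar>w x\<bar>" B "\<bar>f x\<bar>"]
    by (cases "w x = 0") (auto simp: indicator_def abs_mult mult.commute)
  then show "AE x in lborel. norm (f x * w x) \<le> norm (B * (indicator (cball 0 R) x * f x))" by simp
qed

lemma integral_mult_bnorm:
  assumes "loc_int f" and [measurable]: "w \<in> borel_measurable borel"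
    and "\<And>x. \<bar>w x\<bar> \<le> B" "\<And>x. w x \<noteq> 0 \<Longrightarrow> norm x \<le> R"
  shows "ennreal \<bar>\<integral>x. f x * w x \<partial>lborel\<bar> \<le> ennreal B * bnorm R f"
proof -
  note [measurable] = loc_int_borel[OF assms(1)]
  have "ennreal \<bar>\<integral>x. f x * w x \<partial>lborel\<bar> \<le> (\<integral>\<^sup>+x. norm (f x * w x) \<partial>lborel)"
    using integral_norm_bound_ennreal[OF loc_int_mult_integrable[OF assms]] by simp
  also have "\<dots> \<le> (\<integral>\<^sup>+x. ennreal B * (ennreal \<bar>f x\<bar> * indicator (cball 0 R) x) \<partial>lborel)"
  proof (intro nn_integral_mono)
    fix x
    have "0 \<le> B" using assms(3)[of x] by linarith
    then show "ennreal (norm (f x * w x)) \<le> ennreal B * (ennreal \<bar>f x\<bar> * indicator (cball 0 R) x)"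
      using assms(3)[of x] assms(4)[of x] mult_left_mono[of "\<bar>w x\<bar>" B "\<bar>f x\<bar>"]
      by (cases "w x = 0") (auto simp: abs_mult mult.commute ennreal_leI simp flip: ennreal_mult)
  qed
  also have "\<dots> = ennreal B * bnorm R f"
    unfolding bnorm_def by (intro nn_integral_cmult) measurable
  finally show ?thesis .
qed

section \<open>Convolution with a test function\<close>

definition conv :: "('a::euclidean_space \<Rightarrow> real) \<Rightarrow> ('a \<Rightarrow> real) \<Rightarrow> 'a \<Rightarrow> real" where
  "conv u \<phi> x = (\<integral>y. u y * \<phi> (x - y) \<partial>lborel)"

lemma conv_borel [measurable]:
  assumes [measurable]: "u \<in> borel_measurable borel" "\<phi> \<in> borel_measurable borel"
  shows "conv u \<phi> \<in> borel_measurable borel"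
  unfolding conv_def by measurable

lemma conv_integrable:
  assumes "loc_int u" "\<phi> \<in> test_functions"
  shows "integrable lborel (\<lambda>y. u y * \<phi> (x - y))"
proof -
  note t = test_function_reflect[OF assms(2), of x]
  obtain B R where "\<And>y. \<bar>\<phi> (x - y)\<bar> \<le> B" "\<And>y. \<phi> (x - y) \<noteq> 0 \<Longrightarrow> norm y \<le> R"
    using test_function_bounded[OF t] test_function_support[OF t] by metis
  then show ?thesis by (intro loc_int_mult_integrable[OF assms(1) test_function_borel[OF t]])
qed

lemma conv_bound:
  assumes "loc_int u" "\<phi> \<in> test_functions" "\<And>x. \<bar>\<phi> x\<bar> \<le> B" "\<And>x. \<phi> x \<noteq> 0 \<Longrightarrow> norm x \<le> R" "norm x \<le> r"
  shows "ennreal \<bar>conv u \<phi> x\<bar> \<le> ennreal B * bnorm (R + r) u"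
  unfolding conv_def
proof (rule integral_mult_bnorm)
  fix y assume "\<phi> (x - y) \<noteq> 0"
  then show "norm y \<le> R + r" using assms(4)[of "x - y"] assms(5) norm_triangle_sub[of y x] by (simp add: norm_minus_commute)
qed (use assms test_function_borel[OF test_function_reflect[OF assms(2)]] in auto)

text \<open>As in \<open>conv_bound\<close>, the function u enters the constant only through its L^1
  seminorm on a ball. A family bounded in local L^1 therefore has locally equibounded and
  equi-Lipschitz mollifications at each fixed scale, which is what the compactness theorem
  exploits.\<close>

lemma conv_lipschitz:
  assumes "loc_int u" "\<phi> \<in> test_functions" "\<And>x y. \<bar>\<phi> x - \<phi> y\<bar> \<le> L * norm (x - y)"
    "\<And>x. \<phi> x \<noteq> 0 \<Longrightarrow> norm x \<le> R" "norm x \<le> r" "norm x' \<le> r"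
  shows "ennreal \<bar>conv u \<phi> x - conv u \<phi> x'\<bar> \<le> ennreal (L * norm (x - x')) * bnorm (R + r) u"
proof -
  have eq: "conv u \<phi> x - conv u \<phi> x' = (\<integral>y. u y * (\<phi> (x - y) - \<phi> (x' - y)) \<partial>lborel)"
    unfolding conv_def using conv_integrable[OF assms(1,2)]
    by (simp add: right_diff_distrib)
  show ?thesis unfolding eq
  proof (rule integral_mult_bnorm)
    show "(\<lambda>y. \<phi> (x - y) - \<phi> (x' - y)) \<in> borel_measurable borel"
      using test_function_borel[OF test_function_reflect[OF assms(2)]] by measurable
    show "\<bar>\<phi> (x - y) - \<phi> (x' - y)\<bar> \<le> L * norm (x - x')" for y
      using assms(3)[of "x - y" "x' - y"] by simp
    fix y assume "\<phi> (x - y) - \<phi> (x' - y) \<noteq> 0"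
    then have "\<phi> (x - y) \<noteq> 0 \<or> \<phi> (x' - y) \<noteq> 0" by auto
    then show "norm y \<le> R + r"
      using assms(4)[of "x - y"] assms(4)[of "x' - y"] assms(5,6) norm_triangle_sub[of y x] norm_triangle_sub[of y x']
      by (auto simp: norm_minus_commute)
  qed (rule assms)
qed

lemma conv_continuous:
  fixes u :: "'a::euclidean_space \<Rightarrow> real"
  assumes "loc_int u" "\<phi> \<in> test_functions"
  shows "continuous_on UNIV (conv u \<phi>)"
proof (rule continuous_at_imp_continuous_on, rule ballI)
  fix x :: 'a
  obtain L where L: "0 < L" "\<And>x y. \<bar>\<phi> x - \<phi> y\<bar> \<le> L * norm (x - y)" using test_function_lipschitz[OF assms(2)] by metis
  obtain R where R: "\<And>x. \<phi> x \<noteq> 0 \<Longrightarrow> norm x \<le> R" using test_function_support[OF assms(2)] by metis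
  define b where "b = enn2real (bnorm (R + (norm x + 1)) u)"
  have b: "bnorm (R + (norm x + 1)) u = ennreal b" using loc_int_bnorm[OF assms(1)] by (simp add: b_def less_top)
  have le: "\<bar>conv u \<phi> y - conv u \<phi> x\<bar> \<le> L * b * norm (y - x)" if "norm (y - x) < 1" for y
  proof -
    have y: "norm y \<le> norm x + 1" using that norm_triangle_sub[of y x] by simp
    have b0: "0 \<le> b" by (simp add: b_def)
    have "ennreal \<bar>conv u \<phi> y - conv u \<phi> x\<bar> \<le> ennreal (L * norm (y - x)) * ennreal b"
      using conv_lipschitz[OF assms L(2) R y, of x] by (simp add: b)
    also have "\<dots> = ennreal (L * norm (y - x) * b)" using L(1) b0 by (simp add: ennreal_mult)
    finally show ?thesis using L(1) b0 by (subst (asm) ennreal_le_iff) (auto simp: mult_ac)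
  qed
  have "((\<lambda>y. L * b * norm (y - x)) \<longlongrightarrow> L * b * norm (x - x)) (at x)" by (intro tendsto_intros)
  then have "((\<lambda>y. L * b * norm (y - x)) \<longlongrightarrow> 0) (at x)" by simp
  moreover have "eventually (\<lambda>y. norm (conv u \<phi> y - conv u \<phi> x) \<le> L * b * norm (y - x)) (at x)"
    unfolding eventually_at using le by (intro exI[of _ 1]) (auto simp: dist_norm)
  ultimately have "((\<lambda>y. conv u \<phi> y - conv u \<phi> x) \<longlongrightarrow> 0) (at x)" by (rule Lim_null_comparison[rotated])
  then show "isCont (conv u \<phi>) x" unfolding isCont_def by (simp add: LIM_zero_iff)
qed

text \<open>Differentiation under the integral along a line. Difference quotients of \<phi> are
  bounded by L |h|, so the local integrability of u provides the dominating function.\<close>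

lemma conv_has_derivative:
  fixes u :: "'a::euclidean_space \<Rightarrow> real"
  assumes "loc_int u" "\<phi> \<in> test_functions"
  shows "((\<lambda>t. conv u \<phi> (x + t *\<^sub>R h)) has_real_derivative (\<Sum>i\<in>Basis. (h \<bullet> i) * conv u (partials [i] \<phi>) x)) (at 0)"
proof -
  obtain L where L: "0 < L" "\<And>x y. \<bar>\<phi> x - \<phi> y\<bar> \<le> L * norm (x - y)" using test_function_lipschitz[OF assms(2)] by metis
  obtain R where R: "\<And>x. \<phi> x \<noteq> 0 \<Longrightarrow> norm x \<le> R" using test_function_support[OF assms(2)] by metis
  note [measurable] = test_function_borel[OF assms(2)] loc_int_borel[OF assms(1)]
  have pi: "integrable lborel (\<lambda>y. u y * partials [i] \<phi> (x - y))" if "i \<in> Basis" for i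
    by (rule conv_integrable[OF assms(1) test_function_partials[OF assms(2) that]])
  have D: "(\<Sum>i\<in>Basis. (h \<bullet> i) * conv u (partials [i] \<phi>) x) = (\<integral>y. u y * (\<Sum>i\<in>Basis. (h \<bullet> i) * partials [i] \<phi> (x - y)) \<partial>lborel)"
  proof -
    have "(\<integral>y. u y * (\<Sum>i\<in>Basis. (h \<bullet> i) * partials [i] \<phi> (x - y)) \<partial>lborel)
        = (\<integral>y. (\<Sum>i\<in>Basis. (h \<bullet> i) * (u y * partials [i] \<phi> (x - y))) \<partial>lborel)"
      by (simp only: sum_distrib_left mult.left_commute)
    also have "\<dots> = (\<Sum>i\<in>Basis. \<integral>y. (h \<bullet> i) * (u y * partials [i] \<phi> (x - y)) \<partial>lborel)"
      by (rule Bochner_Integration.integral_sum) (rule integrable_mult_right, rule pi)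
    also have "\<dots> = (\<Sum>i\<in>Basis. (h \<bullet> i) * conv u (partials [i] \<phi>) x)"
      by (simp only: conv_def integral_mult_right_zero)
    finally show ?thesis by (rule sym)
  qed
  have pm [measurable]: "partials [i] \<phi> \<in> borel_measurable borel" if "i \<in> Basis" for i
    by (rule test_function_borel[OF test_function_partials[OF assms(2) that]])
  show ?thesis
    unfolding DERIV_def
  proof (rule LIMSEQ_SEQ_conv[THEN iffD1], intro allI impI, elim conjE)
    fix S :: "nat \<Rightarrow> real" assume S: "\<forall>n. S n \<noteq> 0" "S \<longlonglongrightarrow> 0"
    obtain b where b: "\<And>n. \<bar>S n\<bar> \<le> b" using convergent_imp_Bseq[OF convergentI[OF S(2)]] by (auto simp: Bseq_def)
    \<comment> \<open>Since |S n| <= b, all kernels y |-> \<phi>(x + S n h - y) and y |-> \<phi>(x -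
      y) vanish outside the ball of this radius, so one dominating function serves all n.\<close>
    define r where "r = R + norm x + b * norm h"
    have eq: "(conv u \<phi> (x + (0 + S n) *\<^sub>R h) - conv u \<phi> (x + 0 *\<^sub>R h)) / S n =
        (\<integral>y. u y * ((\<phi> (x + S n *\<^sub>R h - y) - \<phi> (x - y)) / S n) \<partial>lborel)" for n
      unfolding conv_def
      by (simp add: conv_integrable[OF assms] right_diff_distrib diff_divide_distrib)
    have "(\<lambda>n. \<integral>y. u y * ((\<phi> (x + S n *\<^sub>R h - y) - \<phi> (x - y)) / S n) \<partial>lborel)
       \<longlonglongrightarrow> (\<integral>y. u y * (\<Sum>i\<in>Basis. (h \<bullet> i) * partials [i] \<phi> (x - y)) \<partial>lborel)"
    proof (rule integral_dominated_convergence)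
      show "integrable lborel (\<lambda>y. L * norm h * \<bar>indicator (cball 0 r) y * u y\<bar>)"
        using loc_int_indicator_integrable[OF assms(1), of r] by (intro integrable_mult_right integrable_abs)
      show "(\<lambda>y. u y * (\<Sum>i\<in>Basis. (h \<bullet> i) * partials [i] \<phi> (x - y))) \<in> borel_measurable lborel"
        using pm by measurable
      show "AE y in lborel. (\<lambda>n. u y * ((\<phi> (x + S n *\<^sub>R h - y) - \<phi> (x - y)) / S n))
          \<longlonglongrightarrow> u y * (\<Sum>i\<in>Basis. (h \<bullet> i) * partials [i] \<phi> (x - y))"
      proof (intro AE_I2 tendsto_mult_left)
        fix y
        have "((\<lambda>t. x - y + t *\<^sub>R h) has_derivative (\<lambda>t. t *\<^sub>R h)) (at 0)" by (auto intro!: derivative_eq_intros)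
        from has_derivative_compose[OF this, of \<phi> "\<lambda>h. \<Sum>i\<in>Basis. (h \<bullet> i) * partials [i] \<phi> (x - y)"]
          test_function_deriv[OF assms(2), of "x - y"]
        have "((\<lambda>t. \<phi> (x - y + t *\<^sub>R h)) has_derivative (\<lambda>t. \<Sum>i\<in>Basis. (t *\<^sub>R h \<bullet> i) * partials [i] \<phi> (x - y))) (at 0)"
          by simp
        then have "((\<lambda>t. \<phi> (x - y + t *\<^sub>R h)) has_real_derivative (\<Sum>i\<in>Basis. (h \<bullet> i) * partials [i] \<phi> (x - y))) (at 0)"
          unfolding has_field_derivative_def by (rule has_derivative_eq_rhs) (simp add: sum_distrib_left sum_distrib_right mult_ac fun_eq_iff)
        then have "(\<lambda>t. (\<phi> (x - y + t *\<^sub>R h) - \<phi> (x - y)) / t) \<midarrow>0\<rightarrow> (\<Sum>i\<in>Basis. (h \<bullet> i) * partials [i] \<phi> (x - y))"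
          by (simp add: DERIV_def del: partials.simps)
        from LIMSEQ_SEQ_conv[THEN iffD2, OF this] S
        have "(\<lambda>n. (\<phi> (x - y + S n *\<^sub>R h) - \<phi> (x - y)) / S n) \<longlonglongrightarrow> (\<Sum>i\<in>Basis. (h \<bullet> i) * partials [i] \<phi> (x - y))"
          by blast
        moreover have "x + S n *\<^sub>R h - y = x - y + S n *\<^sub>R h" for n by simp
        ultimately show "(\<lambda>n. (\<phi> (x + S n *\<^sub>R h - y) - \<phi> (x - y)) / S n) \<longlonglongrightarrow> (\<Sum>i\<in>Basis. (h \<bullet> i) * partials [i] \<phi> (x - y))"
          by (simp only:)
      qed
      fix n
      show "AE y in lborel. norm (u y * ((\<phi> (x + S n *\<^sub>R h - y) - \<phi> (x - y)) / S n)) \<le> L * norm h * \<bar>indicator (cball 0 r) y * u y\<bar>"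
      proof (rule AE_I2)
        fix y
        show "norm (u y * ((\<phi> (x + S n *\<^sub>R h - y) - \<phi> (x - y)) / S n)) \<le> L * norm h * \<bar>indicator (cball 0 r) y * u y\<bar>"
        proof (cases "norm y \<le> r")
          case True
          have "\<bar>\<phi> (x + S n *\<^sub>R h - y) - \<phi> (x - y)\<bar> \<le> L * norm h * \<bar>S n\<bar>"
            using L(2)[of "x + S n *\<^sub>R h - y" "x - y"] by (simp add: mult_ac)
          then have "\<bar>(\<phi> (x + S n *\<^sub>R h - y) - \<phi> (x - y)) / S n\<bar> \<le> L * norm h"
            using S(1) by (simp add: abs_divide divide_le_eq)
          from mult_left_mono[OF this, of "\<bar>u y\<bar>"]
          have "\<bar>u y * ((\<phi> (x + S n *\<^sub>R h - y) - \<phi> (x - y)) / S n)\<bar> \<le> \<bar>u y\<bar> * (L * norm h)"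
            by (simp only: abs_mult abs_ge_zero)
          then show ?thesis using True by (simp add: mult_ac)
        next
          case False
          have "\<phi> (x - y) = 0"
          proof (rule ccontr)
            assume "\<phi> (x - y) \<noteq> 0"
            then have "norm y \<le> R + norm x" using R[of "x - y"] norm_triangle_sub[of y x] by (simp add: norm_minus_commute)
            moreover have "0 \<le> b * norm h" using b[of 0] by simp
            ultimately show False using False by (simp add: r_def)
          qed
          moreover have "\<phi> (x + S n *\<^sub>R h - y) = 0"
          proof (rule ccontr)
            assume "\<phi> (x + S n *\<^sub>R h - y) \<noteq> 0"
            then have "norm y \<le> R + norm (x + S n *\<^sub>R h)" using R[of "x + S n *\<^sub>R h - y"] norm_triangle_sub[of y "x + S n *\<^sub>R h"] by (simp add: norm_minus_commute)
            moreover have "norm (x + S n *\<^sub>R h) \<le> norm x + b * norm h"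
              using b[of n] by (intro order_trans[OF norm_triangle_ineq] add_mono) (auto intro: mult_right_mono)
            ultimately show False using False by (simp add: r_def)
          qed
          ultimately show ?thesis using L(1) by simp
        qed
      qed
    qed measurable
    then show "(\<lambda>n. (conv u \<phi> (x + (0 + S n) *\<^sub>R h) - conv u \<phi> (x + 0 *\<^sub>R h)) / S n) \<longlonglongrightarrow> (\<Sum>i\<in>Basis. (h \<bullet> i) * conv u (partials [i] \<phi>) x)"
      unfolding eq D .
  qed
qed

text \<open>The weak derivative is tested against the reflected kernel y |-> \<phi>(x - y); the sign
  of the reflection cancels the sign of the integration by parts.\<close>

lemma conv_weak_deriv:
  assumes "has_weak_deriv u [i] g" "i \<in> Basis" "\<phi> \<in> test_functions"
  shows "conv u (partials [i] \<phi>) x = conv g \<phi> x"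
proof -
  have *: "partials [i] (\<lambda>y. \<phi> (x - y)) = (\<lambda>y. - partials [i] \<phi> (x - y))"
    using smooth_reflect(2)[OF test_functionD(1)[OF assms(3)], of "[i]" x] assms(2) by simp
  have "(\<integral>y. u y * partials [i] (\<lambda>y. \<phi> (x - y)) y \<partial>lborel) = - (\<integral>y. g y * \<phi> (x - y) \<partial>lborel)"
    using assms(1) test_function_reflect[OF assms(3), of x] by (simp add: has_weak_deriv_def del: partials.simps)
  then show ?thesis unfolding * conv_def by (simp del: partials.simps)
qed


section \<open>Mollification in local L^1\<close>

lemma mollifier_nn_integral:
  assumes "mollifier \<eta> \<delta>"
  shows "(\<integral>\<^sup>+y. ennreal (\<eta> (a - y)) \<partial>lborel) = 1" "(\<integral>\<^sup>+y. ennreal (\<eta> (y - a)) \<partial>lborel) = 1"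
proof -
  note [measurable] = test_function_borel[OF mollifierD(1)[OF assms]]
  have 1: "(\<integral>\<^sup>+y. ennreal (\<eta> y) \<partial>lborel) = 1"
    using nn_integral_eq_integral[OF test_function_integrable[OF mollifierD(1)[OF assms]]] mollifierD(2,3)[OF assms] by simp
  show "(\<integral>\<^sup>+y. ennreal (\<eta> (a - y)) \<partial>lborel) = 1"
    using nn_integral_lborel_reflect[of "\<lambda>y. ennreal (\<eta> y)" a] 1 by simp
  show "(\<integral>\<^sup>+y. ennreal (\<eta> (y - a)) \<partial>lborel) = 1"
    using nn_integral_lborel_shift[of "\<lambda>y. ennreal (\<eta> y)" "- a"] 1 by simp
qed

text \<open>A local form of Young's inequality: by Tonelli each unit of mass of u is spread with
  total weight at most 1, and only mass within \<delta> of the ball reaches it.\<close>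

lemma bnorm_conv_le:
  fixes u :: "'a::euclidean_space \<Rightarrow> real"
  assumes "loc_int u" "mollifier \<eta> \<delta>"
  shows "bnorm R (conv u \<eta>) \<le> bnorm (R + \<delta>) u"
proof -
  note [measurable] = test_function_borel[OF mollifierD(1)[OF assms(2)]] loc_int_borel[OF assms(1)]
  have "bnorm R (conv u \<eta>) \<le> (\<integral>\<^sup>+x. (\<integral>\<^sup>+y. ennreal \<bar>u y\<bar> * ennreal (\<eta> (x - y)) * indicator (cball 0 R) x \<partial>lborel) \<partial>lborel)"
    unfolding bnorm_def
  proof (rule nn_integral_mono)
    fix x :: 'a
    have "ennreal \<bar>conv u \<eta> x\<bar> \<le> (\<integral>\<^sup>+y. ennreal (norm (u y * \<eta> (x - y))) \<partial>lborel)"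
      unfolding conv_def
      using integral_norm_bound_ennreal[OF conv_integrable[OF assms(1) mollifierD(1)[OF assms(2)], of x]] by simp
    also have "\<dots> = (\<integral>\<^sup>+y. ennreal \<bar>u y\<bar> * ennreal (\<eta> (x - y)) \<partial>lborel)"
      using mollifierD(2)[OF assms(2)] by (simp add: abs_mult ennreal_mult)
    finally show "ennreal \<bar>conv u \<eta> x\<bar> * indicator (cball 0 R) x
        \<le> (\<integral>\<^sup>+y. ennreal \<bar>u y\<bar> * ennreal (\<eta> (x - y)) * indicator (cball 0 R) x \<partial>lborel)"
      by (auto simp: indicator_def)
  qed
  also have "\<dots> = (\<integral>\<^sup>+y. (\<integral>\<^sup>+x. ennreal \<bar>u y\<bar> * ennreal (\<eta> (x - y)) * indicator (cball 0 R) x \<partial>lborel) \<partial>lborel)"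
    by (rule lborel_pair.Fubini') measurable
  also have "\<dots> \<le> (\<integral>\<^sup>+y. (\<integral>\<^sup>+x. (ennreal \<bar>u y\<bar> * indicator (cball 0 (R + \<delta>)) y) * ennreal (\<eta> (x - y)) \<partial>lborel) \<partial>lborel)"
  proof (intro nn_integral_mono)
    fix x y :: 'a
    show "ennreal \<bar>u y\<bar> * ennreal (\<eta> (x - y)) * indicator (cball 0 R) x
        \<le> ennreal \<bar>u y\<bar> * indicator (cball 0 (R + \<delta>)) y * ennreal (\<eta> (x - y))"
      using mollifierD(4)[OF assms(2), of "x - y"] norm_triangle_sub[of y x]
      by (cases "\<eta> (x - y) = 0") (auto simp: indicator_def norm_minus_commute)
  qed
  also have "\<dots> = (\<integral>\<^sup>+y. ennreal \<bar>u y\<bar> * indicator (cball 0 (R + \<delta>)) y \<partial>lborel)"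
    by (subst nn_integral_cmult) (auto simp: mollifier_nn_integral[OF assms(2)])
  finally show ?thesis by (simp add: bnorm_def)
qed

lemma integrable_approx_continuous_indicator:
  fixes A :: "'a::euclidean_space set"
  assumes A: "A \<in> sets lborel" "emeasure lborel A < \<infinity>" and e: "0 < e"
  shows "\<exists>g. continuous_on UNIV g \<and> integrable lborel g \<and> (\<integral>x. \<bar>indicator A x - g x\<bar> \<partial>lborel) < (e::real)"
proof -
  have Ab: "A \<in> sets borel" using A by simp
  obtain U where U: "open U" "A \<subseteq> U" "emeasure lborel (U - A) < ennreal (e / 2)"
    using outer_regular_lborel[OF Ab, of "e / 2"] e by auto
  \<comment> \<open>Outer regularity of the complement of A gives the approximation of A from inside
    by a closed set.\<close>
  obtain U' where U': "open U'" "- A \<subseteq> U'" "emeasure lborel (U' - (- A)) < ennreal (e / 2)"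
    using outer_regular_lborel[of "- A" "e / 2"] Ab e by auto
  define K where "K = - U'"
  have K: "closed K" "K \<subseteq> A" using U' by (auto simp: K_def)
  have UK: "emeasure lborel (U - K) < ennreal e"
  proof -
    have "U - K = (U - A) \<union> (U' - (- A))" using U U' by (auto simp: K_def)
    then have "emeasure lborel (U - K) \<le> emeasure lborel (U - A) + emeasure lborel (U' - (- A))"
      using U(1) U'(1) Ab by (auto intro!: emeasure_subadditive)
    also have "\<dots> < ennreal (e / 2) + ennreal (e / 2)" by (intro add_strict_mono U U')
    also have "\<dots> = ennreal e" using e by (simp flip: ennreal_plus)
    finally show ?thesis .
  qed
  obtain g :: "'a \<Rightarrow> real" where g: "continuous_on UNIV g" "\<And>x. g x \<in> closed_segment 1 0"
    "\<And>x. x \<in> K \<Longrightarrow> g x = 1" "\<And>x. x \<in> - U \<Longrightarrow> g x = 0"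
    using Urysohn[of K "- U" "1::real" 0] K U by (auto simp: closed_def)
  have g01: "0 \<le> g x" "g x \<le> 1" for x using g(2)[of x] by (auto simp: closed_segment_eq_real_ivl)
  note [measurable] = borel_measurable_continuous_onI[OF g(1)] Ab borel_open[OF U(1)] borel_closed[OF K(1)]
  have UKf: "integrable lborel (indicator (U - K) :: 'a \<Rightarrow> real)"
    using UK by (subst integrable_indicator_iff) (auto intro: less_trans)
  have Ai: "integrable lborel (indicator A :: 'a \<Rightarrow> real)"
    using A by (subst integrable_indicator_iff) auto
  have le: "\<bar>indicator A x - g x\<bar> \<le> indicator (U - K) x" for x
    using g01[of x] g(3,4)[of x] U(2) K(2) by (auto simp: indicator_def)
  have gi: "integrable lborel (\<lambda>x. indicator A x - g x)"
    by (rule Bochner_Integration.integrable_bound[OF UKf]) (use le in auto)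
  have "integrable lborel g"
    using Bochner_Integration.integrable_diff[OF Ai gi] by simp
  moreover have "(\<integral>x. \<bar>indicator A x - g x\<bar> \<partial>lborel) \<le> (\<integral>x. indicator (U - K) x \<partial>lborel)"
    using le by (intro integral_mono integrable_abs gi UKf)
  moreover have "(\<integral>x. indicator (U - K) x \<partial>lborel) < e"
    using UK e by (simp add: measure_def enn2real_less_iff less_trans[OF UK])
  ultimately show ?thesis using g(1) by (intro exI[of _ g]) auto
qed

lemma integrable_approx_continuous:
  fixes f :: "'a::euclidean_space \<Rightarrow> real"
  assumes "integrable lborel f" "0 < e"
  shows "\<exists>g. continuous_on UNIV g \<and> integrable lborel g \<and> (\<integral>x. \<bar>f x - g x\<bar> \<partial>lborel) < e"
  using assms
proof (induction arbitrary: e rule: integrable_induct)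
  case (base A c)
  obtain g where g: "continuous_on UNIV g" "integrable lborel g"
    "(\<integral>x. \<bar>indicator A x - g x\<bar> \<partial>lborel) < e / (1 + \<bar>c\<bar>)"
    using integrable_approx_continuous_indicator[of A "e / (1 + \<bar>c\<bar>)"] base by auto
  have "(\<integral>x. \<bar>indicator A x *\<^sub>R c - c * g x\<bar> \<partial>lborel) = (\<integral>x. \<bar>c\<bar> * \<bar>indicator A x - g x\<bar> \<partial>lborel)"
    by (intro Bochner_Integration.integral_cong) (auto simp: abs_mult[symmetric] algebra_simps)
  also have "\<dots> = \<bar>c\<bar> * (\<integral>x. \<bar>indicator A x - g x\<bar> \<partial>lborel)" by simp
  also have "\<dots> \<le> (1 + \<bar>c\<bar>) * (\<integral>x. \<bar>indicator A x - g x\<bar> \<partial>lborel)" by (intro mult_right_mono) auto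
  also have "\<dots> < e" using g(3) by (simp add: field_simps)
  finally show ?case using g by (intro exI[of _ "\<lambda>x. c * g x"]) (auto intro: continuous_intros)
next
  case (add f1 f2)
  obtain g1 where g1: "continuous_on UNIV g1" "integrable lborel g1" "(\<integral>x. \<bar>f1 x - g1 x\<bar> \<partial>lborel) < e / 2"
    using add.IH(1)[of "e / 2"] add.prems by auto
  obtain g2 where g2: "continuous_on UNIV g2" "integrable lborel g2" "(\<integral>x. \<bar>f2 x - g2 x\<bar> \<partial>lborel) < e / 2"
    using add.IH(2)[of "e / 2"] add.prems by auto
  have "(\<integral>x. \<bar>f1 x + f2 x - (g1 x + g2 x)\<bar> \<partial>lborel) \<le> (\<integral>x. \<bar>f1 x - g1 x\<bar> + \<bar>f2 x - g2 x\<bar> \<partial>lborel)"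
    using add.hyps g1(2) g2(2) by (intro integral_mono) auto
  also have "\<dots> = (\<integral>x. \<bar>f1 x - g1 x\<bar> \<partial>lborel) + (\<integral>x. \<bar>f2 x - g2 x\<bar> \<partial>lborel)"
    using add.hyps g1(2) g2(2) by (intro Bochner_Integration.integral_add) auto
  also have "\<dots> < e" using g1 g2 by simp
  finally show ?case using g1 g2 by (intro exI[of _ "\<lambda>x. g1 x + g2 x"]) (auto intro: continuous_intros)
next
  case (lim f s)
  have "(\<lambda>i. \<integral>x. \<bar>f x - s i x\<bar> \<partial>lborel) \<longlonglongrightarrow> (\<integral>x. 0 \<partial>(lborel :: 'a measure))"
  proof (rule integral_dominated_convergence)
    show "integrable lborel (\<lambda>x. 3 * \<bar>f x\<bar>)" using lim by auto
    show "AE x in lborel. (\<lambda>i. \<bar>f x - s i x\<bar>) \<longlonglongrightarrow> 0"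
    proof (rule AE_I2)
      fix x :: 'a
      have "(\<lambda>i. f x - s i x) \<longlonglongrightarrow> f x - f x" using lim.hyps(2) by (intro tendsto_intros) auto
      then show "(\<lambda>i. \<bar>f x - s i x\<bar>) \<longlonglongrightarrow> 0" by (intro tendsto_rabs_zero) simp
    qed
    show "AE x in lborel. norm \<bar>f x - s i x\<bar> \<le> 3 * \<bar>f x\<bar>" for i
      using lim.hyps(3)[of _ i] by (intro AE_I2) (smt (verit) real_norm_def space_lborel UNIV_I)
  qed (use lim in auto)
  then have "eventually (\<lambda>i. (\<integral>x. \<bar>f x - s i x\<bar> \<partial>lborel) < e / 2) sequentially"
    using lim.prems by (intro order_tendstoD(2)) auto
  then obtain i where i: "(\<integral>x. \<bar>f x - s i x\<bar> \<partial>lborel) < e / 2" by (auto simp: eventually_sequentially)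
  obtain g where g: "continuous_on UNIV g" "integrable lborel g" "(\<integral>x. \<bar>s i x - g x\<bar> \<partial>lborel) < e / 2"
    using lim.IH[of "e / 2" i] lim.prems by auto
  have "(\<integral>x. \<bar>f x - g x\<bar> \<partial>lborel) \<le> (\<integral>x. \<bar>f x - s i x\<bar> + \<bar>s i x - g x\<bar> \<partial>lborel)"
    using lim.hyps g(2) by (intro integral_mono) auto
  also have "\<dots> = (\<integral>x. \<bar>f x - s i x\<bar> \<partial>lborel) + (\<integral>x. \<bar>s i x - g x\<bar> \<partial>lborel)"
    using lim.hyps g(2) by (intro Bochner_Integration.integral_add) auto
  also have "\<dots> < e" using g i by simp
  finally show ?case using g by auto
qed

lemma mollifier_integral_reflect:
  assumes "mollifier \<eta> \<delta>"
  shows "(\<integral>y. \<eta> (x - y) \<partial>lborel) = 1"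
  using mollifier_nn_integral(1)[OF assms, of x] mollifierD(2)[OF assms]
    test_function_borel[OF test_function_reflect[OF mollifierD(1)[OF assms], of x]]
  by (subst integral_eq_nn_integral) auto

lemma conv_minus_const:
  assumes "loc_int u" "mollifier \<eta> \<delta>"
  shows "conv u \<eta> x - c = (\<integral>y. (u y - c) * \<eta> (x - y) \<partial>lborel)"
    and "integrable lborel (\<lambda>y. (u y - c) * \<eta> (x - y))"
proof -
  note t = test_function_reflect[OF mollifierD(1)[OF assms(2)], of x]
  have "conv u \<eta> x - c = (\<integral>y. u y * \<eta> (x - y) \<partial>lborel) - (\<integral>y. c * \<eta> (x - y) \<partial>lborel)"
    using mollifier_integral_reflect[OF assms(2)] by (simp add: conv_def)
  also have "\<dots> = (\<integral>y. u y * \<eta> (x - y) - c * \<eta> (x - y) \<partial>lborel)"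
    using conv_integrable[OF assms(1) mollifierD(1)[OF assms(2)]] test_function_integrable[OF t]
    by (intro Bochner_Integration.integral_diff[symmetric]) auto
  finally show "conv u \<eta> x - c = (\<integral>y. (u y - c) * \<eta> (x - y) \<partial>lborel)" by (simp only: left_diff_distrib)
  show "integrable lborel (\<lambda>y. (u y - c) * \<eta> (x - y))"
    using conv_integrable[OF assms(1) mollifierD(1)[OF assms(2)]] test_function_integrable[OF t]
    by (simp add: left_diff_distrib)
qed

lemma conv_diff_const:
  assumes "loc_int u" "mollifier \<eta> \<delta>" "\<And>y. norm (x - y) \<le> \<delta> \<Longrightarrow> \<bar>u y - c\<bar> \<le> e"
  shows "\<bar>conv u \<eta> x - c\<bar> \<le> e"
proof -
  note t = test_function_reflect[OF mollifierD(1)[OF assms(2)], of x]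
  have "\<bar>conv u \<eta> x - c\<bar> = \<bar>\<integral>y. (u y - c) * \<eta> (x - y) \<partial>lborel\<bar>"
    by (simp only: conv_minus_const(1)[OF assms(1,2)])
  also have "\<dots> \<le> (\<integral>y. e * \<eta> (x - y) \<partial>lborel)"
  proof (rule order_trans[OF integral_abs_bound integral_mono])
    show "integrable lborel (\<lambda>y. \<bar>(u y - c) * \<eta> (x - y)\<bar>)"
      by (rule integrable_abs[OF conv_minus_const(2)[OF assms(1,2)]])
    show "integrable lborel (\<lambda>y. e * \<eta> (x - y))" using test_function_integrable[OF t] by simp
    fix y
    have "\<bar>(u y - c) * \<eta> (x - y)\<bar> = \<bar>u y - c\<bar> * \<eta> (x - y)"
      using mollifierD(2)[OF assms(2), of "x - y"] by (simp add: abs_mult)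
    also have "\<dots> \<le> e * \<eta> (x - y)"
      using mollifierD(2,4)[OF assms(2), of "x - y"] assms(3)[of y]
      by (cases "\<eta> (x - y) = 0") (auto intro: mult_right_mono)
    finally show "\<bar>(u y - c) * \<eta> (x - y)\<bar> \<le> e * \<eta> (x - y)" .
  qed
  also have "\<dots> = e" using mollifier_integral_reflect[OF assms(2)] by simp
  finally show ?thesis .
qed

lemma ennreal_tendsto_0I:
  fixes f :: "'b \<Rightarrow> ennreal"
  assumes "\<And>e::real. 0 < e \<Longrightarrow> eventually (\<lambda>x. f x \<le> ennreal e) F"
  shows "(f \<longlongrightarrow> 0) F"
proof (rule order_tendstoI)
  fix a :: ennreal assume "0 < a"
  then obtain b where b: "0 < b" "b < a" using dense by blast
  then obtain e where e: "b = ennreal e" "0 < e"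
    by (cases b) auto
  from assms[OF e(2)] show "eventually (\<lambda>x. f x < a) F"
    by eventually_elim (use b e in auto)
qed auto

lemma conv_diff:
  assumes "loc_int u" "loc_int v" "\<phi> \<in> test_functions"
  shows "conv (\<lambda>x. u x - v x) \<phi> x = conv u \<phi> x - conv v \<phi> x"
  using conv_integrable[OF assms(1,3)] conv_integrable[OF assms(2,3)]
  by (simp add: conv_def left_diff_distrib)

text \<open>An e/3 argument. A continuous g approximates u on a slightly larger ball, mollifying u -
  g does not enlarge its seminorm except for the change of radius, and mollifications of g converge
  uniformly on the ball.\<close>

lemma conv_tendsto:
  fixes u :: "'a::euclidean_space \<Rightarrow> real"
  assumes "loc_int u" "\<And>k. mollifier (\<eta> k) (\<delta> k)" "\<delta> \<longlonglongrightarrow> 0"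
  shows "(\<lambda>k. bnorm R (\<lambda>x. conv u (\<eta> k) x - u x)) \<longlonglongrightarrow> 0"
proof (rule ennreal_tendsto_0I)
  fix e :: real assume e: "0 < e"
  \<comment> \<open>The margin 1 contains everything that a mollifier of radius below 1 sees from
    the ball of radius R.\<close>
  define S where "S = cball (0::'a) (R + 1)"
  define vol where "vol = measure lborel (cball (0::'a) R)"
  have vol: "emeasure lborel (cball (0::'a) R) = ennreal vol"
    unfolding vol_def using emeasure_lborel_cball_finite[of "0::'a" R] by (intro emeasure_eq_ennreal_measure) auto
  obtain g :: "'a \<Rightarrow> real" where g: "continuous_on UNIV g" "integrable lborel g"
    "(\<integral>x. \<bar>indicator S x * u x - g x\<bar> \<partial>lborel) < e / 3"
    using integrable_approx_continuous[OF loc_int_indicator_integrable[OF assms(1), of "R + 1"], of "e / 3"] e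
    by (auto simp: S_def)
  have gl: "loc_int g" by (rule integrable_loc_int[OF g(2)])
  note [measurable] = loc_int_borel[OF assms(1)] loc_int_borel[OF gl]
    test_function_borel[OF mollifierD(1)[OF assms(2)]]
  have ug: "bnorm (R + 1) (\<lambda>x. u x - g x) \<le> ennreal (e / 3)"
  proof -
    have i: "integrable lborel (\<lambda>x. indicator S x * u x - g x)"
      unfolding S_def by (intro Bochner_Integration.integrable_diff loc_int_indicator_integrable assms g)
    have "bnorm (R + 1) (\<lambda>x. u x - g x) \<le> (\<integral>\<^sup>+x. ennreal \<bar>indicator S x * u x - g x\<bar> \<partial>lborel)"
      unfolding bnorm_def S_def by (intro nn_integral_mono) (auto simp: indicator_def)
    also have "\<dots> = ennreal (\<integral>x. \<bar>indicator S x * u x - g x\<bar> \<partial>lborel)"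
      using i by (intro nn_integral_eq_integral) auto
    finally show ?thesis using g(3) by (meson ennreal_leI less_imp_le order_trans)
  qed
  have "uniformly_continuous_on S g"
    unfolding S_def using continuous_on_subset[OF g(1)] by (intro compact_uniformly_continuous) auto
  \<comment> \<open>Dividing by 1 + vol makes the tolerance meaningful also when the ball has volume
    0.\<close>
  moreover have ee: "0 < e / 3 / (1 + vol)" using e by (simp add: vol_def add_pos_nonneg)
  ultimately obtain d where d: "0 < d" "\<And>x y. x \<in> S \<Longrightarrow> y \<in> S \<Longrightarrow> dist y x < d \<Longrightarrow> dist (g y) (g x) < e / 3 / (1 + vol)"
    unfolding uniformly_continuous_on_def by metis
  have "eventually (\<lambda>k. \<delta> k < min 1 d) sequentially"
    using d(1) by (intro order_tendstoD(2)[OF assms(3)]) auto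
  then show "eventually (\<lambda>k. bnorm R (\<lambda>x. conv u (\<eta> k) x - u x) \<le> ennreal e) sequentially"
  proof eventually_elim
    case (elim k)
    have 1: "bnorm R (\<lambda>x. conv u (\<eta> k) x - u x)
        \<le> bnorm R (\<lambda>x. conv (\<lambda>x. u x - g x) (\<eta> k) x) + bnorm R (\<lambda>x. (conv g (\<eta> k) x - g x) + (g x - u x))"
      by (rule bnorm_triangle) (auto simp: conv_diff[OF assms(1) gl mollifierD(1)[OF assms(2)]])
    have "bnorm R (\<lambda>x. conv (\<lambda>x. u x - g x) (\<eta> k) x) \<le> bnorm (R + \<delta> k) (\<lambda>x. u x - g x)"
      by (rule bnorm_conv_le[OF loc_int_diff[OF assms(1) gl] assms(2)])
    also have "\<dots> \<le> bnorm (R + 1) (\<lambda>x. u x - g x)" using elim by (intro bnorm_mono_radius) auto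
    also have "\<dots> \<le> ennreal (e / 3)" by (rule ug)
    finally have 2: "bnorm R (\<lambda>x. conv (\<lambda>x. u x - g x) (\<eta> k) x) \<le> ennreal (e / 3)" .
    have 3: "bnorm R (\<lambda>x. (conv g (\<eta> k) x - g x) + (g x - u x)) \<le> bnorm R (\<lambda>x. conv g (\<eta> k) x - g x) + bnorm R (\<lambda>x. g x - u x)"
      by (rule bnorm_add) auto
    have "bnorm R (\<lambda>x. g x - u x) = bnorm R (\<lambda>x. u x - g x)" by (simp add: bnorm_def abs_minus_commute)
    also have "\<dots> \<le> bnorm (R + 1) (\<lambda>x. u x - g x)" by (intro bnorm_mono_radius) auto
    also have "\<dots> \<le> ennreal (e / 3)" by (rule ug)
    finally have 4: "bnorm R (\<lambda>x. g x - u x) \<le> ennreal (e / 3)" .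
    have "bnorm R (\<lambda>x. conv g (\<eta> k) x - g x) \<le> ennreal (e / 3 / (1 + vol)) * emeasure lborel (cball (0::'a) R)"
    proof (rule bnorm_bound, rule conv_diff_const[OF gl assms(2)])
      fix x y :: 'a assume "norm x \<le> R" "norm (x - y) \<le> \<delta> k"
      then show "\<bar>g y - g x\<bar> \<le> e / 3 / (1 + vol)"
        using d(2)[of x y] elim norm_triangle_sub[of y x]
        by (auto simp: S_def dist_norm norm_minus_commute less_imp_le)
    qed
    also have "\<dots> = ennreal (e / 3 / (1 + vol) * vol)" unfolding vol using ee by (subst ennreal_mult) (auto simp: vol_def)
    also have "\<dots> \<le> ennreal (e / 3)"
    proof (rule ennreal_leI)
      have "0 \<le> vol" by (simp add: vol_def)
      then have "vol / (1 + vol) \<le> 1" by simp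
      then have "e / 3 * (vol / (1 + vol)) \<le> e / 3 * 1" using e by (intro mult_left_mono) auto
      then show "e / 3 / (1 + vol) * vol \<le> e / 3" by simp
    qed
    finally have 5: "bnorm R (\<lambda>x. conv g (\<eta> k) x - g x) \<le> ennreal (e / 3)" .
    have "bnorm R (\<lambda>x. conv u (\<eta> k) x - u x) \<le> ennreal (e / 3) + (ennreal (e / 3) + ennreal (e / 3))"
      by (rule order_trans[OF 1 add_mono[OF 2 order_trans[OF 3 add_mono[OF 5 4]]]])
    also have "\<dots> = ennreal e" using e by (simp flip: ennreal_plus)
    finally show ?case .
  qed
qed

section \<open>Translation estimates and the rate of mollification\<close>

lemma translate_bound:
  fixes v :: "'a::euclidean_space \<Rightarrow> real"
  assumes d: "\<And>i. i \<in> Basis \<Longrightarrow> continuous_on UNIV (d i)"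
    and der: "\<And>x h. ((\<lambda>t. v (x + t *\<^sub>R h)) has_real_derivative (\<Sum>i\<in>Basis. (h \<bullet> i) * d i x)) (at 0)"
  shows "ennreal \<bar>v (x - h) - v x\<bar> \<le> (\<integral>\<^sup>+t. ennreal (norm h * (\<Sum>i\<in>Basis. \<bar>d i (x - t *\<^sub>R h)\<bar>)) * indicator {0..1} t \<partial>lborel)"
proof -
  define F where "F t = v (x - t *\<^sub>R h)" for t :: real
  define f where "f t = (\<Sum>i\<in>Basis. (- h \<bullet> i) * d i (x - t *\<^sub>R h))" for t :: real
  have cd: "continuous_on A (\<lambda>t. d i (x - t *\<^sub>R h))" if "i \<in> Basis" for i and A :: "real set"
    by (rule continuous_on_compose2[OF d[OF that]]) (auto intro!: continuous_intros)
  have cf: "continuous_on A f" for A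
    unfolding f_def by (intro continuous_intros cd)
  have "(F has_real_derivative f t) (at t)" for t
  proof -
    have "((\<lambda>s. F (s + t)) has_real_derivative f t) (at 0)"
      using der[of "x - t *\<^sub>R h" "- h"] unfolding F_def f_def by (simp add: algebra_simps)
    then show ?thesis using DERIV_shift[of F "f t" 0 t] by simp
  qed
  then have F: "(F has_vector_derivative f t) (at t within {0..1})" for t
    by (meson has_real_derivative_iff_has_vector_derivative has_vector_derivative_at_within)
  have h: "has_bochner_integral lborel (\<lambda>t. indicator {0..1} t *\<^sub>R f t) (F 1 - F 0)"
    by (rule has_bochner_integral_FTC_Icc) (use F cf in auto)
  have "ennreal \<bar>F 1 - F 0\<bar> \<le> (\<integral>\<^sup>+t. ennreal (norm (indicator {0..1} t *\<^sub>R f t)) \<partial>lborel)"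
    using integral_norm_bound_ennreal[of lborel "\<lambda>t. indicator {0..1} t *\<^sub>R f t"] h by (simp add: has_bochner_integral_iff)
  also have "\<dots> \<le> (\<integral>\<^sup>+t. ennreal (norm h * (\<Sum>i\<in>Basis. \<bar>d i (x - t *\<^sub>R h)\<bar>)) * indicator {0..1} t \<partial>lborel)"
  proof (rule nn_integral_mono)
    fix t :: real
    have "\<bar>f t\<bar> \<le> (\<Sum>i\<in>Basis. norm h * \<bar>d i (x - t *\<^sub>R h)\<bar>)"
      unfolding f_def by (rule order_trans[OF sum_abs sum_mono]) (auto simp: abs_mult Basis_le_norm intro!: mult_right_mono)
    then show "ennreal (norm (indicator {0..1} t *\<^sub>R f t)) \<le> ennreal (norm h * (\<Sum>i\<in>Basis. \<bar>d i (x - t *\<^sub>R h)\<bar>)) * indicator {0..1} t"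
      by (auto simp: indicator_def sum_distrib_left intro: ennreal_leI)
  qed
  finally show ?thesis by (simp add: F_def)
qed

text \<open>The fundamental theorem of calculus along the segment from x to x - h, integrated over
  x. After exchanging the integrals, every intermediate shift t h only costs an enlargement of the
  ball by |h|.\<close>

lemma bnorm_translate:
  fixes v :: "'a::euclidean_space \<Rightarrow> real"
  assumes d: "\<And>i. i \<in> Basis \<Longrightarrow> continuous_on UNIV (d i)"
    and der: "\<And>x h. ((\<lambda>t. v (x + t *\<^sub>R h)) has_real_derivative (\<Sum>i\<in>Basis. (h \<bullet> i) * d i x)) (at 0)"
  shows "bnorm R (\<lambda>x. v (x - h) - v x) \<le> ennreal (norm h) * (\<Sum>i\<in>Basis. bnorm (R + norm h) (d i))"
proof -
  have [measurable]: "d i \<in> borel_measurable borel" if "i \<in> Basis" for i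
    by (rule borel_measurable_continuous_onI[OF d[OF that]])
  \<comment> \<open>The indicator of the larger ball is built into q, so that translation invariance
    applies to q as a function on the whole space.\<close>
  define q where "q y = ennreal (norm h) * (\<Sum>i\<in>Basis. ennreal \<bar>d i y\<bar> * indicator (cball 0 (R + norm h)) y)" for y
  have [measurable]: "q \<in> borel_measurable borel" unfolding q_def by measurable
  have "bnorm R (\<lambda>x. v (x - h) - v x) \<le> (\<integral>\<^sup>+x. (\<integral>\<^sup>+t. q (x - t *\<^sub>R h) * indicator {0..1} t \<partial>lborel) \<partial>lborel)"
    unfolding bnorm_def
  proof (rule nn_integral_mono)
    fix x :: 'a
    show "ennreal \<bar>v (x - h) - v x\<bar> * indicator (cball 0 R) x \<le> (\<integral>\<^sup>+t. q (x - t *\<^sub>R h) * indicator {0..1} t \<partial>lborel)"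
    proof (cases "norm x \<le> R")
      case True
      have le: "(\<integral>\<^sup>+t. ennreal (norm h * (\<Sum>i\<in>Basis. \<bar>d i (x - t *\<^sub>R h)\<bar>)) * indicator {0..1} t \<partial>lborel)
          \<le> (\<integral>\<^sup>+t. q (x - t *\<^sub>R h) * indicator {0..1} t \<partial>lborel)"
      proof (rule nn_integral_mono)
        fix t :: real
        have "norm (x - t *\<^sub>R h) \<le> R + norm h" if "t \<in> {0..1}"
        proof -
          have "norm (x - t *\<^sub>R h) \<le> norm x + norm (t *\<^sub>R h)" by (rule norm_triangle_ineq4)
          also have "norm (t *\<^sub>R h) \<le> norm h" using that by (simp add: mult_left_le_one_le)
          finally show ?thesis using True by simp
        qed
        note * = this
        show "ennreal (norm h * (\<Sum>i\<in>Basis. \<bar>d i (x - t *\<^sub>R h)\<bar>)) * indicator {0..1} t \<le> q (x - t *\<^sub>R h) * indicator {0..1} t"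
        proof (cases "t \<in> {0..1}")
          case True
          have "ennreal (norm h * (\<Sum>i\<in>Basis. \<bar>d i (x - t *\<^sub>R h)\<bar>)) = ennreal (norm h) * (\<Sum>i\<in>Basis. ennreal \<bar>d i (x - t *\<^sub>R h)\<bar>)"
            by (subst ennreal_mult) (auto simp: sum_nonneg)
          also have "\<dots> = q (x - t *\<^sub>R h)"
            unfolding q_def using *[OF True] by simp
          finally show ?thesis by simp
        qed simp
      qed
      have ind: "indicator (cball 0 R) x = (1::ennreal)" using True by simp
      show ?thesis unfolding ind mult_1_right by (rule order_trans[OF translate_bound[OF d der] le])
    qed simp
  qed
  also have "\<dots> = (\<integral>\<^sup>+t. (\<integral>\<^sup>+x. q (x - t *\<^sub>R h) * indicator {0..1} t \<partial>lborel) \<partial>lborel)"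
    by (rule lborel_pair.Fubini') measurable
  also have "\<dots> = (\<integral>\<^sup>+t. (\<integral>\<^sup>+x. q x \<partial>lborel) * indicator {0..1} (t::real) \<partial>lborel)"
  proof (rule nn_integral_cong)
    fix t :: real
    have "(\<integral>\<^sup>+x. q (x - t *\<^sub>R h) * indicator {0..1} t \<partial>lborel) = (\<integral>\<^sup>+x. q (x - t *\<^sub>R h) \<partial>lborel) * indicator {0..1} t"
      by (rule nn_integral_multc) measurable
    also have "(\<integral>\<^sup>+x. q (x - t *\<^sub>R h) \<partial>lborel) = (\<integral>\<^sup>+x. q x \<partial>lborel)"
      using nn_integral_lborel_shift[of q "- (t *\<^sub>R h)"] by simp
    finally show "(\<integral>\<^sup>+x. q (x - t *\<^sub>R h) * indicator {0..1} t \<partial>lborel) = (\<integral>\<^sup>+x. q x \<partial>lborel) * indicator {0..1} t" .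
  qed
  also have "\<dots> = (\<integral>\<^sup>+x. q x \<partial>lborel)" by (subst nn_integral_cmult) auto
  also have "\<dots> = ennreal (norm h) * (\<Sum>i\<in>Basis. bnorm (R + norm h) (d i))"
    unfolding q_def bnorm_def by (subst nn_integral_cmult, measurable, subst nn_integral_sum) auto
  finally show ?thesis .
qed

text \<open>As \<eta> has total mass 1, conv v \<eta> - v is the \<eta>-average of the increments
  v(x - z) - v(x) with |z| <= \<delta>, to which the translation estimate applies.\<close>

lemma bnorm_conv_diff_smooth:
  fixes v :: "'a::euclidean_space \<Rightarrow> real"
  assumes v: "loc_int v" and d: "\<And>i. i \<in> Basis \<Longrightarrow> continuous_on UNIV (d i)"
    and der: "\<And>x h. ((\<lambda>t. v (x + t *\<^sub>R h)) has_real_derivative (\<Sum>i\<in>Basis. (h \<bullet> i) * d i x)) (at 0)"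
    and m: "mollifier \<eta> \<delta>"
  shows "bnorm R (\<lambda>x. conv v \<eta> x - v x) \<le> ennreal \<delta> * (\<Sum>i\<in>Basis. bnorm (R + \<delta>) (d i))"
proof -
  note [measurable] = test_function_borel[OF mollifierD(1)[OF m]] loc_int_borel[OF v]
  define C where "C = ennreal \<delta> * (\<Sum>i\<in>Basis. bnorm (R + \<delta>) (d i))"
  have "bnorm R (\<lambda>x. conv v \<eta> x - v x)
      \<le> (\<integral>\<^sup>+x. (\<integral>\<^sup>+z. ennreal \<bar>v (x - z) - v x\<bar> * ennreal (\<eta> z) * indicator (cball 0 R) x \<partial>lborel) \<partial>lborel)"
    unfolding bnorm_def
  proof (rule nn_integral_mono)
    fix x :: 'a
    have "ennreal \<bar>conv v \<eta> x - v x\<bar> \<le> (\<integral>\<^sup>+y. ennreal (norm ((v y - v x) * \<eta> (x - y))) \<partial>lborel)"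
      unfolding conv_minus_const(1)[OF v m]
      using integral_norm_bound_ennreal[OF conv_minus_const(2)[OF v m, of "v x" x]] by simp
    also have "\<dots> = (\<integral>\<^sup>+y. (\<lambda>z. ennreal \<bar>v (x - z) - v x\<bar> * ennreal (\<eta> z)) (x - y) \<partial>lborel)"
      using mollifierD(2)[OF m] by (simp add: abs_mult ennreal_mult)
    also have "\<dots> = (\<integral>\<^sup>+z. ennreal \<bar>v (x - z) - v x\<bar> * ennreal (\<eta> z) \<partial>lborel)"
      by (rule nn_integral_lborel_reflect) measurable
    finally show "ennreal \<bar>conv v \<eta> x - v x\<bar> * indicator (cball 0 R) x
        \<le> (\<integral>\<^sup>+z. ennreal \<bar>v (x - z) - v x\<bar> * ennreal (\<eta> z) * indicator (cball 0 R) x \<partial>lborel)"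
      by (auto simp: indicator_def)
  qed
  also have "\<dots> = (\<integral>\<^sup>+z. (\<integral>\<^sup>+x. ennreal \<bar>v (x - z) - v x\<bar> * ennreal (\<eta> z) * indicator (cball 0 R) x \<partial>lborel) \<partial>lborel)"
    by (rule lborel_pair.Fubini') measurable
  also have "\<dots> \<le> (\<integral>\<^sup>+z. C * ennreal (\<eta> z) \<partial>lborel)"
  proof (rule nn_integral_mono)
    fix z :: 'a
    have "(\<integral>\<^sup>+x. ennreal \<bar>v (x - z) - v x\<bar> * ennreal (\<eta> z) * indicator (cball 0 R) x \<partial>lborel)
        = (\<integral>\<^sup>+x. ennreal (\<eta> z) * (ennreal \<bar>v (x - z) - v x\<bar> * indicator (cball 0 R) x) \<partial>lborel)"
      by (simp add: mult_ac)
    also have "\<dots> = ennreal (\<eta> z) * bnorm R (\<lambda>x. v (x - z) - v x)"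
      unfolding bnorm_def by (rule nn_integral_cmult) measurable
    also have "\<dots> \<le> ennreal (\<eta> z) * C"
    proof (cases "\<eta> z = 0")
      case False
      then have z: "norm z \<le> \<delta>" using mollifierD(4)[OF m] by blast
      have "bnorm R (\<lambda>x. v (x - z) - v x) \<le> ennreal (norm z) * (\<Sum>i\<in>Basis. bnorm (R + norm z) (d i))"
        by (rule bnorm_translate[OF d der])
      also have "\<dots> \<le> C"
        unfolding C_def using z by (intro mult_mono sum_mono bnorm_mono_radius ennreal_leI) auto
      finally show ?thesis by (rule mult_left_mono) simp
    qed simp
    finally show "(\<integral>\<^sup>+x. ennreal \<bar>v (x - z) - v x\<bar> * ennreal (\<eta> z) * indicator (cball 0 R) x \<partial>lborel) \<le> C * ennreal (\<eta> z)"
      by (simp add: mult.commute)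
  qed
  also have "\<dots> = C" using mollifier_nn_integral(2)[OF m, of 0] by (subst nn_integral_cmult) auto
  finally show ?thesis by (simp add: C_def)
qed

lemma mollifier_sequence:
  obtains \<eta> :: "nat \<Rightarrow> 'a::euclidean_space \<Rightarrow> real" where "\<And>k. mollifier (\<eta> k) (1 / real (Suc k))"
  using mollifier_exists[where 'a='a, of "1 / real (Suc _)"] by (metis of_nat_0_less_iff zero_less_Suc zero_less_divide_1_iff)

lemma lim_1_Suc: "(\<lambda>k. 1 / real (Suc k)) \<longlonglongrightarrow> 0"
  using LIMSEQ_inverse_real_of_nat by (simp add: inverse_eq_divide)

lemma conv_loc_int: "loc_int u \<Longrightarrow> mollifier \<eta> \<delta> \<Longrightarrow> loc_int (conv u \<eta>)"
  unfolding loc_int_def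
  by (meson bnorm_conv_le conv_borel le_less_trans loc_int_def mollifierD(1) test_function_borel)

lemma has_weak_deriv_loc_int: "has_weak_deriv u is g \<Longrightarrow> loc_int u \<and> loc_int g"
  by (simp add: has_weak_deriv_def Lp_loc_1_iff)

lemma conv_deriv:
  assumes "\<And>i. i \<in> Basis \<Longrightarrow> has_weak_deriv u [i] (g i)" "\<phi> \<in> test_functions"
  shows "((\<lambda>t. conv u \<phi> (x + t *\<^sub>R h)) has_real_derivative (\<Sum>i\<in>Basis. (h \<bullet> i) * conv (g i) \<phi> x)) (at 0)"
proof -
  have "loc_int u" using has_weak_deriv_loc_int[OF assms(1)] nonempty_Basis by blast
  from conv_has_derivative[OF this assms(2), of x h] show ?thesis
    using conv_weak_deriv[OF assms(1) _ assms(2), of _ x] by (simp del: partials.simps cong: sum.cong)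
qed

text \<open>A rate of order \<delta> whose constant involves u only through its gradient, hence
  uniform over families with dominated gradients. The smooth case is transferred by first mollifying
  u with \<rho> k; this widens the balls by at most 1, which explains the radius R + \<delta> +
  1.\<close>

lemma bnorm_conv_diff:
  fixes u :: "'a::euclidean_space \<Rightarrow> real"
  assumes g: "\<And>i. i \<in> Basis \<Longrightarrow> has_weak_deriv u [i] (g i)" and m: "mollifier \<eta> \<delta>"
  shows "bnorm R (\<lambda>x. conv u \<eta> x - u x) \<le> ennreal \<delta> * (\<Sum>i\<in>Basis. bnorm (R + \<delta> + 1) (g i))"
proof -
  have u: "loc_int u" using has_weak_deriv_loc_int[OF g] nonempty_Basis by blast
  have gi: "loc_int (g i)" if "i \<in> Basis" for i using has_weak_deriv_loc_int[OF g[OF that]] by blast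
  obtain \<rho> :: "nat \<Rightarrow> 'a \<Rightarrow> real" where \<rho>: "\<And>k. mollifier (\<rho> k) (1 / real (Suc k))" using mollifier_sequence by blast
  define v where "v k = conv u (\<rho> k)" for k
  have vl: "loc_int (v k)" for k unfolding v_def by (rule conv_loc_int[OF u \<rho>])
  note [measurable] = loc_int_borel[OF u] loc_int_borel[OF vl] test_function_borel[OF mollifierD(1)[OF m]]
  define C where "C = ennreal \<delta> * (\<Sum>i\<in>Basis. bnorm (R + \<delta> + 1) (g i))"
  \<comment> \<open>The error of replacing u by v k appears twice, once widened by \<delta> since it
    is mollified again; C does not depend on k.\<close>
  have step: "bnorm R (\<lambda>x. conv u \<eta> x - u x) \<le> bnorm (R + \<delta>) (\<lambda>x. v k x - u x) + (C + bnorm R (\<lambda>x. v k x - u x))" for k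
  proof -
    have 1: "bnorm R (\<lambda>x. conv u \<eta> x - u x) \<le> bnorm R (\<lambda>x. conv (\<lambda>x. v k x - u x) \<eta> x) + bnorm R (\<lambda>x. (conv (v k) \<eta> x - v k x) + (v k x - u x))"
      by (rule bnorm_triangle) (auto simp: conv_diff[OF vl u mollifierD(1)[OF m]])
    have 2: "bnorm R (\<lambda>x. conv (\<lambda>x. v k x - u x) \<eta> x) \<le> bnorm (R + \<delta>) (\<lambda>x. v k x - u x)"
      by (rule bnorm_conv_le[OF loc_int_diff[OF vl u] m])
    have 3: "bnorm R (\<lambda>x. (conv (v k) \<eta> x - v k x) + (v k x - u x)) \<le> bnorm R (\<lambda>x. conv (v k) \<eta> x - v k x) + bnorm R (\<lambda>x. v k x - u x)"
      by (rule bnorm_add) auto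
    have "bnorm R (\<lambda>x. conv (v k) \<eta> x - v k x) \<le> ennreal \<delta> * (\<Sum>i\<in>Basis. bnorm (R + \<delta>) (conv (g i) (\<rho> k)))"
    proof (rule bnorm_conv_diff_smooth[OF vl _ _ m])
      show "continuous_on UNIV (conv (g i) (\<rho> k))" if "i \<in> Basis" for i
        by (rule conv_continuous[OF gi[OF that] mollifierD(1)[OF \<rho>]])
      show "((\<lambda>t. v k (x + t *\<^sub>R h)) has_real_derivative (\<Sum>i\<in>Basis. (h \<bullet> i) * conv (g i) (\<rho> k) x)) (at 0)" for x h
        unfolding v_def by (rule conv_deriv[OF g mollifierD(1)[OF \<rho>]])
    qed
    also have "\<dots> \<le> C"
      unfolding C_def
    proof (intro mult_left_mono sum_mono)
      fix i :: 'a assume i: "i \<in> Basis"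
      have "bnorm (R + \<delta>) (conv (g i) (\<rho> k)) \<le> bnorm (R + \<delta> + 1 / real (Suc k)) (g i)"
        by (rule bnorm_conv_le[OF gi[OF i] \<rho>])
      also have "\<dots> \<le> bnorm (R + \<delta> + 1) (g i)" by (rule bnorm_mono_radius) simp
      finally show "bnorm (R + \<delta>) (conv (g i) (\<rho> k)) \<le> bnorm (R + \<delta> + 1) (g i)" .
    qed simp
    finally have 4: "bnorm R (\<lambda>x. conv (v k) \<eta> x - v k x) \<le> C" .
    show ?thesis by (rule order_trans[OF 1 add_mono[OF 2 order_trans[OF 3 add_mono[OF 4 order_refl]]]])
  qed
  have "(\<lambda>k. bnorm (R + \<delta>) (\<lambda>x. v k x - u x) + (C + bnorm R (\<lambda>x. v k x - u x))) \<longlonglongrightarrow> 0 + (C + 0)"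
    unfolding v_def by (intro tendsto_add tendsto_const conv_tendsto[OF u \<rho> lim_1_Suc])
  then have "bnorm R (\<lambda>x. conv u \<eta> x - u x) \<le> 0 + (C + 0)"
    by (rule LIMSEQ_le_const) (use step in auto)
  then show ?thesis by (simp add: C_def)
qed

section \<open>Weak derivatives\<close>

text \<open>By translation invariance the difference quotients of F have integral 0, and dominated
  convergence passes to the derivative. Only a bounded derivative along h is required, so the lemma
  also covers products with cutoffs that are merely C^1.\<close>

lemma integral_dir_deriv_zero:
  fixes F :: "'a::euclidean_space \<Rightarrow> real"
  assumes [measurable]: "F \<in> borel_measurable borel" "F' \<in> borel_measurable borel"
    and der: "\<And>x. ((\<lambda>t. F (x + t *\<^sub>R h)) has_real_derivative F' x) (at 0)"
    and L: "\<And>x. \<bar>F' x\<bar> \<le> L" and B: "\<And>x. \<bar>F x\<bar> \<le> B" and R: "\<And>x. F x \<noteq> 0 \<Longrightarrow> norm x \<le> R"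
  shows "(\<integral>x. F' x \<partial>lborel) = 0"
proof -
  define t where "t n = 1 / real (Suc n)" for n
  have t: "0 < t n" "t n \<le> 1" for n by (auto simp: t_def)
  have L0: "0 \<le> L" using L[of 0] by linarith
  have Fi: "integrable lborel F" by (rule bounded_support_integrable[OF assms(1) B R])
  have Fs: "integrable lborel (\<lambda>x. F (x + t n *\<^sub>R h))" for n
  proof (rule bounded_support_integrable[OF _ B])
    show "(\<lambda>x. F (x + t n *\<^sub>R h)) \<in> borel_measurable borel" by measurable
    fix x assume "F (x + t n *\<^sub>R h) \<noteq> 0"
    then have "norm (x + t n *\<^sub>R h) \<le> R" by (rule R)
    then show "norm x \<le> R + norm (t n *\<^sub>R h)" using norm_diff_triangle_ineq[of "x + t n *\<^sub>R h" "t n *\<^sub>R h" 0 0] norm_triangle_ineq4[of "x + t n *\<^sub>R h" "t n *\<^sub>R h"] by simp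
  qed
  have der2: "((\<lambda>t. F (x + t *\<^sub>R h)) has_real_derivative F' (x + s *\<^sub>R h)) (at s)" for x s
    using der[of "x + s *\<^sub>R h"] DERIV_shift[of "\<lambda>t. F (x + t *\<^sub>R h)" _ 0 s] by (simp add: algebra_simps)
  have lip: "\<bar>F (x + t n *\<^sub>R h) - F x\<bar> \<le> L * t n" for x n
  proof -
    obtain z where "F (x + t n *\<^sub>R h) - F (x + 0 *\<^sub>R h) = (t n - 0) * F' (x + z *\<^sub>R h)"
      using MVT2[OF t(1)[of n], where f = "\<lambda>t. F (x + t *\<^sub>R h)" and f' = "\<lambda>s. F' (x + s *\<^sub>R h)"] der2 by blast
    then show ?thesis using t(1)[of n] L[of "x + z *\<^sub>R h"] by (simp add: abs_mult mult.commute mult_right_mono)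
  qed
  have lim0: "t \<longlonglongrightarrow> 0" unfolding t_def by (rule lim_1_Suc)
  have "(\<lambda>n. \<integral>x. (F (x + t n *\<^sub>R h) - F x) / t n \<partial>lborel) \<longlonglongrightarrow> (\<integral>x. F' x \<partial>lborel)"
  proof (rule integral_dominated_convergence)
    show "integrable lborel (\<lambda>x::'a. L * indicator (cball 0 (R + norm h)) x)"
      using emeasure_lborel_cball_finite[of "0::'a" "R + norm h"] by (intro integrable_mult_right) (simp add: integrable_indicator_iff)
    show "AE x in lborel. (\<lambda>n. (F (x + t n *\<^sub>R h) - F x) / t n) \<longlonglongrightarrow> F' x"
    proof (rule AE_I2)
      fix x
      have "(\<lambda>s. (F (x + s *\<^sub>R h) - F x) / s) \<midarrow>0\<rightarrow> F' x" using der[of x] by (simp add: DERIV_def)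
      from LIMSEQ_SEQ_conv[THEN iffD2, OF this] show "(\<lambda>n. (F (x + t n *\<^sub>R h) - F x) / t n) \<longlonglongrightarrow> F' x"
        using lim0 t(1) by (metis less_irrefl)
    qed
    fix n
    show "AE x in lborel. norm ((F (x + t n *\<^sub>R h) - F x) / t n) \<le> L * indicator (cball 0 (R + norm h)) x"
    proof (rule AE_I2)
      fix x
      show "norm ((F (x + t n *\<^sub>R h) - F x) / t n) \<le> L * indicator (cball 0 (R + norm h)) x"
      proof (cases "norm x \<le> R + norm h")
        case True
        then show ?thesis using lip[of x n] t(1)[of n] by (simp add: abs_divide divide_le_eq)
      next
        case False
        have th: "norm (t n *\<^sub>R h) \<le> norm h" using t[of n] by (simp add: mult_left_le_one_le)
        have "norm x \<le> norm (x + t n *\<^sub>R h) + norm (t n *\<^sub>R h)"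
          using norm_triangle_ineq4[of "x + t n *\<^sub>R h" "t n *\<^sub>R h"] by simp
        then have "F x = 0" "F (x + t n *\<^sub>R h) = 0"
          using R[of x] R[of "x + t n *\<^sub>R h"] False th norm_ge_zero[of h] by linarith+
        then show ?thesis using L0 by simp
      qed
    qed
  qed measurable
  moreover have "(\<integral>x. (F (x + t n *\<^sub>R h) - F x) / t n \<partial>lborel) = 0" for n
  proof -
    have "(\<integral>x. F (x + t n *\<^sub>R h) \<partial>lborel) = (\<integral>x. F x \<partial>lborel)"
      using integral_lborel_shift[of F "t n *\<^sub>R h"] by (simp add: add.commute)
    then show ?thesis using Fi Fs by simp
  qed
  ultimately show ?thesis by (simp only: LIMSEQ_const_iff)
qed

text \<open>The hypothesis says that g and g' have the same mollifications, and these converge to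
  both in local L^1.\<close>

lemma weak_deriv_unique:
  fixes g g' :: "'a::euclidean_space \<Rightarrow> real"
  assumes g: "loc_int g" "loc_int g'"
    and eq: "\<And>\<phi>. \<phi> \<in> test_functions \<Longrightarrow> (\<integral>x. g x * \<phi> x \<partial>lborel) = (\<integral>x. g' x * \<phi> x \<partial>lborel)"
  shows "AE x in lborel. g x = g' x"
proof -
  obtain \<eta> :: "nat \<Rightarrow> 'a \<Rightarrow> real" where \<eta>: "\<And>k. mollifier (\<eta> k) (1 / real (Suc k))" using mollifier_sequence by blast
  note [measurable] = g[THEN loc_int_borel] test_function_borel[OF mollifierD(1)[OF \<eta>]]
  have c: "conv g (\<eta> k) = conv g' (\<eta> k)" for k
    unfolding conv_def by (intro ext eq test_function_reflect mollifierD(1)[OF \<eta>])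
  have z: "bnorm R (\<lambda>x. g x - g' x) = 0" for R
  proof -
    have "bnorm R (\<lambda>x. g x - g' x) \<le> bnorm R (\<lambda>x. conv g (\<eta> k) x - g x) + bnorm R (\<lambda>x. conv g' (\<eta> k) x - g' x)" for k
      by (rule bnorm_triangle) (auto simp: c)
    moreover have "(\<lambda>k. bnorm R (\<lambda>x. conv g (\<eta> k) x - g x) + bnorm R (\<lambda>x. conv g' (\<eta> k) x - g' x)) \<longlonglongrightarrow> 0 + 0"
      by (intro tendsto_add conv_tendsto[OF _ \<eta> lim_1_Suc] g)
    ultimately have "bnorm R (\<lambda>x. g x - g' x) \<le> 0 + 0" by (intro LIMSEQ_le_const) auto
    then show ?thesis by simp
  qed
  have "AE x in lborel. \<forall>n. x \<in> cball 0 (real n) \<longrightarrow> g x = g' x"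
  proof (subst AE_all_countable, rule allI)
    fix n
    have "AE x in lborel. ennreal \<bar>g x - g' x\<bar> * indicator (cball 0 (real n)) x = 0"
      using z[of "real n"] unfolding bnorm_def by (subst (asm) nn_integral_0_iff_AE) auto
    then show "AE x in lborel. x \<in> cball 0 (real n) \<longrightarrow> g x = g' x" by eventually_elim (auto simp: indicator_def)
  qed
  then show ?thesis by eventually_elim (metis mem_cball_0 real_arch_simple)
qed

lemma has_weak_deriv_unique:
  assumes "has_weak_deriv u is g" "has_weak_deriv u is g'"
  shows "AE x in lborel. g x = g' x"
proof (rule weak_deriv_unique)
  show "loc_int g" "loc_int g'" using has_weak_deriv_loc_int assms by auto
  fix \<phi> :: "'a \<Rightarrow> real" assume \<phi>: "\<phi> \<in> test_functions"
  have "(-1 :: real) ^ length is * (\<integral>x. g x * \<phi> x \<partial>lborel) = (-1) ^ length is * (\<integral>x. g' x * \<phi> x \<partial>lborel)"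
    using assms \<phi> by (auto simp: has_weak_deriv_def)
  then show "(\<integral>x. g x * \<phi> x \<partial>lborel) = (\<integral>x. g' x * \<phi> x \<partial>lborel)" by simp
qed

text \<open>Second derivatives are defined by testing u against second partial derivatives.
  Integration by parts needs instead that the first derivative g is weakly differentiable with
  derivative G; this follows by using partial derivatives of test functions as test
  functions.\<close>

lemma has_weak_deriv_second:
  assumes "has_weak_deriv u [i] g" "has_weak_deriv u [i, i] G" "i \<in> Basis"
  shows "has_weak_deriv g [i] G"
  unfolding has_weak_deriv_def
proof (intro conjI ballI)
  show "g \<in> Lp_loc 1" "G \<in> Lp_loc 1" using assms by (auto simp: has_weak_deriv_def)
  fix \<phi> :: "'a \<Rightarrow> real" assume \<phi>: "\<phi> \<in> test_functions"
  have "(\<integral>x. u x * partials [i] (partials [i] \<phi>) x \<partial>lborel) = - (\<integral>x. g x * partials [i] \<phi> x \<partial>lborel)"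
    using assms(1) test_function_partials[OF \<phi> assms(3)] by (simp add: has_weak_deriv_def del: partials.simps)
  moreover have "(\<integral>x. u x * partials [i, i] \<phi> x \<partial>lborel) = (\<integral>x. G x * \<phi> x \<partial>lborel)"
    using assms(2) \<phi> by (simp add: has_weak_deriv_def del: partials.simps)
  moreover have "partials [i] (partials [i] \<phi>) = partials [i, i] \<phi>" by simp
  ultimately show "(\<integral>x. g x * partials [i] \<phi> x \<partial>lborel) = (- 1) ^ length [i] * (\<integral>x. G x * \<phi> x \<partial>lborel)"
    by (simp del: partials.simps)
qed

section \<open>Linearity of weak derivatives\<close>

lemma test_function_mult_integrable:
  assumes "loc_int f" "\<phi> \<in> test_functions"
  shows "integrable lborel (\<lambda>x. f x * \<phi> x)"
proof -
  obtain B R where "\<And>y. \<bar>\<phi> y\<bar> \<le> B" "\<And>y. \<phi> y \<noteq> 0 \<Longrightarrow> norm y \<le> R"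
    using test_function_bounded[OF assms(2)] test_function_support[OF assms(2)] by metis
  then show ?thesis by (intro loc_int_mult_integrable[OF assms(1) test_function_borel[OF assms(2)]])
qed

lemma has_weak_deriv_add:
  assumes "has_weak_deriv u [i] g" "has_weak_deriv v [i] h" "i \<in> Basis"
  shows "has_weak_deriv (\<lambda>x. u x + v x) [i] (\<lambda>x. g x + h x)"
proof -
  note l = has_weak_deriv_loc_int[OF assms(1)] has_weak_deriv_loc_int[OF assms(2)]
  note I = test_function_mult_integrable
  show ?thesis
    unfolding has_weak_deriv_def Lp_loc_1_iff
  proof (intro conjI ballI loc_int_add)
    fix \<phi> :: "'a \<Rightarrow> real" assume \<phi>: "\<phi> \<in> test_functions"
    have 1: "(\<integral>x. u x * partials [i] \<phi> x \<partial>lborel) = - (\<integral>x. g x * \<phi> x \<partial>lborel)"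
      "(\<integral>x. v x * partials [i] \<phi> x \<partial>lborel) = - (\<integral>x. h x * \<phi> x \<partial>lborel)"
      using assms(1,2) \<phi> by (auto simp: has_weak_deriv_def simp del: partials.simps)
    have 2: "(\<integral>x. (u x + v x) * partials [i] \<phi> x \<partial>lborel) = (\<integral>x. u x * partials [i] \<phi> x \<partial>lborel) + (\<integral>x. v x * partials [i] \<phi> x \<partial>lborel)"
      unfolding distrib_right by (rule Bochner_Integration.integral_add) (use l I test_function_partials[OF \<phi> assms(3)] in blast)+
    have 3: "(\<integral>x. (g x + h x) * \<phi> x \<partial>lborel) = (\<integral>x. g x * \<phi> x \<partial>lborel) + (\<integral>x. h x * \<phi> x \<partial>lborel)"
      unfolding distrib_right by (rule Bochner_Integration.integral_add) (use l I \<phi> in blast)+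
    show "(\<integral>x. (u x + v x) * partials [i] \<phi> x \<partial>lborel) = (- 1) ^ length [i] * (\<integral>x. (g x + h x) * \<phi> x \<partial>lborel)"
      unfolding 2 3 1 by simp
  qed (use l in auto)
qed

lemma loc_int_cmult: "loc_int f \<Longrightarrow> loc_int (\<lambda>x. c * f x)"
  unfolding loc_int_def
proof (intro conjI allI; elim conjE)
  fix R assume f: "f \<in> borel_measurable borel" "\<forall>R. bnorm R f < \<infinity>"
  note [measurable] = f(1)
  have "bnorm R (\<lambda>x. c * f x) = (\<integral>\<^sup>+x. ennreal \<bar>c\<bar> * (ennreal \<bar>f x\<bar> * indicator (cball 0 R) x) \<partial>lborel)"
    unfolding bnorm_def by (simp add: abs_mult ennreal_mult mult.assoc)
  also have "\<dots> = ennreal \<bar>c\<bar> * bnorm R f" unfolding bnorm_def by (rule nn_integral_cmult) measurable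
  finally show "bnorm R (\<lambda>x. c * f x) < \<infinity>" using f(2) by (simp add: ennreal_mult_less_top)
qed simp

lemma has_weak_deriv_cmult:
  assumes "has_weak_deriv u [i] g"
  shows "has_weak_deriv (\<lambda>x. c * u x) [i] (\<lambda>x. c * g x)"
  using assms unfolding has_weak_deriv_def Lp_loc_1_iff
  by (auto intro: loc_int_cmult simp: mult.assoc simp del: partials.simps)

section \<open>Product and chain rules for weak derivatives\<close>

lemma test_function_dir_deriv:
  assumes "\<phi> \<in> test_functions"
  shows "((\<lambda>t. \<phi> (x + t *\<^sub>R i)) has_real_derivative partials [i] \<phi> x) (at 0)"
proof -
  have "((\<lambda>t. x + t *\<^sub>R i) has_derivative (\<lambda>t. t *\<^sub>R i)) (at 0)" by (auto intro!: derivative_eq_intros)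
  moreover have "(\<phi> has_derivative frechet_derivative \<phi> (at x)) (at (x + 0 *\<^sub>R i))"
    using smooth_has_derivative[OF test_functionD(1)[OF assms]] by simp
  ultimately have "((\<lambda>t. \<phi> (x + t *\<^sub>R i)) has_derivative (\<lambda>t. frechet_derivative \<phi> (at x) (t *\<^sub>R i))) (at 0)"
    by (rule has_derivative_compose)
  then show ?thesis unfolding has_field_derivative_def
    by (rule has_derivative_eq_rhs)
       (simp add: linear_cmul[OF linear_frechet_derivative[OF smooth_differentiable[OF test_functionD(1)[OF assms]]]] fun_eq_iff mult.commute)
qed

text \<open>Allows the constant 1 as the factor a in \<open>weak_exp_product\<close>, which then
  becomes the chain rule for exp.\<close>

lemma has_weak_deriv_one:
  assumes "i \<in> Basis"
  shows "has_weak_deriv (\<lambda>x. 1) [i] (\<lambda>x. 0)"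
  unfolding has_weak_deriv_def Lp_loc_1_iff
proof (intro conjI ballI)
  show "loc_int (\<lambda>x::'a. 1)" "loc_int (\<lambda>x::'a. 0)" by (auto intro: loc_int_bounded[of _ 1])
  fix \<phi> :: "'a \<Rightarrow> real" assume \<phi>: "\<phi> \<in> test_functions"
  note p = test_function_partials[OF \<phi> assms]
  obtain L where L: "\<And>x. \<bar>partials [i] \<phi> x\<bar> \<le> L" using test_function_bounded[OF p] by metis
  obtain B where B: "\<And>x. \<bar>\<phi> x\<bar> \<le> B" using test_function_bounded[OF \<phi>] by metis
  obtain R where R: "\<And>x. \<phi> x \<noteq> 0 \<Longrightarrow> norm x \<le> R" using test_function_support[OF \<phi>] by metis
  have "(\<integral>x. partials [i] \<phi> x \<partial>lborel) = 0"
    by (rule integral_dir_deriv_zero[OF test_function_borel[OF \<phi>] test_function_borel[OF p] test_function_dir_deriv[OF \<phi>] L B R])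
  then show "(\<integral>x. 1 * partials [i] \<phi> x \<partial>lborel) = (- 1) ^ length [i] * (\<integral>x. 0 * \<phi> x \<partial>lborel)" by (simp del: partials.simps)
qed

text \<open>One factor converges in local L^1, the other is bounded and converges almost everywhere:
  the difference of the products is (gs - g) h + g (h - h'), where the first term is small by the
  bound and the second by domination.\<close>

lemma integral_mult_tendsto:
  fixes g :: "'a::euclidean_space \<Rightarrow> real"
  assumes g: "loc_int g" "\<And>k. loc_int (gs k)" "(\<lambda>k. bnorm R (\<lambda>x. gs k x - g x)) \<longlonglongrightarrow> 0"
    and [measurable]: "\<And>k. h k \<in> borel_measurable borel" "h' \<in> borel_measurable borel"
    and h: "\<And>k x. \<bar>h k x\<bar> \<le> C" "\<And>k x. h k x \<noteq> 0 \<Longrightarrow> norm x \<le> R"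
    and lim: "AE x in lborel. norm x \<le> R \<longrightarrow> (\<lambda>k. h k x) \<longlonglongrightarrow> h' x" and h': "\<And>x. h' x \<noteq> 0 \<Longrightarrow> norm x \<le> R"
  shows "(\<lambda>k. \<integral>x. gs k x * h k x \<partial>lborel) \<longlonglongrightarrow> (\<integral>x. g x * h' x \<partial>lborel)"
proof -
  note [measurable] = loc_int_borel[OF g(1)] loc_int_borel[OF g(2)]
  have i1: "integrable lborel (\<lambda>x. gs k x * h k x)" for k by (rule loc_int_mult_integrable[OF g(2) _ h]) measurable
  have i2: "integrable lborel (\<lambda>x. g x * h k x)" for k by (rule loc_int_mult_integrable[OF g(1) _ h]) measurable
  have "(\<lambda>k. ennreal C * bnorm R (\<lambda>x. gs k x - g x)) \<longlonglongrightarrow> ennreal C * 0"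
    by (intro tendsto_mult_ennreal tendsto_const g(3)) auto
  then have z: "(\<lambda>k. ennreal C * bnorm R (\<lambda>x. gs k x - g x)) \<longlonglongrightarrow> 0" by simp
  have "ennreal \<bar>\<integral>x. (gs k x - g x) * h k x \<partial>lborel\<bar> \<le> ennreal C * bnorm R (\<lambda>x. gs k x - g x)" for k
    by (rule integral_mult_bnorm[OF loc_int_diff[OF g(2,1)] _ h]) measurable
  then have "(\<lambda>k. ennreal \<bar>\<integral>x. (gs k x - g x) * h k x \<partial>lborel\<bar>) \<longlonglongrightarrow> 0"
    by (intro tendsto_sandwich[OF _ _ tendsto_const z]) auto
  then have "(\<lambda>k. \<bar>\<integral>x. (gs k x - g x) * h k x \<partial>lborel\<bar>) \<longlonglongrightarrow> 0"
    by (simp add: tendsto_ennreal_iff flip: ennreal_0)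
  then have A: "(\<lambda>k. \<integral>x. (gs k x - g x) * h k x \<partial>lborel) \<longlonglongrightarrow> 0" by (rule tendsto_rabs_zero_cancel)
  have B: "(\<lambda>k. \<integral>x. g x * h k x \<partial>lborel) \<longlonglongrightarrow> (\<integral>x. g x * h' x \<partial>lborel)"
  proof (rule integral_dominated_convergence)
    show "integrable lborel (\<lambda>x. C * \<bar>indicator (cball 0 R) x * g x\<bar>)"
      by (intro integrable_mult_right integrable_abs loc_int_indicator_integrable g)
    show "AE x in lborel. (\<lambda>k. g x * h k x) \<longlonglongrightarrow> g x * h' x"
      using lim
    proof eventually_elim
      case (elim x)
      show ?case
      proof (cases "norm x \<le> R")
        case True then show ?thesis using elim by (intro tendsto_mult_left) auto
      next
        case False
        then have "h k x = 0" "h' x = 0" for k using h(2) h' by blast+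
        then show ?thesis by simp
      qed
    qed
    show "AE x in lborel. norm (g x * h k x) \<le> C * \<bar>indicator (cball 0 R) x * g x\<bar>" for k
    proof (rule AE_I2)
      fix x
      show "norm (g x * h k x) \<le> C * \<bar>indicator (cball 0 R) x * g x\<bar>"
        using h(1)[of k x] h(2)[of k x] mult_right_mono[OF h(1)[of k x], of "\<bar>g x\<bar>"]
        by (cases "h k x = 0") (auto simp: abs_mult mult.commute indicator_def)
    qed
  qed measurable
  have "(\<integral>x. gs k x * h k x \<partial>lborel) = (\<integral>x. (gs k x - g x) * h k x \<partial>lborel) + (\<integral>x. g x * h k x \<partial>lborel)" for k
    using i1[of k] i2[of k] by (simp add: left_diff_distrib)
  with tendsto_add[OF A B] show ?thesis by simp
qed

lemma bnorm_AE_subseq: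
  fixes f :: "nat \<Rightarrow> 'a::euclidean_space \<Rightarrow> real"
  assumes "\<And>k. loc_int (f k)" "(\<lambda>k. bnorm R (f k)) \<longlonglongrightarrow> 0"
  shows "\<exists>r. strict_mono (r :: nat \<Rightarrow> nat) \<and> (AE x in lborel. norm x \<le> R \<longrightarrow> (\<lambda>k. f (r k) x) \<longlonglongrightarrow> 0)"
proof -
  have i: "integrable lborel (\<lambda>x. indicator (cball 0 R) x * f k x)" for k
    by (rule loc_int_indicator_integrable[OF assms(1)])
  have "ennreal (\<integral>x. norm (indicator (cball 0 R) x * f k x) \<partial>lborel) = bnorm R (f k)" for k
    unfolding bnorm_def
    by (subst nn_integral_eq_integral[OF integrable_norm[OF i], symmetric]) (auto intro!: nn_integral_cong simp: indicator_def)
  then have "(\<lambda>k. ennreal (\<integral>x. norm (indicator (cball 0 R) x * f k x) \<partial>lborel)) \<longlonglongrightarrow> ennreal 0"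
    using assms(2) by simp
  then have "(\<lambda>k. \<integral>x. norm (indicator (cball 0 R) x * f k x) \<partial>lborel) \<longlonglongrightarrow> 0"
    by (subst (asm) tendsto_ennreal_iff) auto
  from tendsto_L1_AE_subseq[OF i this] obtain r where r: "strict_mono (r :: nat \<Rightarrow> nat)"
    "AE x in lborel. (\<lambda>k. indicator (cball 0 R) x * f (r k) x) \<longlonglongrightarrow> 0" by blast
  have "AE x in lborel. norm x \<le> R \<longrightarrow> (\<lambda>k. f (r k) x) \<longlonglongrightarrow> 0"
    using r(2) by eventually_elim auto
  with r(1) show ?thesis by blast
qed

lemma conv_deriv_dir:
  assumes "has_weak_deriv u [i] g" "i \<in> Basis" "\<phi> \<in> test_functions"
  shows "((\<lambda>t. conv u \<phi> (x + t *\<^sub>R i)) has_real_derivative conv g \<phi> x) (at 0)"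
proof -
  have "(\<Sum>j\<in>Basis. (i \<bullet> j) * conv u (partials [j] \<phi>) x) = conv u (partials [i] \<phi>) x"
    using assms(2) by (subst sum.remove[of _ i]) (auto simp: inner_Basis simp del: partials.simps split: if_splits intro!: sum.neutral)
  then show ?thesis
    using conv_has_derivative[OF _ assms(3), of u x i] has_weak_deriv_loc_int[OF assms(1)] conv_weak_deriv[OF assms, of x]
    by (simp del: partials.simps)
qed

text \<open>The product and chain rule for \<tau>(a) \<Phi>(b), tested against \<zeta>. It holds for
  mollifications by \<open>integral_dir_deriv_zero\<close>. Along a common subsequence the mollified
  a and b converge almost everywhere and their derivatives in local L^1; boundedness of \<tau>,
  \<Phi> and their derivatives then puts every term in the situation of
  \<open>integral_mult_tendsto\<close>.\<close>

lemma weak_chain_product: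
  fixes a b \<zeta> :: "'a::euclidean_space \<Rightarrow> real"
  assumes a: "has_weak_deriv a [i] a'" and b: "has_weak_deriv b [i] b'" and i: "i \<in> Basis"
    and \<tau>: "\<And>s. (\<tau> has_real_derivative \<tau>' s) (at s)" "continuous_on UNIV \<tau>'" "\<And>s. \<bar>\<tau> s\<bar> \<le> A" "\<And>s. \<bar>\<tau>' s\<bar> \<le> A"
    and \<Phi>: "\<And>s. (\<Phi> has_real_derivative \<Phi>' s) (at s)" "continuous_on UNIV \<Phi>'" "\<And>s. \<bar>\<Phi> s\<bar> \<le> A" "\<And>s. \<bar>\<Phi>' s\<bar> \<le> A"
    and [measurable]: "\<zeta> \<in> borel_measurable borel" "\<zeta>' \<in> borel_measurable borel"
    and \<zeta>: "\<And>x. ((\<lambda>t. \<zeta> (x + t *\<^sub>R i)) has_real_derivative \<zeta>' x) (at 0)"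
      "\<And>x. \<bar>\<zeta> x\<bar> \<le> B" "\<And>x. \<bar>\<zeta>' x\<bar> \<le> B" "\<And>x. \<zeta> x \<noteq> 0 \<Longrightarrow> norm x \<le> R" "\<And>x. \<zeta>' x \<noteq> 0 \<Longrightarrow> norm x \<le> R"
  shows "(\<integral>x. \<tau> (a x) * \<Phi> (b x) * \<zeta>' x \<partial>lborel)
     = - ((\<integral>x. a' x * (\<tau>' (a x) * \<Phi> (b x) * \<zeta> x) \<partial>lborel) + (\<integral>x. b' x * (\<tau> (a x) * \<Phi>' (b x) * \<zeta> x) \<partial>lborel))"
proof -
  obtain \<eta> :: "nat \<Rightarrow> 'a \<Rightarrow> real" where \<eta>: "\<And>k. mollifier (\<eta> k) (1 / real (Suc k))" using mollifier_sequence by blast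
  note t = mollifierD(1)[OF \<eta>]
  have la: "loc_int a" "loc_int a'" using has_weak_deriv_loc_int[OF a] by auto
  have lb: "loc_int b" "loc_int b'" using has_weak_deriv_loc_int[OF b] by auto
  note l1 = loc_int_diff[OF conv_loc_int[OF la(1) \<eta>] la(1)]
  note l2 = loc_int_diff[OF conv_loc_int[OF lb(1) \<eta>] lb(1)]
  obtain r1 where r1: "strict_mono (r1 :: nat \<Rightarrow> nat)"
    "AE x in lborel. norm x \<le> R \<longrightarrow> (\<lambda>k. conv a (\<eta> (r1 k)) x - a x) \<longlonglongrightarrow> 0"
    using bnorm_AE_subseq[OF l1 conv_tendsto[OF la(1) \<eta> lim_1_Suc]] by blast
  have "(\<lambda>k. bnorm R (\<lambda>x. conv b (\<eta> (r1 k)) x - b x)) \<longlonglongrightarrow> 0"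
    using LIMSEQ_subseq_LIMSEQ[OF conv_tendsto[OF lb(1) \<eta> lim_1_Suc] r1(1)] by (simp add: o_def)
  from bnorm_AE_subseq[OF l2 this] obtain r2 where r2: "strict_mono (r2 :: nat \<Rightarrow> nat)"
    "AE x in lborel. norm x \<le> R \<longrightarrow> (\<lambda>k. conv b (\<eta> (r1 (r2 k))) x - b x) \<longlonglongrightarrow> 0"
    by blast
  define r where "r = r1 \<circ> r2"
  have r: "strict_mono r" unfolding r_def by (rule strict_mono_o[OF r1(1) r2(1)])
  define ak where "ak k = conv a (\<eta> (r k))" for k
  define bk where "bk k = conv b (\<eta> (r k))" for k
  define ak' where "ak' k = conv a' (\<eta> (r k))" for k
  define bk' where "bk' k = conv b' (\<eta> (r k))" for k
  have lim_a: "AE x in lborel. norm x \<le> R \<longrightarrow> (\<lambda>k. ak k x) \<longlonglongrightarrow> a x"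
    using r1(2)
  proof eventually_elim
    case (elim x)
    show ?case
    proof
      assume "norm x \<le> R"
      then have "(\<lambda>k. conv a (\<eta> (r1 k)) x) \<longlonglongrightarrow> a x" using elim by (simp add: LIM_zero_iff)
      from LIMSEQ_subseq_LIMSEQ[OF this r2(1)] show "(\<lambda>k. ak k x) \<longlonglongrightarrow> a x" by (simp add: ak_def r_def o_def)
    qed
  qed
  have lim_b: "AE x in lborel. norm x \<le> R \<longrightarrow> (\<lambda>k. bk k x) \<longlonglongrightarrow> b x"
    using r2(2) by eventually_elim (simp add: bk_def r_def LIM_zero_iff)
  have lim_a': "(\<lambda>k. bnorm R (\<lambda>x. ak' k x - a' x)) \<longlonglongrightarrow> 0"
    using LIMSEQ_subseq_LIMSEQ[OF conv_tendsto[OF la(2) \<eta> lim_1_Suc] r] by (simp add: ak'_def o_def)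
  have lim_b': "(\<lambda>k. bnorm R (\<lambda>x. bk' k x - b' x)) \<longlonglongrightarrow> 0"
    using LIMSEQ_subseq_LIMSEQ[OF conv_tendsto[OF lb(2) \<eta> lim_1_Suc] r] by (simp add: bk'_def o_def)
  have lk: "loc_int (ak k)" "loc_int (bk k)" "loc_int (ak' k)" "loc_int (bk' k)" for k
    unfolding ak_def bk_def ak'_def bk'_def by (intro conv_loc_int[OF _ \<eta>] la lb)+
  note [measurable] = lk[THEN loc_int_borel] la[THEN loc_int_borel] lb[THEN loc_int_borel]
  have c\<tau>: "isCont \<tau> s" and c\<Phi>: "isCont \<Phi> s" for s using \<tau>(1) \<Phi>(1) DERIV_isCont by blast+
  have c\<tau>': "isCont \<tau>' s" and c\<Phi>': "isCont \<Phi>' s" for s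
    using \<tau>(2) \<Phi>(2) by (auto simp: continuous_on_eq_continuous_at)
  have [measurable]: "\<tau> \<in> borel_measurable borel" "\<Phi> \<in> borel_measurable borel" "\<tau>' \<in> borel_measurable borel" "\<Phi>' \<in> borel_measurable borel"
    using c\<tau> c\<Phi> \<tau>(2) \<Phi>(2) by (auto intro!: borel_measurable_continuous_onI continuous_at_imp_continuous_on)
  have A0: "0 \<le> A" using \<tau>(3)[of 0] by linarith
  have B0: "0 \<le> B" using \<zeta>(2)[of 0] by linarith
  have bd: "\<bar>p * q * s\<bar> \<le> A * A * B" if "\<bar>p\<bar> \<le> A" "\<bar>q\<bar> \<le> A" "\<bar>s\<bar> \<le> B" for p q s :: real
    using that A0 B0 by (auto simp: abs_mult intro!: mult_mono)
  have T1: "(\<lambda>k. \<integral>x. ak' k x * (\<tau>' (ak k x) * \<Phi> (bk k x) * \<zeta> x) \<partial>lborel) \<longlonglongrightarrow> (\<integral>x. a' x * (\<tau>' (a x) * \<Phi> (b x) * \<zeta> x) \<partial>lborel)"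
  proof (rule integral_mult_tendsto[OF la(2) lk(3) lim_a'])
    show "AE x in lborel. norm x \<le> R \<longrightarrow> (\<lambda>k. \<tau>' (ak k x) * \<Phi> (bk k x) * \<zeta> x) \<longlonglongrightarrow> \<tau>' (a x) * \<Phi> (b x) * \<zeta> x"
      using lim_a lim_b by eventually_elim (auto intro!: tendsto_intros isCont_tendsto_compose[OF c\<tau>'] isCont_tendsto_compose[OF c\<Phi>])
    show "\<bar>\<tau>' (ak k x) * \<Phi> (bk k x) * \<zeta> x\<bar> \<le> A * A * B" for k x by (intro bd \<tau> \<Phi> \<zeta>)
  qed (use \<zeta>(4) in auto)
  have T2: "(\<lambda>k. \<integral>x. bk' k x * (\<tau> (ak k x) * \<Phi>' (bk k x) * \<zeta> x) \<partial>lborel) \<longlonglongrightarrow> (\<integral>x. b' x * (\<tau> (a x) * \<Phi>' (b x) * \<zeta> x) \<partial>lborel)"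
  proof (rule integral_mult_tendsto[OF lb(2) lk(4) lim_b'])
    show "AE x in lborel. norm x \<le> R \<longrightarrow> (\<lambda>k. \<tau> (ak k x) * \<Phi>' (bk k x) * \<zeta> x) \<longlonglongrightarrow> \<tau> (a x) * \<Phi>' (b x) * \<zeta> x"
      using lim_a lim_b by eventually_elim (auto intro!: tendsto_intros isCont_tendsto_compose[OF c\<tau>] isCont_tendsto_compose[OF c\<Phi>'])
    show "\<bar>\<tau> (ak k x) * \<Phi>' (bk k x) * \<zeta> x\<bar> \<le> A * A * B" for k x by (intro bd \<tau> \<Phi> \<zeta>)
  qed (use \<zeta>(4) in auto)
  have one: "loc_int (\<lambda>x::'a. 1)" by (rule loc_int_bounded[of _ 1]) auto
  have "(\<lambda>k. \<integral>x. 1 * (\<tau> (ak k x) * \<Phi> (bk k x) * \<zeta>' x) \<partial>lborel) \<longlonglongrightarrow> (\<integral>x. 1 * (\<tau> (a x) * \<Phi> (b x) * \<zeta>' x) \<partial>lborel)"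
  proof (rule integral_mult_tendsto[OF one one])
    show "AE x in lborel. norm x \<le> R \<longrightarrow> (\<lambda>k. \<tau> (ak k x) * \<Phi> (bk k x) * \<zeta>' x) \<longlonglongrightarrow> \<tau> (a x) * \<Phi> (b x) * \<zeta>' x"
      using lim_a lim_b by eventually_elim (auto intro!: tendsto_intros isCont_tendsto_compose[OF c\<tau>] isCont_tendsto_compose[OF c\<Phi>])
    show "\<bar>\<tau> (ak k x) * \<Phi> (bk k x) * \<zeta>' x\<bar> \<le> A * A * B" for k x by (intro bd \<tau> \<Phi> \<zeta>)
  qed (use \<zeta>(5) in \<open>auto simp: bnorm_def\<close>)
  then have T3: "(\<lambda>k. \<integral>x. \<tau> (ak k x) * \<Phi> (bk k x) * \<zeta>' x \<partial>lborel) \<longlonglongrightarrow> (\<integral>x. \<tau> (a x) * \<Phi> (b x) * \<zeta>' x \<partial>lborel)" by simp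
  have id: "(\<integral>x. ak' k x * (\<tau>' (ak k x) * \<Phi> (bk k x) * \<zeta> x) \<partial>lborel) + (\<integral>x. bk' k x * (\<tau> (ak k x) * \<Phi>' (bk k x) * \<zeta> x) \<partial>lborel)
      + (\<integral>x. \<tau> (ak k x) * \<Phi> (bk k x) * \<zeta>' x \<partial>lborel) = 0" for k
  proof -
    have i1: "integrable lborel (\<lambda>x. ak' k x * (\<tau>' (ak k x) * \<Phi> (bk k x) * \<zeta> x))"
      by (rule loc_int_mult_integrable[OF lk(3), where B = "A * A * B" and R = R]) (use \<zeta>(4) in \<open>auto intro!: bd \<tau> \<Phi> \<zeta>(2)\<close>)
    have i2: "integrable lborel (\<lambda>x. bk' k x * (\<tau> (ak k x) * \<Phi>' (bk k x) * \<zeta> x))"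
      by (rule loc_int_mult_integrable[OF lk(4), where B = "A * A * B" and R = R]) (use \<zeta>(4) in \<open>auto intro!: bd \<tau> \<Phi> \<zeta>(2)\<close>)
    have i3: "integrable lborel (\<lambda>x. \<tau> (ak k x) * \<Phi> (bk k x) * \<zeta>' x)"
      by (rule bounded_support_integrable[where B = "A * A * B" and R = R]) (use \<zeta>(5) in \<open>auto intro!: bd \<tau> \<Phi> \<zeta>(3)\<close>)
    have cont: "continuous_on UNIV (ak' k)" "continuous_on UNIV (bk' k)"
      unfolding ak'_def bk'_def by (rule conv_continuous[OF _ t], rule la lb)+
    \<comment> \<open>These bounds on the mollified derivatives depend on k. That is harmless, as
      they only serve the exact identity at fixed k.\<close>
    have "\<exists>C. \<forall>x. norm x \<le> R \<longrightarrow> \<bar>f x\<bar> \<le> C" if "continuous_on UNIV f" for f :: "'a \<Rightarrow> real"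
    proof -
      have "bounded (f ` cball 0 R)"
        using that by (intro compact_imp_bounded compact_continuous_image) (auto intro: continuous_on_subset)
      then show ?thesis unfolding bounded_iff by (metis image_eqI mem_cball_0 real_norm_def)
    qed
    then obtain C1 C2 where C: "\<And>x. norm x \<le> R \<Longrightarrow> \<bar>ak' k x\<bar> \<le> C1" "\<And>x. norm x \<le> R \<Longrightarrow> \<bar>bk' k x\<bar> \<le> C2"
      using cont by metis
    define F' where "F' x = ak' k x * (\<tau>' (ak k x) * \<Phi> (bk k x) * \<zeta> x) + bk' k x * (\<tau> (ak k x) * \<Phi>' (bk k x) * \<zeta> x)
        + \<tau> (ak k x) * \<Phi> (bk k x) * \<zeta>' x" for x
    have [measurable]: "F' \<in> borel_measurable borel" unfolding F'_def by measurable
    have "(\<integral>x. F' x \<partial>lborel) = 0"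
    proof (rule integral_dir_deriv_zero[where F = "\<lambda>x. \<tau> (ak k x) * \<Phi> (bk k x) * \<zeta> x" and h = i
          and L = "\<bar>C1\<bar> * (A * A * B) + \<bar>C2\<bar> * (A * A * B) + A * A * B" and B = "A * A * B" and R = R])
      fix x
      have 1: "((\<lambda>t. \<tau> (ak k (x + t *\<^sub>R i))) has_real_derivative \<tau>' (ak k x) * ak' k x) (at 0)"
        by (rule DERIV_chain2) (use \<tau>(1) conv_deriv_dir[OF a i t] in \<open>simp_all add: ak_def ak'_def\<close>)
      have 2: "((\<lambda>t. \<Phi> (bk k (x + t *\<^sub>R i))) has_real_derivative \<Phi>' (bk k x) * bk' k x) (at 0)"
        by (rule DERIV_chain2) (use \<Phi>(1) conv_deriv_dir[OF b i t] in \<open>simp_all add: bk_def bk'_def\<close>)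
      show "((\<lambda>t. \<tau> (ak k (x + t *\<^sub>R i)) * \<Phi> (bk k (x + t *\<^sub>R i)) * \<zeta> (x + t *\<^sub>R i)) has_real_derivative F' x) (at 0)"
        by (rule DERIV_cong[OF DERIV_mult[OF DERIV_mult[OF 1 2] \<zeta>(1)]]) (simp add: F'_def algebra_simps)
      show "\<bar>F' x\<bar> \<le> \<bar>C1\<bar> * (A * A * B) + \<bar>C2\<bar> * (A * A * B) + A * A * B"
      proof -
        have "\<bar>ak' k x * (\<tau>' (ak k x) * \<Phi> (bk k x) * \<zeta> x)\<bar> \<le> \<bar>C1\<bar> * (A * A * B)"
          using C(1)[of x] \<zeta>(4)[of x] bd[OF \<tau>(4) \<Phi>(3) \<zeta>(2), of "ak k x" "bk k x" x] A0 B0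
          by (cases "\<zeta> x = 0") (auto simp: abs_mult[of "ak' k x"] intro!: mult_mono)
        moreover have "\<bar>bk' k x * (\<tau> (ak k x) * \<Phi>' (bk k x) * \<zeta> x)\<bar> \<le> \<bar>C2\<bar> * (A * A * B)"
          using C(2)[of x] \<zeta>(4)[of x] bd[OF \<tau>(3) \<Phi>(4) \<zeta>(2), of "ak k x" "bk k x" x] A0 B0
          by (cases "\<zeta> x = 0") (auto simp: abs_mult[of "bk' k x"] intro!: mult_mono)
        moreover have "\<bar>\<tau> (ak k x) * \<Phi> (bk k x) * \<zeta>' x\<bar> \<le> A * A * B" by (intro bd \<tau> \<Phi> \<zeta>)
        ultimately show ?thesis unfolding F'_def by linarith
      qed
      show "\<bar>\<tau> (ak k x) * \<Phi> (bk k x) * \<zeta> x\<bar> \<le> A * A * B" by (intro bd \<tau> \<Phi> \<zeta>)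
    qed (use \<zeta>(4) in auto)
    moreover have "(\<integral>x. F' x \<partial>lborel) = (\<integral>x. ak' k x * (\<tau>' (ak k x) * \<Phi> (bk k x) * \<zeta> x) \<partial>lborel) + (\<integral>x. bk' k x * (\<tau> (ak k x) * \<Phi>' (bk k x) * \<zeta> x) \<partial>lborel)
      + (\<integral>x. \<tau> (ak k x) * \<Phi> (bk k x) * \<zeta>' x \<partial>lborel)"
      unfolding F'_def using i1 i2 i3 by simp
    ultimately show ?thesis by simp
  qed
  from tendsto_add[OF tendsto_add[OF T1 T2] T3]
  have "(\<integral>x. a' x * (\<tau>' (a x) * \<Phi> (b x) * \<zeta> x) \<partial>lborel) + (\<integral>x. b' x * (\<tau> (a x) * \<Phi>' (b x) * \<zeta> x) \<partial>lborel)
      + (\<integral>x. \<tau> (a x) * \<Phi> (b x) * \<zeta>' x \<partial>lborel) = 0"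
    unfolding id by (simp add: LIMSEQ_const_iff)
  then show ?thesis by linarith
qed

text \<open>
  A product \<open>a * exp b\<close> of weakly differentiable functions need not be locally integrable. It is
  approximated by \<open>trunc n a * trunc n (exp b)\<close>: both factors are bounded and have bounded derivatives
  with respect to \<open>a\<close> and \<open>b\<close>, so mollification passes to the limit in the product rule, and they are
  dominated by the untruncated factors, so \<open>n\<close> can then tend to infinity.
\<close>

definition trunc :: "nat \<Rightarrow> real \<Rightarrow> real" where
  "trunc n s = real (Suc n) * arctan (s / real (Suc n))"

definition trunc' :: "nat \<Rightarrow> real \<Rightarrow> real" where
  "trunc' n s = inverse (1 + (s / real (Suc n))\<^sup>2)"

lemma trunc_deriv: "(trunc n has_real_derivative trunc' n s) (at s)"
proof -
  have "((\<lambda>s. real (Suc n) * arctan (s / real (Suc n))) has_real_derivative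
      real (Suc n) * (inverse (1 + (s / real (Suc n))\<^sup>2) * (1 / real (Suc n)))) (at s)"
    by (intro DERIV_cmult DERIV_chain2[OF DERIV_arctan] DERIV_cdivide DERIV_ident)
  then show ?thesis by (simp add: trunc_def[abs_def] trunc'_def)
qed

lemma trunc'_bounds: "0 \<le> trunc' n s" "trunc' n s \<le> 1"
  by (auto simp: trunc'_def inverse_le_1_iff)

lemma trunc'_continuous: "continuous_on S (trunc' n)"
proof -
  have "1 + (s / real (Suc n))\<^sup>2 \<noteq> 0" for s by (smt (verit) zero_le_power2)
  then show ?thesis unfolding trunc'_def[abs_def] by (intro continuous_intros) auto
qed

lemma trunc_abs_le: "\<bar>trunc n s\<bar> \<le> \<bar>s\<bar>"
proof -
  have "norm (trunc n s - trunc n 0) \<le> 1 * norm (s - 0)"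
    by (rule field_differentiable_bound[of UNIV _ "trunc' n"])
       (use trunc_deriv trunc'_bounds[of n] in \<open>auto simp: has_field_derivative_at_within\<close>)
  then show ?thesis by (simp add: trunc_def)
qed

lemma trunc_bounded: "\<bar>trunc n s\<bar> \<le> 2 * real (Suc n)"
proof -
  have "\<bar>arctan (s / real (Suc n))\<bar> \<le> 2"
    using arctan_bounded[of "s / real (Suc n)"] pi_less_4 by (simp add: abs_le_iff)
  then have "real (Suc n) * \<bar>arctan (s / real (Suc n))\<bar> \<le> real (Suc n) * 2" by (intro mult_left_mono) auto
  then show ?thesis by (simp add: trunc_def abs_mult mult.commute)
qed

text \<open>With s replaced by exp s this bounds the derivative of s |-> trunc n (exp s), although
  the inner derivative exp s is unbounded.\<close>

lemma trunc_mult_bounded: "trunc' n s * s \<le> real (Suc n)"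
proof -
  define y where "y = s / real (Suc n)"
  have "y \<le> 1 + y\<^sup>2" using sum_squares_ge_zero[of "y - 1" y] zero_le_power2[of "y - 1"] zero_le_power2[of y] zero_le_power2[of "y + 1"]
    by (simp add: power2_eq_square algebra_simps)
  moreover have p: "0 < 1 + y\<^sup>2" by (smt (verit) zero_le_power2)
  ultimately have "inverse (1 + y\<^sup>2) * y \<le> 1" by (simp add: field_simps)
  then have "real (Suc n) * (inverse (1 + y\<^sup>2) * y) \<le> real (Suc n) * 1" by (intro mult_left_mono) auto
  moreover have "real (Suc n) * (inverse (1 + y\<^sup>2) * y) = trunc' n s * s" by (simp add: trunc'_def y_def)
  ultimately show ?thesis by (metis mult.right_neutral)
qed

lemma trunc'_tendsto: "(\<lambda>n. trunc' n s) \<longlonglongrightarrow> 1"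
proof -
  have "(\<lambda>n. s * (1 / real (Suc n))) \<longlonglongrightarrow> s * 0" by (intro tendsto_intros lim_1_Suc)
  then have "(\<lambda>n. s / real (Suc n)) \<longlonglongrightarrow> 0" by simp
  then have "(\<lambda>n. inverse (1 + (s / real (Suc n))\<^sup>2)) \<longlonglongrightarrow> inverse (1 + 0\<^sup>2)" by (intro tendsto_intros) auto
  then show ?thesis by (simp add: trunc'_def)
qed

lemma trunc_tendsto: "(\<lambda>n. trunc n s) \<longlonglongrightarrow> s"
proof (cases "s = 0")
  case False
  have "(\<lambda>n. s * (1 / real (Suc n))) \<longlonglongrightarrow> s * 0" by (intro tendsto_intros lim_1_Suc)
  then have z: "(\<lambda>n. s / real (Suc n)) \<longlonglongrightarrow> 0" by simp
  have l: "(\<lambda>h. arctan h / h) \<midarrow>0\<rightarrow> 1" using DERIV_arctan[of 0] by (simp add: DERIV_def)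
  have ne: "\<forall>n. s / real (Suc n) \<noteq> 0" using False by simp
  have "(\<lambda>n. arctan (s / real (Suc n)) / (s / real (Suc n))) \<longlonglongrightarrow> 1"
    by (rule LIMSEQ_SEQ_conv[THEN iffD2, OF l, THEN spec, THEN mp, OF conjI[OF ne z]])
  from tendsto_mult[OF tendsto_const[of s] this]
  have "(\<lambda>n. s * (arctan (s / real (Suc n)) / (s / real (Suc n)))) \<longlonglongrightarrow> s" by simp
  moreover have "s * (arctan (s / real (Suc n)) / (s / real (Suc n))) = trunc n s" for n
    using False by (simp add: trunc_def del: of_nat_Suc)
  ultimately show ?thesis by (simp only:)
qed (simp add: trunc_def)

lemma integral_tendsto_dominated:
  fixes f w :: "'b \<Rightarrow> real"
  assumes "integrable M w" "\<And>k. s k \<in> borel_measurable M" "f \<in> borel_measurable M"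
    "\<And>x. (\<lambda>k. s k x) \<longlonglongrightarrow> f x" "\<And>k x. \<bar>s k x\<bar> \<le> \<bar>w x\<bar>"
  shows "(\<lambda>k. \<integral>x. s k x \<partial>M) \<longlonglongrightarrow> (\<integral>x. f x \<partial>M)"
  by (rule integral_dominated_convergence[where w = "\<lambda>x. \<bar>w x\<bar>"]) (use assms in auto)

lemma weak_exp_product:
  fixes a b \<zeta> :: "'a::euclidean_space \<Rightarrow> real"
  assumes a: "has_weak_deriv a [i] a'" and b: "has_weak_deriv b [i] b'" and i: "i \<in> Basis"
    and [measurable]: "\<zeta> \<in> borel_measurable borel" "\<zeta>' \<in> borel_measurable borel"
    and \<zeta>: "\<And>x. ((\<lambda>t. \<zeta> (x + t *\<^sub>R i)) has_real_derivative \<zeta>' x) (at 0)"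
      "\<And>x. \<bar>\<zeta> x\<bar> \<le> B" "\<And>x. \<bar>\<zeta>' x\<bar> \<le> B" "\<And>x. \<zeta> x \<noteq> 0 \<Longrightarrow> norm x \<le> R" "\<And>x. \<zeta>' x \<noteq> 0 \<Longrightarrow> norm x \<le> R"
    and int: "integrable lborel (\<lambda>x. a x * exp (b x) * \<zeta>' x)" "integrable lborel (\<lambda>x. a' x * exp (b x) * \<zeta> x)"
      "integrable lborel (\<lambda>x. b' x * a x * exp (b x) * \<zeta> x)"
  shows "(\<integral>x. a x * exp (b x) * \<zeta>' x \<partial>lborel)
     = - ((\<integral>x. a' x * exp (b x) * \<zeta> x \<partial>lborel) + (\<integral>x. b' x * a x * exp (b x) * \<zeta> x \<partial>lborel))"
proof -
  have [measurable]: "a \<in> borel_measurable borel" "a' \<in> borel_measurable borel" "b \<in> borel_measurable borel" "b' \<in> borel_measurable borel"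
    using has_weak_deriv_loc_int[OF a] has_weak_deriv_loc_int[OF b] by (auto simp: loc_int_borel)
  have [measurable]: "trunc n \<in> borel_measurable borel" "trunc' n \<in> borel_measurable borel" for n
    by (rule borel_measurable_continuous_onI, rule continuous_at_imp_continuous_on, use DERIV_isCont[OF trunc_deriv] in blast)
      (rule borel_measurable_continuous_onI[OF trunc'_continuous])
  define \<Phi> where "\<Phi> n s = trunc n (exp s)" for n s
  define \<Phi>' where "\<Phi>' n s = trunc' n (exp s) * exp s" for n s
  have [measurable]: "\<Phi> n \<in> borel_measurable borel" "\<Phi>' n \<in> borel_measurable borel" for n
    unfolding \<Phi>_def[abs_def] \<Phi>'_def[abs_def] by measurable
  have \<Phi>b: "\<bar>\<Phi> n s\<bar> \<le> exp s" "\<bar>\<Phi>' n s\<bar> \<le> exp s" for n s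
    using trunc_abs_le[of n "exp s"] trunc'_bounds[of n "exp s"]
    by (auto simp: \<Phi>_def \<Phi>'_def abs_mult mult_left_le_one_le)
  have \<Phi>l: "(\<lambda>n. \<Phi> n s) \<longlonglongrightarrow> exp s" "(\<lambda>n. \<Phi>' n s) \<longlonglongrightarrow> exp s" for s
  proof -
    show "(\<lambda>n. \<Phi> n s) \<longlonglongrightarrow> exp s" unfolding \<Phi>_def by (rule trunc_tendsto)
    have "(\<lambda>n. trunc' n (exp s) * exp s) \<longlonglongrightarrow> 1 * exp s" by (intro tendsto_intros trunc'_tendsto)
    then show "(\<lambda>n. \<Phi>' n s) \<longlonglongrightarrow> exp s" by (simp add: \<Phi>'_def)
  qed
  have eq: "(\<integral>x. trunc n (a x) * \<Phi> n (b x) * \<zeta>' x \<partial>lborel)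
     = - ((\<integral>x. a' x * (trunc' n (a x) * \<Phi> n (b x) * \<zeta> x) \<partial>lborel) + (\<integral>x. b' x * (trunc n (a x) * \<Phi>' n (b x) * \<zeta> x) \<partial>lborel))" for n
  \<comment> \<open>One bound for all four functions: |arctan| < 2 covers the two truncations,
    \<open>trunc'\<close> is at most 1, and \<open>trunc_mult_bounded\<close> covers the derivative
    of the truncated exponential.\<close>
  proof (rule weak_chain_product[OF a b i, where A = "2 * real (Suc n)" and B = B and R = R])
    show "(trunc n has_real_derivative trunc' n s) (at s)" for s by (rule trunc_deriv)
    show "continuous_on UNIV (trunc' n)" by (rule trunc'_continuous)
    show "\<bar>trunc n s\<bar> \<le> 2 * real (Suc n)" for s by (rule trunc_bounded)
    show "\<bar>trunc' n s\<bar> \<le> 2 * real (Suc n)" for s using trunc'_bounds[of n s] by simp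
    show "(\<Phi> n has_real_derivative \<Phi>' n s) (at s)" for s
      unfolding \<Phi>_def[abs_def] \<Phi>'_def by (rule DERIV_chain2[OF trunc_deriv DERIV_exp])
    show "continuous_on UNIV (\<Phi>' n)"
      unfolding \<Phi>'_def[abs_def]
      by (intro continuous_intros continuous_on_compose2[OF trunc'_continuous[of UNIV]]) auto
    show "\<bar>\<Phi> n s\<bar> \<le> 2 * real (Suc n)" for s unfolding \<Phi>_def by (rule trunc_bounded)
    show "\<bar>\<Phi>' n s\<bar> \<le> 2 * real (Suc n)" for s
      using trunc_mult_bounded[of n "exp s"] trunc'_bounds[of n "exp s"] by (simp add: \<Phi>'_def)
  qed (use \<zeta> in auto)
  have L1: "(\<lambda>n. \<integral>x. trunc n (a x) * \<Phi> n (b x) * \<zeta>' x \<partial>lborel) \<longlonglongrightarrow> (\<integral>x. a x * exp (b x) * \<zeta>' x \<partial>lborel)"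
    by (rule integral_tendsto_dominated[OF int(1)])
       (auto intro!: tendsto_intros trunc_tendsto \<Phi>l mult_mono trunc_abs_le \<Phi>b simp: abs_mult)
  have L2: "(\<lambda>n. \<integral>x. a' x * (trunc' n (a x) * \<Phi> n (b x) * \<zeta> x) \<partial>lborel) \<longlonglongrightarrow> (\<integral>x. a' x * exp (b x) * \<zeta> x \<partial>lborel)"
  proof (rule integral_tendsto_dominated[OF int(2)])
    show "(\<lambda>n. a' x * (trunc' n (a x) * \<Phi> n (b x) * \<zeta> x)) \<longlonglongrightarrow> a' x * exp (b x) * \<zeta> x" for x
      using tendsto_mult[OF tendsto_const[of "a' x"] tendsto_mult[OF tendsto_mult[OF trunc'_tendsto[of "a x"] \<Phi>l(1)[of "b x"]] tendsto_const[of "\<zeta> x"]]]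
      by (simp add: mult.assoc)
    show "\<bar>a' x * (trunc' n (a x) * \<Phi> n (b x) * \<zeta> x)\<bar> \<le> \<bar>a' x * exp (b x) * \<zeta> x\<bar>" for n x
    proof -
      have "\<bar>trunc' n (a x) * \<Phi> n (b x)\<bar> \<le> 1 * exp (b x)"
        unfolding abs_mult using trunc'_bounds[of n "a x"] \<Phi>b(1)[of n "b x"] by (intro mult_mono) auto
      then have "\<bar>a' x\<bar> * (\<bar>trunc' n (a x) * \<Phi> n (b x)\<bar> * \<bar>\<zeta> x\<bar>) \<le> \<bar>a' x\<bar> * (exp (b x) * \<bar>\<zeta> x\<bar>)"
        by (intro mult_left_mono mult_right_mono) auto
      then show ?thesis by (simp add: abs_mult mult.assoc)
    qed
  qed measurable
  have L3: "(\<lambda>n. \<integral>x. b' x * (trunc n (a x) * \<Phi>' n (b x) * \<zeta> x) \<partial>lborel) \<longlonglongrightarrow> (\<integral>x. b' x * a x * exp (b x) * \<zeta> x \<partial>lborel)"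
  proof (rule integral_tendsto_dominated[OF int(3)])
    show "(\<lambda>n. b' x * (trunc n (a x) * \<Phi>' n (b x) * \<zeta> x)) \<longlonglongrightarrow> b' x * a x * exp (b x) * \<zeta> x" for x
      using tendsto_mult[OF tendsto_const[of "b' x"] tendsto_mult[OF tendsto_mult[OF trunc_tendsto[of "a x"] \<Phi>l(2)[of "b x"]] tendsto_const[of "\<zeta> x"]]]
      by (simp add: mult.assoc)
    show "\<bar>b' x * (trunc n (a x) * \<Phi>' n (b x) * \<zeta> x)\<bar> \<le> \<bar>b' x * a x * exp (b x) * \<zeta> x\<bar>" for n x
    proof -
      have "\<bar>trunc n (a x) * \<Phi>' n (b x)\<bar> \<le> \<bar>a x\<bar> * exp (b x)"
        unfolding abs_mult using trunc_abs_le[of n "a x"] \<Phi>b(2)[of n "b x"] by (intro mult_mono) auto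
      then have "\<bar>b' x\<bar> * (\<bar>trunc n (a x) * \<Phi>' n (b x)\<bar> * \<bar>\<zeta> x\<bar>) \<le> \<bar>b' x\<bar> * ((\<bar>a x\<bar> * exp (b x)) * \<bar>\<zeta> x\<bar>)"
        by (intro mult_left_mono mult_right_mono) auto
      then show ?thesis by (simp add: abs_mult mult.assoc)
    qed
  qed measurable
  show ?thesis
    by (rule LIMSEQ_unique[OF L1[unfolded eq] tendsto_minus[OF tendsto_add[OF L2 L3]]])
qed

text \<open>An upper bound on b makes exp b bounded, so exp b and b' exp b are locally integrable
  and the integrability conditions of \<open>weak_exp_product\<close> hold with a = 1.\<close>

lemma weak_deriv_exp:
  fixes b :: "'a::euclidean_space \<Rightarrow> real"
  assumes b: "has_weak_deriv b [i] b'" and i: "i \<in> Basis" and K: "\<And>x. b x \<le> K"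
  shows "has_weak_deriv (\<lambda>x. exp (b x)) [i] (\<lambda>x. b' x * exp (b x))"
proof -
  have lb: "loc_int b" "loc_int b'" using has_weak_deriv_loc_int[OF b] by auto
  note [measurable] = lb[THEN loc_int_borel]
  have e: "\<bar>exp (b x)\<bar> \<le> exp K" for x using K by simp
  have le: "loc_int (\<lambda>x. exp (b x))" by (rule loc_int_bounded[OF _ e]) measurable
  have lbe: "loc_int (\<lambda>x. b' x * exp (b x))"
  proof (rule loc_int_mono[OF loc_int_cmult[OF lb(2), of "exp K"]])
    show "AE x in lborel. \<bar>b' x * exp (b x)\<bar> \<le> \<bar>exp K * b' x\<bar>"
    proof (rule AE_I2)
      fix x
      show "\<bar>b' x * exp (b x)\<bar> \<le> \<bar>exp K * b' x\<bar>"
        using mult_left_mono[OF e[of x], of "\<bar>b' x\<bar>"] by (simp add: abs_mult mult.commute)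
    qed
  qed measurable
  show ?thesis
    unfolding has_weak_deriv_def Lp_loc_1_iff
  proof (intro conjI ballI le lbe)
    fix \<phi> :: "'a \<Rightarrow> real" assume \<phi>: "\<phi> \<in> test_functions"
    note p = test_function_partials[OF \<phi> i]
    obtain L where L: "\<And>x. \<bar>partials [i] \<phi> x\<bar> \<le> L" using test_function_bounded[OF p] by metis
    obtain B where B: "\<And>x. \<bar>\<phi> x\<bar> \<le> B" using test_function_bounded[OF \<phi>] by metis
    obtain R where R: "\<And>x. \<phi> x \<noteq> 0 \<Longrightarrow> norm x \<le> R" using test_function_support[OF \<phi>] by metis
    obtain R' where R': "\<And>x. partials [i] \<phi> x \<noteq> 0 \<Longrightarrow> norm x \<le> R'" using test_function_support[OF p] by metis
    have "(\<integral>x. 1 * exp (b x) * partials [i] \<phi> x \<partial>lborel)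
     = - ((\<integral>x. 0 * exp (b x) * \<phi> x \<partial>lborel) + (\<integral>x. b' x * 1 * exp (b x) * \<phi> x \<partial>lborel))"
    proof (rule weak_exp_product[OF has_weak_deriv_one[OF i] b i test_function_borel[OF \<phi>] test_function_borel[OF p],
          where B = "max B L" and R = "max R R'"])
      show "\<bar>\<phi> x\<bar> \<le> max B L" "\<bar>partials [i] \<phi> x\<bar> \<le> max B L" for x using B[of x] L[of x] by (auto simp del: partials.simps)
      show "norm x \<le> max R R'" if "\<phi> x \<noteq> 0" for x using R[OF that] by simp
      show "norm x \<le> max R R'" if "partials [i] \<phi> x \<noteq> 0" for x using R'[OF that] by simp
      show "integrable lborel (\<lambda>x. 1 * exp (b x) * partials [i] \<phi> x)"
        using test_function_mult_integrable[OF le p] by (simp del: partials.simps)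
      show "integrable lborel (\<lambda>x. b' x * 1 * exp (b x) * \<phi> x)"
        using test_function_mult_integrable[OF lbe \<phi>] by simp
    qed (auto intro: test_function_dir_deriv[OF \<phi>] simp del: partials.simps)
    then show "(\<integral>x. exp (b x) * partials [i] \<phi> x \<partial>lborel) = (- 1) ^ length [i] * (\<integral>x. b' x * exp (b x) * \<phi> x \<partial>lborel)"
      by (simp del: partials.simps)
  qed
qed

section \<open>Local compactness\<close>

lemma diagonal_convergent:
  fixes f :: "nat \<Rightarrow> 'b \<Rightarrow> real"
  assumes "countable S" and bd: "\<And>x. x \<in> S \<Longrightarrow> \<exists>M. \<forall>n. \<bar>f n x\<bar> \<le> M"
  shows "\<exists>r. strict_mono (r :: nat \<Rightarrow> nat) \<and> (\<forall>x\<in>S. convergent (\<lambda>k. f (r k) x))"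
proof (cases "S = {}")
  case True
  then show ?thesis using strict_mono_id by auto
next
  case False
  define P where "P n s \<longleftrightarrow> convergent (\<lambda>k. f (s k) (from_nat_into S n))" for n and s :: "nat \<Rightarrow> nat"
  interpret subseqs P
  proof
    fix n and s :: "nat \<Rightarrow> nat"
    obtain M where "\<forall>k. \<bar>f k (from_nat_into S n)\<bar> \<le> M" using bd from_nat_into[OF False] by blast
    then have "bounded (range (\<lambda>k. f (s k) (from_nat_into S n)))" by (auto simp: bounded_iff)
    from bounded_imp_convergent_subsequence[OF this]
    obtain l r where "strict_mono r" "((\<lambda>k. f (s k) (from_nat_into S n)) \<circ> r) \<longlonglongrightarrow> l" by blast
    then show "\<exists>r'. strict_mono r' \<and> P n (s \<circ> r')" by (auto simp: P_def convergent_def o_def)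
  qed
  have "convergent (\<lambda>k. f (diagseq k) x)" if x: "x \<in> S" for x
  proof -
    obtain n where n: "x = from_nat_into S n" using from_nat_into_surj[OF assms(1) x] by metis
    \<comment> \<open>The diagonal sequence is a subsequence of the n-th one only after its first n
      + 1 terms, which do not affect convergence.\<close>
    have "P n (diagseq \<circ> ((+) (Suc n)))"
    proof (rule diagseq_holds)
      fix r s :: "nat \<Rightarrow> nat" and n assume "strict_mono r" "P n s"
      then show "P n (s \<circ> r)" using convergent_subseq_convergent[of "\<lambda>k. f (s k) (from_nat_into S n)" r] by (simp add: P_def o_def)
    qed
    then have "convergent (\<lambda>k. f (diagseq (k + Suc n)) x)" by (simp add: P_def n o_def add.commute)
    then show ?thesis by (rule convergent_ignore_initial_segment[THEN iffD1])
  qed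
  then show ?thesis using subseq_diagseq by blast
qed

lemma convergent_dense:
  fixes f :: "nat \<Rightarrow> 'a::euclidean_space \<Rightarrow> real"
  assumes D: "\<And>X. open X \<Longrightarrow> X \<noteq> {} \<Longrightarrow> \<exists>d\<in>D. d \<in> X" and cd: "\<And>x. x \<in> D \<Longrightarrow> convergent (\<lambda>n. f n x)"
    and lip: "\<And>n y. norm (y - x) \<le> 1 \<Longrightarrow> \<bar>f n y - f n x\<bar> \<le> L * norm (y - x)"
  shows "convergent (\<lambda>n. f n x)"
  unfolding Cauchy_convergent_iff[symmetric]
proof (rule CauchyI)
  fix e :: real assume e: "0 < e"
  define d where "d = min 1 (e / (3 * (1 + \<bar>L\<bar>)))"
  have d: "0 < d" using e by (simp add: d_def)
  then obtain y where y: "y \<in> D" "y \<in> ball x d" using D[of "ball x d"] by auto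
  have nd: "norm (y - x) \<le> 1" "norm (y - x) < e / (3 * (1 + \<bar>L\<bar>))" using y(2) by (auto simp: d_def dist_norm norm_minus_commute)
  have close: "\<bar>f n y - f n x\<bar> < e / 3" for n
  proof -
    have "\<bar>f n y - f n x\<bar> \<le> L * norm (y - x)" by (rule lip[OF nd(1)])
    also have "\<dots> \<le> (1 + \<bar>L\<bar>) * norm (y - x)" by (intro mult_right_mono) auto
    also have "\<dots> < (1 + \<bar>L\<bar>) * (e / (3 * (1 + \<bar>L\<bar>)))" using nd(2) by (intro mult_strict_left_mono) auto
    also have "\<dots> = e / 3"
    proof -
      have "K * (e / (3 * K)) = e / 3" if "K \<noteq> 0" for K :: real using that by simp
      then show ?thesis by (metis abs_ge_zero add_nonneg_eq_0_iff zero_le_one zero_neq_one)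
    qed
    finally show ?thesis .
  qed
  have "Cauchy (\<lambda>n. f n y)" using cd[OF y(1)] by (rule convergent_Cauchy)
  then obtain N where N: "\<And>m n. N \<le> m \<Longrightarrow> N \<le> n \<Longrightarrow> norm (f m y - f n y) < e / 3"
    using CauchyD[of "\<lambda>n. f n y" "e / 3"] e by auto
  have "norm (f m x - f n x) < e" if "N \<le> m" "N \<le> n" for m n
    using N[OF that] close[of m] close[of n] unfolding real_norm_def by linarith
  then show "\<exists>N. \<forall>m\<ge>N. \<forall>n\<ge>N. norm (f m x - f n x) < e" by blast
qed

lemma bnorm_tendsto_dominated:
  fixes f :: "nat \<Rightarrow> 'a::euclidean_space \<Rightarrow> real"
  assumes [measurable]: "\<And>n. f n \<in> borel_measurable borel" "U \<in> borel_measurable borel"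
    and lim: "\<And>x. (\<lambda>n. f n x) \<longlonglongrightarrow> U x" and bd: "\<And>n x. norm x \<le> R \<Longrightarrow> \<bar>f n x\<bar> \<le> C"
  shows "(\<lambda>n. bnorm R (\<lambda>x. f n x - U x)) \<longlonglongrightarrow> 0"
proof -
  have Ub: "\<bar>U x\<bar> \<le> C" if "norm x \<le> R" for x
    by (rule LIMSEQ_le_const2[OF tendsto_rabs[OF lim]]) (use bd[OF that] in auto)
  have "(\<lambda>n. \<integral>\<^sup>+x. ennreal \<bar>f n x - U x\<bar> * indicator (cball 0 R) x \<partial>lborel) \<longlonglongrightarrow> (\<integral>\<^sup>+x. 0 \<partial>(lborel :: 'a measure))"
  proof (rule nn_integral_dominated_convergence[where w = "\<lambda>x. ennreal (2 * C) * indicator (cball 0 R) x"])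
    have "(\<integral>\<^sup>+x. ennreal (2 * C) * indicator (cball 0 R) (x::'a) \<partial>lborel) = ennreal (2 * C) * emeasure lborel (cball 0 R :: 'a set)"
      by (subst nn_integral_cmult_indicator) auto
    then show "(\<integral>\<^sup>+x. ennreal (2 * C) * indicator (cball 0 R) (x::'a) \<partial>lborel) < \<infinity>"
      using emeasure_lborel_cball_finite[of "0::'a" R] by (simp add: ennreal_mult_less_top)
    show "AE x in lborel. ennreal \<bar>f n x - U x\<bar> * indicator (cball 0 R) x \<le> ennreal (2 * C) * indicator (cball 0 R) x" for n
    proof (rule AE_I2)
      fix x :: 'a
      show "ennreal \<bar>f n x - U x\<bar> * indicator (cball 0 R) x \<le> ennreal (2 * C) * indicator (cball 0 R) x"
        using bd[of x n] Ub[of x] by (cases "norm x \<le> R") (auto intro!: ennreal_leI)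
    qed
    show "AE x in lborel. (\<lambda>n. ennreal \<bar>f n x - U x\<bar> * indicator (cball 0 R) x) \<longlonglongrightarrow> 0"
    proof (rule AE_I2)
      fix x :: 'a
      have "(\<lambda>n. \<bar>f n x - U x\<bar>) \<longlonglongrightarrow> 0" using lim[of x] by (intro tendsto_rabs_zero) (simp add: LIM_zero_iff)
      then have "(\<lambda>n. ennreal \<bar>f n x - U x\<bar>) \<longlonglongrightarrow> ennreal 0" by (rule tendsto_ennrealI)
      then show "(\<lambda>n. ennreal \<bar>f n x - U x\<bar> * indicator (cball 0 R) x) \<longlonglongrightarrow> 0"
        by (cases "norm x \<le> R") auto
    qed
  qed measurable
  then show ?thesis by (simp add: bnorm_def)
qed

text \<open>The Riesz-Fischer argument with growing balls: the j-th increment is measured on the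
  ball of radius j and is at most 2^(-j) there. Every point belongs to all balls from some index on,
  so a single subsequence works on the whole space without a further diagonal argument.\<close>

lemma bnorm_Cauchy_AE_convergent:
  fixes u :: "nat \<Rightarrow> 'a::euclidean_space \<Rightarrow> real"
  assumes [measurable]: "\<And>n. u n \<in> borel_measurable borel"
    and C: "\<And>R e. 0 < e \<Longrightarrow> \<exists>N. \<forall>m\<ge>N. \<forall>n\<ge>N. bnorm R (\<lambda>x. u m x - u n x) \<le> ennreal e"
  shows "\<exists>s. strict_mono (s :: nat \<Rightarrow> nat) \<and> (AE x in lborel. convergent (\<lambda>k. u (s k) x))"
proof -
  have "\<forall>j. \<exists>N. \<forall>m\<ge>N. \<forall>n\<ge>N. bnorm (real j) (\<lambda>x. u m x - u n x) \<le> ennreal ((1 / 2) ^ j)"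
    by (intro allI C) simp
  from choice[OF this] obtain N where
    "\<forall>j. \<forall>m\<ge>N j. \<forall>n\<ge>N j. bnorm (real j) (\<lambda>x. u m x - u n x) \<le> ennreal ((1 / 2) ^ j)" ..
  then have N: "\<And>j m n. N j \<le> m \<Longrightarrow> N j \<le> n \<Longrightarrow> bnorm (real j) (\<lambda>x. u m x - u n x) \<le> ennreal ((1 / 2) ^ j)"
    by simp
  \<comment> \<open>The sum ensures s j >= N j, and the summand j makes s strictly
    increasing.\<close>
  define s where "s j = (\<Sum>i\<le>j. N i) + j" for j :: nat
  have s: "strict_mono s" by (rule strict_mono_Suc_iff[THEN iffD2]) (simp add: s_def)
  have sN: "N j \<le> s j" for j unfolding s_def by (intro trans_le_add1 member_le_sum) auto
  define d where "d j x = u (s (Suc j)) x - u (s j) x" for j x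
  have [measurable]: "d j \<in> borel_measurable borel" for j unfolding d_def by measurable
  have dn: "bnorm (real j) (d j) \<le> ennreal ((1 / 2) ^ j)" for j
    unfolding d_def using sN[of j] strict_mono_less[OF s, of j "Suc j"] by (intro N) auto
  have "(\<integral>\<^sup>+x. (\<Sum>j. ennreal \<bar>d j x\<bar> * indicator (cball 0 (real j)) x) \<partial>lborel) = (\<Sum>j. bnorm (real j) (d j))"
    unfolding bnorm_def by (rule nn_integral_suminf) measurable
  also have "\<dots> \<le> (\<Sum>j. ennreal ((1 / 2) ^ j))" by (intro suminf_le dn) auto
  also have "\<dots> = ennreal (\<Sum>j. (1 / 2) ^ j)" by (intro suminf_ennreal2) (auto intro: summable_geometric)
  also have "\<dots> < \<infinity>" by simp
  finally have "(\<integral>\<^sup>+x. (\<Sum>j. ennreal \<bar>d j x\<bar> * indicator (cball 0 (real j)) x) \<partial>lborel) \<noteq> \<infinity>" by simp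
  then have "AE x in lborel. (\<Sum>j. ennreal \<bar>d j x\<bar> * indicator (cball 0 (real j)) x) \<noteq> \<infinity>"
    by (rule nn_integral_PInf_AE[rotated]) measurable
  then have "AE x in lborel. convergent (\<lambda>k. u (s k) x)"
  proof eventually_elim
    case (elim x)
    have "(\<lambda>j. ennreal \<bar>d j x\<bar> * indicator (cball 0 (real j)) x) = (\<lambda>j. ennreal (\<bar>d j x\<bar> * indicator (cball 0 (real j)) x))"
      by (auto simp: indicator_def fun_eq_iff)
    with elim have "summable (\<lambda>j. \<bar>d j x\<bar> * indicator (cball 0 (real j)) x)"
      by (intro summable_suminf_not_top) auto
    moreover have "eventually (\<lambda>j. norm (d j x) \<le> \<bar>d j x\<bar> * indicator (cball 0 (real j)) x) sequentially"
      using eventually_ge_at_top[of "nat \<lceil>norm x\<rceil>"] by eventually_elim (auto simp: indicator_def)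
    ultimately have "summable (\<lambda>j. d j x)" by (rule summable_comparison_test_ev[rotated])
    then have "convergent (\<lambda>k. \<Sum>j<k. d j x)" by (simp add: summable_iff_convergent)
    then have "convergent (\<lambda>k. u (s k) x - u (s 0) x)"
      unfolding d_def sum_lessThan_telescope[of "\<lambda>j. u (s j) x"] .
    from convergent_add[OF this convergent_const[of "u (s 0) x"]] show ?case by simp
  qed
  with s show ?thesis by blast
qed

text \<open>A Rellich theorem with domination in local L^1 only. H controls values and Lipschitz
  constants of the mollifications at a fixed scale, so that convergence on a countable dense set
  extends to all points; G controls the distance to the mollifications. The conclusion is almost
  everywhere convergence because the limit will be taken inside an exponential.\<close>

theorem sobolev_compact:
  fixes u :: "nat \<Rightarrow> 'a::euclidean_space \<Rightarrow> real"
  assumes wd: "\<And>n i. i \<in> Basis \<Longrightarrow> has_weak_deriv (u n) [i] (g n i)"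
    and G: "loc_int G" "\<And>n i. i \<in> Basis \<Longrightarrow> AE x in lborel. \<bar>g n i x\<bar> \<le> \<bar>G x\<bar>"
    and H: "loc_int H" "\<And>n. AE x in lborel. \<bar>u n x\<bar> \<le> \<bar>H x\<bar>"
  shows "\<exists>r. strict_mono (r :: nat \<Rightarrow> nat) \<and> (AE x in lborel. convergent (\<lambda>k. u (r k) x))"
proof -
  have ul: "loc_int (u n)" for n using has_weak_deriv_loc_int[OF wd] nonempty_Basis by blast
  obtain \<eta> :: "nat \<Rightarrow> 'a \<Rightarrow> real" where \<eta>: "\<And>k. mollifier (\<eta> k) (1 / real (Suc k))" using mollifier_sequence by blast
  note t = mollifierD(1)[OF \<eta>]
  note [measurable] = loc_int_borel[OF ul] test_function_borel[OF t]
  have supp: "norm x \<le> 1" if "\<eta> m x \<noteq> 0" for m x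
    using mollifierD(4)[OF \<eta> that] by (rule order_trans) simp
  obtain D :: "'a set" where D: "countable D" "\<And>X. open X \<Longrightarrow> X \<noteq> {} \<Longrightarrow> \<exists>d\<in>D. d \<in> X"
    using countable_dense_exists[where 'a='a] by metis
  have bH: "bnorm R (u n) \<le> ennreal (enn2real (bnorm R H))" for R n
    using bnorm_mono_AE[OF H(2)[of n], of R] loc_int_bnorm[OF H(1), of R] by (simp add: less_top)
  have cb: "\<exists>M. \<forall>n x. norm x \<le> R \<longrightarrow> \<bar>conv (u n) (\<eta> m) x\<bar> \<le> M" for R m
  proof -
    obtain B where B: "0 < B" "\<And>x. \<bar>\<eta> m x\<bar> \<le> B" using test_function_bounded[OF t] by metis
    have "\<bar>conv (u n) (\<eta> m) x\<bar> \<le> B * enn2real (bnorm (1 + R) H)" if "norm x \<le> R" for n x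
    proof -
      have "ennreal \<bar>conv (u n) (\<eta> m) x\<bar> \<le> ennreal B * bnorm (1 + R) (u n)"
        by (rule conv_bound[OF ul t B(2) supp that])
      also have "\<dots> \<le> ennreal B * ennreal (enn2real (bnorm (1 + R) H))" by (rule mult_left_mono[OF bH]) simp
      also have "\<dots> = ennreal (B * enn2real (bnorm (1 + R) H))" using B(1) by (simp add: ennreal_mult)
      finally show ?thesis using B(1) by (subst (asm) ennreal_le_iff) auto
    qed
    then show ?thesis by blast
  qed
  have "\<exists>r. strict_mono (r :: nat \<Rightarrow> nat) \<and> (\<forall>p\<in>D \<times> UNIV. convergent (\<lambda>k. conv (u (r k)) (\<eta> (snd p)) (fst p)))"
  proof (rule diagonal_convergent[where f = "\<lambda>n p. conv (u n) (\<eta> (snd p)) (fst p)"])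
    show "countable (D \<times> (UNIV :: nat set))" using D(1) by simp
    show "\<exists>M. \<forall>n. \<bar>conv (u n) (\<eta> (snd p)) (fst p)\<bar> \<le> M" for p using cb[of "norm (fst p)" "snd p"] by blast
  qed
  then obtain r where r: "strict_mono r" and rc: "\<And>x m. x \<in> D \<Longrightarrow> convergent (\<lambda>k. conv (u (r k)) (\<eta> m) x)"
    by auto
  have all: "convergent (\<lambda>k. conv (u (r k)) (\<eta> m) x)" for m x
  proof -
    obtain L where L: "0 < L" "\<And>x y. \<bar>\<eta> m x - \<eta> m y\<bar> \<le> L * norm (x - y)" using test_function_lipschitz[OF t] by metis
    define b where "b = enn2real (bnorm (1 + (norm x + 1)) H)"
    have b0: "0 \<le> b" by (simp add: b_def)
    show ?thesis
    proof (rule convergent_dense[OF D(2) rc, where L = "L * b"])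
      fix n y assume y: "norm (y - x) \<le> 1"
      have ny: "norm y \<le> norm x + 1" using y norm_triangle_sub[of y x] by simp
      have "ennreal \<bar>conv (u (r n)) (\<eta> m) y - conv (u (r n)) (\<eta> m) x\<bar> \<le> ennreal (L * norm (y - x)) * bnorm (1 + (norm x + 1)) (u (r n))"
        by (rule conv_lipschitz[OF ul t L(2) supp ny]) simp_all
      also have "\<dots> \<le> ennreal (L * norm (y - x)) * ennreal b" unfolding b_def by (rule mult_left_mono[OF bH]) simp
      also have "\<dots> = ennreal (L * norm (y - x) * b)" using L(1) b0 by (simp add: ennreal_mult)
      finally show "\<bar>conv (u (r n)) (\<eta> m) y - conv (u (r n)) (\<eta> m) x\<bar> \<le> L * b * norm (y - x)"
        using L(1) b0 by (subst (asm) ennreal_le_iff) (auto simp: mult_ac)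
    qed
  qed
  define U where "U m x = lim (\<lambda>k. conv (u (r k)) (\<eta> m) x)" for m x
  have U: "(\<lambda>k. conv (u (r k)) (\<eta> m) x) \<longlonglongrightarrow> U m x" for m x
    using all[of m x] by (simp add: U_def convergent_LIMSEQ_iff)
  have [measurable]: "U m \<in> borel_measurable borel" for m
    by (rule borel_measurable_LIMSEQ_real[OF U]) measurable
  have UL: "(\<lambda>k. bnorm R (\<lambda>x. conv (u (r k)) (\<eta> m) x - U m x)) \<longlonglongrightarrow> 0" for R m
  proof -
    obtain M where "\<forall>n x. norm x \<le> R \<longrightarrow> \<bar>conv (u n) (\<eta> m) x\<bar> \<le> M" using cb by blast
    then show ?thesis by (intro bnorm_tendsto_dominated[OF _ _ U, where C = M]) auto
  qed
  have "\<exists>s. strict_mono (s :: nat \<Rightarrow> nat) \<and> (AE x in lborel. convergent (\<lambda>k. u (r (s k)) x))"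
  proof (rule bnorm_Cauchy_AE_convergent)
    fix R and e :: real assume e: "0 < e"
    \<comment> \<open>The scale 1/(m+1) is chosen so that the rate 1/(m+1) times c is at most e/4.
      Two members of the sequence are compared through the limit U m of their mollifications, at a
      cost of e/4 for each of the four steps.\<close>
    define c where "c = real DIM('a) * enn2real (bnorm (R + 2) G)"
    have c0: "0 \<le> c" by (simp add: c_def)
    obtain m :: nat where "c * (4 / e) < real m" using reals_Archimedean2 by blast
    then have m: "c * (4 / e) < real (Suc m)" by simp
    have mc: "1 / real (Suc m) * c \<le> e / 4"
      using m e by (simp add: field_simps)
    have near: "bnorm R (\<lambda>x. conv (u n) (\<eta> m) x - u n x) \<le> ennreal (e / 4)" for n
    proof -
      have "bnorm R (\<lambda>x. conv (u n) (\<eta> m) x - u n x) \<le> ennreal (1 / real (Suc m)) * (\<Sum>i\<in>Basis. bnorm (R + 1 / real (Suc m) + 1) (g n i))"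
        by (rule bnorm_conv_diff[OF wd \<eta>])
      also have "\<dots> \<le> ennreal (1 / real (Suc m)) * (\<Sum>i\<in>(Basis::'a set). ennreal (enn2real (bnorm (R + 2) G)))"
      proof (intro mult_left_mono sum_mono)
        fix i :: 'a assume i: "i \<in> Basis"
        have "bnorm (R + 1 / real (Suc m) + 1) (g n i) \<le> bnorm (R + 2) (g n i)" by (rule bnorm_mono_radius) simp
        also have "\<dots> \<le> bnorm (R + 2) G" by (rule bnorm_mono_AE[OF G(2)[OF i]])
        finally show "bnorm (R + 1 / real (Suc m) + 1) (g n i) \<le> ennreal (enn2real (bnorm (R + 2) G))"
          using loc_int_bnorm[OF G(1), of "R + 2"] by (simp add: less_top)
      qed simp
      also have "\<dots> = ennreal (1 / real (Suc m) * c)"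
        by (simp only: c_def sum_ennreal[OF enn2real_nonneg] sum_constant ennreal_mult[symmetric] enn2real_nonneg
            mult_nonneg_nonneg of_nat_0_le_iff divide_nonneg_nonneg zero_le_one)
      also have "\<dots> \<le> ennreal (e / 4)" by (rule ennreal_leI[OF mc])
      finally show ?thesis .
    qed
    have "eventually (\<lambda>k. bnorm R (\<lambda>x. conv (u (r k)) (\<eta> m) x - U m x) < ennreal (e / 4)) sequentially"
      using e by (intro order_tendstoD(2)[OF UL]) simp
    then obtain N where N: "\<And>k. N \<le> k \<Longrightarrow> bnorm R (\<lambda>x. conv (u (r k)) (\<eta> m) x - U m x) \<le> ennreal (e / 4)"
      unfolding eventually_sequentially by (meson less_imp_le)
    have near2: "bnorm R (\<lambda>x. u (r k) x - U m x) \<le> ennreal (e / 4) + ennreal (e / 4)" if "N \<le> k" for k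
      by (rule order_trans[OF bnorm_triangle[of "\<lambda>x. conv (u (r k)) (\<eta> m) x - u (r k) x" "\<lambda>x. conv (u (r k)) (\<eta> m) x - U m x"] add_mono[OF near N[OF that]]]) auto
    have "bnorm R (\<lambda>x. u (r k) x - u (r l) x) \<le> ennreal e" if "N \<le> k" "N \<le> l" for k l
    proof -
      have "bnorm R (\<lambda>x. u (r k) x - u (r l) x) \<le> (ennreal (e / 4) + ennreal (e / 4)) + (ennreal (e / 4) + ennreal (e / 4))"
        by (rule order_trans[OF bnorm_triangle[of "\<lambda>x. u (r k) x - U m x" "\<lambda>x. u (r l) x - U m x"] add_mono[OF near2[OF that(1)] near2[OF that(2)]]]) auto
      also have "\<dots> = ennreal e" using e by (simp flip: ennreal_plus)
      finally show ?thesis .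
    qed
    then show "\<exists>N. \<forall>m\<ge>N. \<forall>n\<ge>N. bnorm R (\<lambda>x. u (r m) x - u (r n) x) \<le> ennreal e" by blast
  qed measurable
  then obtain s where "strict_mono s" "AE x in lborel. convergent (\<lambda>k. u (r (s k)) x)" by blast
  then show ?thesis using strict_mono_o[OF r] by (intro exI[of _ "r \<circ> s"]) auto
qed

section \<open>Integrability and integration by parts\<close>

lemma LpD: "f \<in> Lp M p \<Longrightarrow> f \<in> borel_measurable M"
  by (simp add: Lp_def)

lemma Lp_infinity: "f \<in> Lp M \<top> \<longleftrightarrow> f \<in> borel_measurable M \<and> (\<exists>C. AE x in M. \<bar>f x\<bar> \<le> C)"
  by (simp add: Lp_def)

lemma Lp_finite: "p \<noteq> \<infinity> \<Longrightarrow> f \<in> Lp M p \<longleftrightarrow> f \<in> borel_measurable M \<and> (\<integral>\<^sup>+x. ennreal (\<bar>f x\<bar> powr enn2real p) \<partial>M) < \<infinity>"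
  by (simp add: Lp_def)

lemma Lp_mono:
  assumes g: "g \<in> Lp M p" and [measurable]: "f \<in> borel_measurable M" and le: "AE x in M. \<bar>f x\<bar> \<le> c * \<bar>g x\<bar>" and c: "0 \<le> c"
  shows "f \<in> Lp M p"
proof (cases "p = \<infinity>")
  case True
  obtain C where C: "AE x in M. \<bar>g x\<bar> \<le> C" using g by (auto simp: True Lp_infinity)
  have "AE x in M. \<bar>f x\<bar> \<le> c * C"
    using le C by eventually_elim (use c in \<open>meson mult_left_mono order_trans\<close>)
  then show ?thesis using True assms(2) by (auto simp: Lp_infinity)
next
  case False
  define r where "r = enn2real p"
  have r: "0 \<le> r" by (simp add: r_def)
  have g': "g \<in> borel_measurable M" "(\<integral>\<^sup>+x. ennreal (\<bar>g x\<bar> powr r) \<partial>M) < \<infinity>"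
    using g by (auto simp: Lp_finite[OF False] r_def)
  note [measurable] = g'(1)
  have "(\<integral>\<^sup>+x. ennreal (\<bar>f x\<bar> powr r) \<partial>M) \<le> (\<integral>\<^sup>+x. ennreal (c powr r) * ennreal (\<bar>g x\<bar> powr r) \<partial>M)"
  proof (rule nn_integral_mono_AE)
    show "AE x in M. ennreal (\<bar>f x\<bar> powr r) \<le> ennreal (c powr r) * ennreal (\<bar>g x\<bar> powr r)"
      using le
    proof eventually_elim
      case (elim x)
      have "\<bar>f x\<bar> powr r \<le> (c * \<bar>g x\<bar>) powr r" by (rule powr_mono2[OF r _ elim]) simp
      also have "\<dots> = c powr r * \<bar>g x\<bar> powr r" using c by (simp add: powr_mult)
      finally show ?case by (simp add: ennreal_leI flip: ennreal_mult)
    qed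
  qed
  also have "\<dots> = ennreal (c powr r) * (\<integral>\<^sup>+x. ennreal (\<bar>g x\<bar> powr r) \<partial>M)" by (rule nn_integral_cmult) measurable
  also have "\<dots> < \<infinity>" using g'(2) by (simp add: ennreal_mult_less_top)
  finally show ?thesis using assms(2) by (simp add: Lp_finite[OF False] r_def)
qed

lemma Lp_add:
  assumes f: "f \<in> Lp M p" and g: "g \<in> Lp M p"
  shows "(\<lambda>x. f x + g x) \<in> Lp M p"
proof (cases "p = \<infinity>")
  case True
  obtain C D where "AE x in M. \<bar>f x\<bar> \<le> C" "AE x in M. \<bar>g x\<bar> \<le> D" using f g by (auto simp: True Lp_infinity)
  then have "AE x in M. \<bar>f x + g x\<bar> \<le> C + D" by eventually_elim linarith
  then show ?thesis using True LpD[OF f] LpD[OF g] by (auto simp: Lp_infinity)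
next
  case False
  define r where "r = enn2real p"
  have r: "0 \<le> r" by (simp add: r_def)
  note [measurable] = LpD[OF f] LpD[OF g]
  have "(\<integral>\<^sup>+x. ennreal (\<bar>f x + g x\<bar> powr r) \<partial>M)
      \<le> (\<integral>\<^sup>+x. ennreal (2 powr r) * (ennreal (\<bar>f x\<bar> powr r) + ennreal (\<bar>g x\<bar> powr r)) \<partial>M)"
  proof (rule nn_integral_mono)
    fix x
    have "\<bar>f x + g x\<bar> powr r \<le> (2 * max \<bar>f x\<bar> \<bar>g x\<bar>) powr r" by (rule powr_mono2[OF r]) auto
    also have "\<dots> = 2 powr r * max \<bar>f x\<bar> \<bar>g x\<bar> powr r" by (simp add: powr_mult)
    also have "\<dots> \<le> 2 powr r * (\<bar>f x\<bar> powr r + \<bar>g x\<bar> powr r)" by (intro mult_left_mono) (auto simp: max_def)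
    finally show "ennreal (\<bar>f x + g x\<bar> powr r) \<le> ennreal (2 powr r) * (ennreal (\<bar>f x\<bar> powr r) + ennreal (\<bar>g x\<bar> powr r))"
      by (simp add: ennreal_leI flip: ennreal_mult ennreal_plus)
  qed
  also have "\<dots> = ennreal (2 powr r) * ((\<integral>\<^sup>+x. ennreal (\<bar>f x\<bar> powr r) \<partial>M) + (\<integral>\<^sup>+x. ennreal (\<bar>g x\<bar> powr r) \<partial>M))"
    by (subst nn_integral_cmult, measurable, subst nn_integral_add) auto
  also have "\<dots> < \<infinity>" using f g by (simp add: ennreal_mult_less_top Lp_finite[OF False] r_def)
  finally show ?thesis by (simp add: Lp_finite[OF False] r_def)
qed

lemma Lp_bounded:
  assumes "finite_measure M" "f \<in> borel_measurable M" "\<And>x. \<bar>f x\<bar> \<le> c"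
  shows "f \<in> Lp M p"
proof (cases "p = \<infinity>")
  case True
  then show ?thesis using assms(2,3) by (auto simp: Lp_infinity)
next
  case False
  interpret finite_measure M by fact
  have "(\<integral>\<^sup>+x. ennreal (\<bar>f x\<bar> powr enn2real p) \<partial>M) \<le> (\<integral>\<^sup>+x. ennreal (c powr enn2real p) \<partial>M)"
    using assms(3) by (intro nn_integral_mono ennreal_leI powr_mono2) auto
  also have "\<dots> < \<infinity>" by (simp add: ennreal_mult_less_top emeasure_eq_measure)
  finally show ?thesis using assms(2) by (simp add: Lp_finite[OF False])
qed

text \<open>Lowers exponents on finite measure spaces, where the summand 1 is integrable.\<close>

lemma powr_le_one_plus: "0 \<le> a \<Longrightarrow> s \<le> r \<Longrightarrow> 0 \<le> s \<Longrightarrow> a powr s \<le> 1 + a powr r" for a s r :: real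
proof (cases "a \<le> 1")
  case True
  assume "0 \<le> a" "0 \<le> s"
  then have "a powr s \<le> 1 powr s" using True by (intro powr_mono2) auto
  then show ?thesis by (simp add: add_increasing2)
next
  case False
  assume "s \<le> r"
  then have "a powr s \<le> a powr r" using False by (intro powr_mono) auto
  then show ?thesis by simp
qed

lemma Lp_powr_integrable:
  assumes "finite_measure M" "f \<in> Lp M p" "p \<noteq> \<infinity>" "0 \<le> s" "ennreal s \<le> p"
  shows "integrable M (\<lambda>x. \<bar>f x\<bar> powr s)"
proof -
  interpret finite_measure M by fact
  note [measurable] = LpD[OF assms(2)]
  have "integrable M (\<lambda>x. \<bar>f x\<bar> powr enn2real p)"
    using assms(2) by (simp add: integrable_iff_bounded Lp_finite[OF assms(3)])
  then have i: "integrable M (\<lambda>x. 1 + \<bar>f x\<bar> powr enn2real p)" by simp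
  have "s \<le> enn2real p" using assms(3,4,5) by (cases p) auto
  then show ?thesis
    by (intro Bochner_Integration.integrable_bound[OF i]) (auto intro!: powr_le_one_plus assms(4) AE_I2 order_trans[OF powr_le_one_plus abs_ge_self])
qed

lemma Lp_integrable:
  assumes "finite_measure M" "f \<in> Lp M p" "1 \<le> p"
  shows "integrable M f"
proof -
  interpret finite_measure M by fact
  note [measurable] = LpD[OF assms(2)]
  show ?thesis
  proof (cases "p = \<infinity>")
    case True
    then obtain C where "AE x in M. \<bar>f x\<bar> \<le> C" using assms(2) by (auto simp: Lp_infinity)
    then show ?thesis by (intro integrable_const_bound[of _ C]) auto
  next
    case False
    have "integrable M (\<lambda>x. \<bar>f x\<bar> powr 1)"
      using assms(3) by (intro Lp_powr_integrable[OF assms(1,2) False]) auto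
    then have "integrable M (\<lambda>x. norm (f x))" by simp
    then show ?thesis by (rule integrable_norm_cancel) measurable
  qed
qed

text \<open>Hoelder's inequality in qualitative form. For q = 1 the conjugate exponent is infinite
  and forces p to be infinite; otherwise the exponent p is first lowered to q/(q - 1), using that
  the measure is finite.\<close>

lemma Lp_conj_mult_integrable:
  assumes M: "finite_measure M" and f: "f \<in> Lp M (ennreal q)" and g: "g \<in> Lp M p" and q: "1 \<le> q" and p: "conj_exponent q \<le> p"
  shows "integrable M (\<lambda>x. f x * g x)"
proof -
  note [measurable] = LpD[OF f] LpD[OF g]
  show ?thesis
  proof (cases "p = \<infinity>")
    case True
    then obtain C where C: "AE x in M. \<bar>g x\<bar> \<le> C" using g by (auto simp: Lp_infinity)
    have "integrable M f" using q by (intro Lp_integrable[OF M f]) simp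
    then have "integrable M (\<lambda>x. C * f x)" by simp
    then show ?thesis
    proof (rule Bochner_Integration.integrable_bound)
      show "AE x in M. norm (f x * g x) \<le> norm (C * f x)"
        using C
      proof eventually_elim
        case (elim x)
        have "\<bar>f x\<bar> * \<bar>g x\<bar> \<le> \<bar>f x\<bar> * \<bar>C\<bar>" using elim by (intro mult_left_mono) auto
        then show ?case by (simp add: abs_mult mult.commute)
      qed
    qed measurable
  next
    case False
    then have q1: "1 < q" using q p by (cases "q = 1") (auto simp: conj_exponent_def top_unique)
    define q' where "q' = q / (q - 1)"
    have q': "0 \<le> q'" "ennreal q' \<le> p" using q1 p by (auto simp: q'_def conj_exponent_def)
    have i1: "integrable M (\<lambda>x. \<bar>f x\<bar> powr q)" using q by (intro Lp_powr_integrable[OF M f]) auto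
    have i2: "integrable M (\<lambda>x. \<bar>g x\<bar> powr q')" by (rule Lp_powr_integrable[OF M g False q'])
    \<comment> \<open>A cruder Young inequality without optimal constants: the larger of a^q and
      b^q' dominates the product. If b^q' <= a^q, then b <= a^(q-1), and symmetrically.\<close>
    have young: "a * b \<le> a powr q + b powr q'" if ab: "0 \<le> a" "0 \<le> b" for a b :: real
    proof (cases "b powr q' \<le> a powr q")
      case True
      have "b = (b powr q') powr (1 / q')" using ab q1 by (simp add: powr_powr q'_def)
      also have "\<dots> \<le> (a powr q) powr (1 / q')" using True q1 by (intro powr_mono2) (auto simp: q'_def)
      also have "\<dots> = a powr (q - 1)" using q1 by (simp add: powr_powr q'_def)
      finally have "a * b \<le> a * a powr (q - 1)" using ab by (intro mult_left_mono)
      also have "\<dots> = a powr q" using ab q1 by (cases "a = 0") (auto simp: powr_mult_base)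
      finally show ?thesis by (simp add: add_increasing2)
    next
      case False
      have "a = (a powr q) powr (1 / q)" using ab q1 by (simp add: powr_powr)
      also have "\<dots> \<le> (b powr q') powr (1 / q)" using False q1 by (intro powr_mono2) auto
      also have "\<dots> = b powr (q' - 1)" using q1 by (simp add: powr_powr q'_def field_simps)
      finally have "a \<le> b powr (q' - 1)" .
      from mult_left_mono[OF this ab(2)] have "a * b \<le> b * b powr (q' - 1)" by (simp only: mult.commute)
      also have "\<dots> = b powr q'" using ab q1 by (cases "b = 0") (auto simp: powr_mult_base q'_def)
      finally show ?thesis by (simp add: add_increasing)
    qed
    have i: "integrable M (\<lambda>x. \<bar>f x\<bar> powr q + \<bar>g x\<bar> powr q')" using i1 i2 by simp
    show ?thesis
    proof (rule Bochner_Integration.integrable_bound[OF i])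
      have "norm (f x * g x) \<le> norm (\<bar>f x\<bar> powr q + \<bar>g x\<bar> powr q')" for x
        using young[of "\<bar>f x\<bar>" "\<bar>g x\<bar>"] by (simp add: abs_mult)
      then show "AE x in M. norm (f x * g x) \<le> norm (\<bar>f x\<bar> powr q + \<bar>g x\<bar> powr q')" by simp
    qed measurable
  qed
qed

section \<open>Local Lebesgue spaces\<close>

lemma finite_measure_restrict_compact:
  fixes K :: "'a::euclidean_space set"
  assumes "compact K" shows "finite_measure (restrict_space lborel K)"
proof
  have "emeasure lborel K < \<infinity>" using assms by (intro emeasure_bounded_finite compact_imp_bounded)
  then show "emeasure (restrict_space lborel K) (space (restrict_space lborel K)) \<noteq> \<infinity>"
    using assms by (subst emeasure_restrict_space) (auto simp: space_restrict_space borel_compact)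
qed

lemma Lp_loc_loc_int:
  assumes "f \<in> Lp_loc p" "1 \<le> p"
  shows "loc_int f"
proof -
  have "f \<in> Lp (restrict_space lborel K) 1" if K: "compact K" for K
  proof -
    have f: "f \<in> Lp (restrict_space lborel K) p" using assms(1) K by (simp add: Lp_loc_def)
    have "integrable (restrict_space lborel K) f"
      by (rule Lp_integrable[OF finite_measure_restrict_compact[OF K] f assms(2)])
    then show ?thesis using LpD[OF f] by (simp add: Lp_finite integrable_iff_bounded)
  qed
  then have "f \<in> Lp_loc 1" using assms(1) by (simp add: Lp_loc_def)
  then show ?thesis by (simp only: Lp_loc_1_iff)
qed

lemma Lp_loc_add: "f \<in> Lp_loc p \<Longrightarrow> g \<in> Lp_loc p \<Longrightarrow> (\<lambda>x. f x + g x) \<in> Lp_loc p"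
  by (auto simp: Lp_loc_def intro: Lp_add)

lemma Lp_loc_mono:
  assumes "g \<in> Lp_loc p" "f \<in> borel_measurable borel" "AE x in lborel. \<bar>f x\<bar> \<le> c * \<bar>g x\<bar>" "0 \<le> c"
  shows "f \<in> Lp_loc p"
  unfolding Lp_loc_def
proof (intro CollectI conjI allI impI assms(2))
  fix K :: "'a set" assume K: "compact K"
  show "f \<in> Lp (restrict_space lborel K) p"
  proof (rule Lp_mono[OF _ _ _ assms(4)])
    show "g \<in> Lp (restrict_space lborel K) p" using assms(1) K by (simp add: Lp_loc_def)
    show "f \<in> borel_measurable (restrict_space lborel K)" by (rule measurable_restrict_space1) (use assms(2) in simp)
    show "AE x in restrict_space lborel K. \<bar>f x\<bar> \<le> c * \<bar>g x\<bar>"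
      using assms(3) K by (subst AE_restrict_space_iff) (auto simp: borel_compact elim: eventually_mono)
  qed
qed

lemma Lp_loc_bounded:
  assumes "f \<in> borel_measurable borel" "\<And>x. \<bar>f x\<bar> \<le> c"
  shows "f \<in> Lp_loc p"
  unfolding Lp_loc_def
proof (intro CollectI conjI allI impI assms(1))
  fix K :: "'a set" assume "compact K"
  then show "f \<in> Lp (restrict_space lborel K) p"
    using assms by (intro Lp_bounded[OF finite_measure_restrict_compact] measurable_restrict_space1) auto
qed

text \<open>The outer square makes the function C^1 across the sphere of radius n + 1, and the inner
  square avoids the singularity of the norm at the origin. C^1 is enough, since
  \<open>weak_exp_product\<close> asks for no more of \<zeta> than a bounded directional
  derivative.\<close>

definition cutoff :: "nat \<Rightarrow> 'a::euclidean_space \<Rightarrow> real" where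
  "cutoff n x = (max 0 (1 - (norm x / real (Suc n))\<^sup>2))\<^sup>2"

definition cutoff' :: "nat \<Rightarrow> 'a::euclidean_space \<Rightarrow> 'a \<Rightarrow> real" where
  "cutoff' n i x = 2 * max 0 (1 - (norm x / real (Suc n))\<^sup>2) * (- 2 * (x \<bullet> i) / (real (Suc n))\<^sup>2)"

lemma DERIV_pos_part_square: "((\<lambda>s::real. (max 0 s)\<^sup>2) has_real_derivative 2 * max 0 s) (at s)"
proof -
  consider "0 < s" | "s < 0" | "s = 0" by linarith
  then show ?thesis
  proof cases
    case 1
    have "((\<lambda>s::real. s\<^sup>2) has_real_derivative 2 * max 0 s) (at s)" using 1 by (auto intro!: derivative_eq_intros)
    then show ?thesis by (rule has_field_derivative_transform_within_open[of _ _ _ "{0<..}"]) (use 1 in auto)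
  next
    case 2
    have "((\<lambda>s::real. 0) has_real_derivative 2 * max 0 s) (at s)" using 2 by auto
    then show ?thesis by (rule has_field_derivative_transform_within_open[of _ _ _ "{..<0}"]) (use 2 in auto)
  next
    case 3
    have "((\<lambda>h::real. (max 0 h)\<^sup>2 / h) \<longlongrightarrow> 0) (at 0)"
    proof (rule Lim_null_comparison)
      show "eventually (\<lambda>h::real. norm ((max 0 h)\<^sup>2 / h) \<le> \<bar>h\<bar>) (at 0)"
        by (rule always_eventually) (auto simp: max_def power2_eq_square)
      show "((\<lambda>h::real. \<bar>h\<bar>) \<longlongrightarrow> 0) (at 0)" by (rule tendsto_rabs_zero) (rule tendsto_ident_at)
    qed
    then show ?thesis using 3 by (simp add: DERIV_def)
  qed
qed

lemma cutoff_deriv: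
  assumes "i \<in> Basis"
  shows "((\<lambda>t. cutoff n (x + t *\<^sub>R i)) has_real_derivative cutoff' n i x) (at 0)"
proof -
  define N where "N = real (Suc n)"
  have N: "N \<noteq> 0" by (simp add: N_def)
  have sq: "(norm (x + t *\<^sub>R i))\<^sup>2 = (norm x)\<^sup>2 + 2 * t * (x \<bullet> i) + t\<^sup>2" for t
    using assms unfolding power2_norm_eq_inner by (simp add: inner_add_left inner_add_right inner_commute power2_eq_square algebra_simps)
  have "((\<lambda>t. 1 - ((norm x)\<^sup>2 + 2 * t * (x \<bullet> i) + t\<^sup>2) / N\<^sup>2) has_real_derivative - 2 * (x \<bullet> i) / N\<^sup>2) (at 0)"
  proof -
    have "((\<lambda>t. (norm x)\<^sup>2 + 2 * t * (x \<bullet> i) + t\<^sup>2) has_real_derivative 2 * (x \<bullet> i)) (at 0)"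
      by (auto intro!: derivative_eq_intros)
    from DERIV_diff[OF DERIV_const[of 1] DERIV_cdivide[OF this, of "N\<^sup>2"]] show ?thesis by simp
  qed
  then have "((\<lambda>t. 1 - (norm (x + t *\<^sub>R i) / N)\<^sup>2) has_real_derivative - 2 * (x \<bullet> i) / N\<^sup>2) (at 0)"
    by (simp only: sq power_divide)
  from DERIV_chain2[OF DERIV_pos_part_square this] show ?thesis
    by (simp add: cutoff_def cutoff'_def N_def)
qed

lemma cutoff_support: "cutoff n x \<noteq> 0 \<Longrightarrow> norm x \<le> real (Suc n)" "cutoff' n i x \<noteq> 0 \<Longrightarrow> norm x \<le> real (Suc n)"
proof -
  have "max 0 (1 - (norm x / real (Suc n))\<^sup>2) = 0" if "real (Suc n) < norm x"
  proof -
    have "1 \<le> norm x / real (Suc n)" using that by (simp add: field_simps)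
    then have "1 \<le> (norm x / real (Suc n))\<^sup>2" by (rule one_le_power)
    then show ?thesis by simp
  qed
  then have *: "max 0 (1 - (norm x / real (Suc n))\<^sup>2) \<noteq> 0 \<Longrightarrow> norm x \<le> real (Suc n)" by (meson not_le)
  show "norm x \<le> real (Suc n)" if "cutoff n x \<noteq> 0" using that unfolding cutoff_def by (intro *) auto
  show "norm x \<le> real (Suc n)" if "cutoff' n i x \<noteq> 0" using that unfolding cutoff'_def by (intro *) auto
qed

lemma cutoff_bounds: "\<bar>cutoff n x\<bar> \<le> 1" "i \<in> Basis \<Longrightarrow> \<bar>cutoff' n i x\<bar> \<le> 4 / real (Suc n)"
proof -
  have m: "0 \<le> max 0 (1 - (norm x / real (Suc n))\<^sup>2)" "max 0 (1 - (norm x / real (Suc n))\<^sup>2) \<le> 1" by auto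
  show "\<bar>cutoff n x\<bar> \<le> 1" unfolding cutoff_def using power_le_one[OF m] by (simp only: abs_of_nonneg zero_le_power2)
  assume i: "i \<in> Basis"
  show "\<bar>cutoff' n i x\<bar> \<le> 4 / real (Suc n)"
  proof (cases "cutoff' n i x = 0")
    case False
    define N where "N = real (Suc n)"
    have N: "0 < N" by (simp add: N_def)
    have nx: "norm x \<le> N" using cutoff_support(2)[OF False] by (simp add: N_def)
    then have "\<bar>x \<bullet> i\<bar> \<le> N" using Basis_le_norm[OF i, of x] by simp
    then have "\<bar>x \<bullet> i\<bar> / N\<^sup>2 \<le> N / N\<^sup>2" by (rule divide_right_mono) simp
    also have "\<dots> = 1 / N" using N by (simp add: power2_eq_square)
    finally have b: "\<bar>x \<bullet> i\<bar> / N\<^sup>2 \<le> 1 / N" .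
    have "\<bar>cutoff' n i x\<bar> = 4 * (max 0 (1 - (norm x / N)\<^sup>2) * (\<bar>x \<bullet> i\<bar> / N\<^sup>2))"
      unfolding cutoff'_def N_def[symmetric] using m(1)[folded N_def] by (simp add: abs_mult)
    also have "\<dots> \<le> 4 * (1 * (1 / N))" using m[folded N_def] b by (intro mult_left_mono mult_mono) auto
    finally show ?thesis by (simp add: N_def)
  qed simp
qed

lemma cutoff_borel [measurable]: "cutoff n \<in> borel_measurable borel" "cutoff' n i \<in> borel_measurable borel"
  unfolding cutoff_def[abs_def] cutoff'_def[abs_def] by measurable

lemma cutoff_tendsto: "(\<lambda>n. cutoff n x) \<longlonglongrightarrow> 1"
proof -
  have "(\<lambda>n. norm x * (1 / real (Suc n))) \<longlonglongrightarrow> norm x * 0" by (intro tendsto_intros lim_1_Suc)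
  then have "(\<lambda>n. norm x / real (Suc n)) \<longlonglongrightarrow> 0" by simp
  then have "(\<lambda>n. (max 0 (1 - (norm x / real (Suc n))\<^sup>2))\<^sup>2) \<longlonglongrightarrow> (max 0 (1 - 0\<^sup>2))\<^sup>2" by (intro tendsto_intros)
  then show ?thesis by (simp add: cutoff_def)
qed

lemma cutoff'_tendsto:
  assumes "i \<in> Basis" shows "(\<lambda>n. cutoff' n i x) \<longlonglongrightarrow> 0"
proof (rule Lim_null_comparison)
  show "eventually (\<lambda>n. norm (cutoff' n i x) \<le> 4 * (1 / real (Suc n))) sequentially"
    using cutoff_bounds(2)[OF assms] by (intro always_eventually) simp
  have "(\<lambda>n. 4 * (1 / real (Suc n))) \<longlonglongrightarrow> 4 * 0" by (intro tendsto_intros lim_1_Suc)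
  then show "(\<lambda>n. 4 * (1 / real (Suc n))) \<longlonglongrightarrow> 0" by simp
qed

text \<open>The divergence of the field a exp(b) in direction i has integral 0. Cutoff derivatives
  are at most 4/(n+1) and a exp(b) is integrable, so the term containing them disappears in the
  limit.\<close>

lemma integral_weighted_divergence_zero:
  fixes a b :: "'a::euclidean_space \<Rightarrow> real"
  assumes a: "has_weak_deriv a [i] a'" and b: "has_weak_deriv b [i] b'" and i: "i \<in> Basis"
    and int: "integrable lborel (\<lambda>x. a x * exp (b x))" "integrable lborel (\<lambda>x. a' x * exp (b x))"
      "integrable lborel (\<lambda>x. b' x * a x * exp (b x))"
  shows "(\<integral>x. a' x * exp (b x) \<partial>lborel) + (\<integral>x. b' x * a x * exp (b x) \<partial>lborel) = 0"
proof -
  have [measurable]: "a \<in> borel_measurable borel" "a' \<in> borel_measurable borel" "b \<in> borel_measurable borel" "b' \<in> borel_measurable borel"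
    using has_weak_deriv_loc_int[OF a] has_weak_deriv_loc_int[OF b] by (auto simp: loc_int_borel)
  have mult: "integrable lborel (\<lambda>x. f x * w x)" if f: "integrable lborel f" and [measurable]: "w \<in> borel_measurable borel" and w: "\<And>x. \<bar>w x\<bar> \<le> c"
    for f w :: "'a \<Rightarrow> real" and c
  proof (rule Bochner_Integration.integrable_bound[of _ "\<lambda>x. c * f x"])
    show "integrable lborel (\<lambda>x. c * f x)" using f by simp
    show "(\<lambda>x. f x * w x) \<in> borel_measurable lborel" using borel_measurable_integrable[OF f] by measurable
    show "AE x in lborel. norm (f x * w x) \<le> norm (c * f x)"
    proof (rule AE_I2)
      fix x show "norm (f x * w x) \<le> norm (c * f x)"
        using mult_left_mono[OF order_trans[OF w[of x] abs_ge_self], of "\<bar>f x\<bar>"] by (simp add: abs_mult mult.commute)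
    qed
  qed
  have b4: "\<bar>cutoff' n i x\<bar> \<le> 4" for n x
    using cutoff_bounds(2)[OF i, of n x] by (rule order_trans) (simp add: field_simps)
  have eq: "(\<integral>x. a x * exp (b x) * cutoff' n i x \<partial>lborel)
     = - ((\<integral>x. a' x * exp (b x) * cutoff n x \<partial>lborel) + (\<integral>x. b' x * a x * exp (b x) * cutoff n x \<partial>lborel))" for n
  proof (rule weak_exp_product[OF a b i cutoff_borel cutoff_deriv[OF i], where B = 4 and R = "real (Suc n)"])
    show "\<bar>cutoff n x\<bar> \<le> 4" for x using cutoff_bounds(1)[of n x] by simp
    show "integrable lborel (\<lambda>x. a x * exp (b x) * cutoff' n i x)" by (rule mult[OF int(1) cutoff_borel(2) b4])
    show "integrable lborel (\<lambda>x. a' x * exp (b x) * cutoff n x)" by (rule mult[OF int(2) cutoff_borel(1) cutoff_bounds(1)])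
    show "integrable lborel (\<lambda>x. b' x * a x * exp (b x) * cutoff n x)" by (rule mult[OF int(3) cutoff_borel(1) cutoff_bounds(1)])
  qed (use b4 in \<open>auto intro: cutoff_support simp del: of_nat_Suc\<close>)
  have L1: "(\<lambda>n. \<integral>x. a x * exp (b x) * cutoff' n i x \<partial>lborel) \<longlonglongrightarrow> (\<integral>x. a x * exp (b x) * 0 \<partial>lborel)"
  proof (rule integral_tendsto_dominated[of _ "\<lambda>x. 4 * (a x * exp (b x))"])
    show "(\<lambda>n. a x * exp (b x) * cutoff' n i x) \<longlonglongrightarrow> a x * exp (b x) * 0" for x
      by (intro tendsto_intros cutoff'_tendsto i)
    show "\<bar>a x * exp (b x) * cutoff' n i x\<bar> \<le> \<bar>4 * (a x * exp (b x))\<bar>" for n x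
      using mult_left_mono[OF b4[of n x], of "\<bar>a x * exp (b x)\<bar>"] by (simp add: abs_mult mult_ac)
  qed (use int in auto)
  have L2: "(\<lambda>n. \<integral>x. h x * cutoff n x \<partial>lborel) \<longlonglongrightarrow> (\<integral>x. h x * 1 \<partial>lborel)" if h: "integrable lborel h" for h :: "'a \<Rightarrow> real"
  proof (rule integral_tendsto_dominated[OF h])
    show "(\<lambda>n. h x * cutoff n x) \<longlonglongrightarrow> h x * 1" for x by (intro tendsto_intros cutoff_tendsto)
    show "\<bar>h x * cutoff n x\<bar> \<le> \<bar>h x\<bar>" for n x
      using mult_left_mono[OF cutoff_bounds(1)[of n x], of "\<bar>h x\<bar>"] by (simp add: abs_mult)
  qed (use borel_measurable_integrable[OF h] in measurable)
  have "(\<integral>x. a x * exp (b x) * 0 \<partial>lborel) = - ((\<integral>x. a' x * exp (b x) * 1 \<partial>lborel) + (\<integral>x. b' x * a x * exp (b x) * 1 \<partial>lborel))"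
    by (rule LIMSEQ_unique[OF L1[unfolded eq] tendsto_minus[OF tendsto_add[OF L2[OF int(2)] L2[OF int(3)]]]])
  then show ?thesis by simp
qed

section \<open>The fixed point\<close>

lemma Lp_cmult:
  assumes "f \<in> Lp M r" shows "(\<lambda>x. c * f x) \<in> Lp M r"
proof (rule Lp_mono[OF assms])
  note [measurable] = LpD[OF assms]
  show "(\<lambda>x. c * f x) \<in> borel_measurable M" by measurable
  show "AE x in M. \<bar>c * f x\<bar> \<le> \<bar>c\<bar> * \<bar>f x\<bar>" by (simp add: abs_mult)
qed simp

lemma Lp_loc_cmult:
  assumes "f \<in> Lp_loc r" shows "(\<lambda>x. c * f x) \<in> Lp_loc r"
proof (rule Lp_loc_mono[OF assms])
  have [measurable]: "f \<in> borel_measurable borel" using assms by (simp add: Lp_loc_def)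
  show "(\<lambda>x. c * f x) \<in> borel_measurable borel" by measurable
  show "AE x in lborel. \<bar>c * f x\<bar> \<le> \<bar>c\<bar> * \<bar>f x\<bar>" by (simp add: abs_mult)
qed simp

text \<open>The conditions assert F1 to F4, G1, G2 and C only existentially; one choice is fixed so
  that constants built from them can be named.\<close>

locale mckean_vlasov =
  fixes V0 Vb W0 W W1 F0 F2 :: "'a::euclidean_space \<Rightarrow> real"
    and V :: "'a \<Rightarrow> 'a measure \<Rightarrow> real"
    and p p1 :: ennreal and q C :: real
    and F1 F3 F4 G1 G2 :: "real \<Rightarrow> real"
  assumes H1: "H1 p q V0 Vb"
    and W0_borel [measurable]: "W0 \<in> borel_measurable borel" and W0_ge: "\<And>x. 1 \<le> W0 x"
    and W0_int: "integrable (ref_measure Vb) W0"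
    and V_sob: "\<And>\<mu>. \<mu> \<in> prob_wt W0 \<Longrightarrow> (\<lambda>x. V x \<mu>) \<in> sobolev_loc 1 p"
    and F0_nonneg: "\<And>x. 0 \<le> F0 x" and F0_loc: "F0 \<in> Lp_loc \<infinity>"
    and F2: "\<And>x. 0 \<le> F2 x" "F2 \<in> Lp (ref_measure Vb) (ennreal q)" "F2 \<in> Lp_loc p"
    and F1: "\<And>r. 0 \<le> r \<Longrightarrow> 0 \<le> F1 r" "mono_on {0..} F1" "(F1 \<longlongrightarrow> 0) (at_right 0)"
    and F3: "\<And>r. 0 \<le> r \<Longrightarrow> 0 \<le> F3 r" "mono_on {0..} F3"
    and V_diff: "\<And>\<mu> \<nu> x. \<mu> \<in> prob_wt W0 \<Longrightarrow> \<nu> \<in> prob_wt W0 \<Longrightarrow> \<bar>V x \<mu> - V x \<nu>\<bar> \<le> F0 x * F1 (wt_dist W0 \<mu> \<nu>)"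
    and V_ref: "\<And>x. \<bar>V x (ref_measure Vb)\<bar> \<le> C * (F0 x + 1)"
    and V_grad: "\<And>\<mu>. \<mu> \<in> prob_wt W0 \<Longrightarrow> AE x in lborel. norm (weak_grad (\<lambda>y. V y \<mu>) x) \<le> F2 x * F3 (wt_norm W0 \<mu>)"
    and F4: "mono_on {0..} F4" "\<And>\<beta> x. 0 \<le> \<beta> \<Longrightarrow> - V0 x + \<beta> * F0 x \<le> - Vb x + F4 \<beta>"
    and W1_cond: "cond_W1 W0 W"
    and G: "strict_mono_on {0..} G1" "strict_mono_on {0..} G2" "convex_on {0..} G2"
      "Limsup at_top (\<lambda>r. ereal (G1 r / G2 r)) < 1"
    and Lyap: "\<And>\<mu>. \<mu> \<in> prob_wt W \<Longrightarrow> AE x in lborel. L_op V0 V \<mu> W1 x \<le> G1 (wt_norm W \<mu>) - G2 (W x)"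
    and p1: "conj_exponent q \<le> p1" and W1_sob: "W1 \<in> sobolev_wt 2 p1 p1 (ref_measure Vb)"
begin

section \<open>The reference measure\<close>

abbreviation "mub \<equiv> ref_measure Vb"

definition "Z = (\<integral>x. exp (- Vb x) \<partial>lborel)"

lemma V0_borel [measurable]: "V0 \<in> borel_measurable borel"
  and Vb_borel [measurable]: "Vb \<in> borel_measurable borel"
  and exp_int: "integrable lborel (\<lambda>x. exp (- V0 x))" "integrable lborel (\<lambda>x. exp (- Vb x))"
  and q1: "1 \<le> q"
  using H1 by (auto simp: H1_def)

lemma p_ge: "1 \<le> p"
proof -
  have "(1::ennreal) \<le> of_nat DIM('a)" using DIM_positive[where 'a='a] by (metis Suc_leI One_nat_def of_nat_1 of_nat_le_iff)
  also have "of_nat DIM('a) < p" using H1 by (simp add: H1_def)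
  finally show ?thesis by (rule less_imp_le)
qed

lemma W_borel [measurable]: "W \<in> borel_measurable borel" and W_ge: "1 \<le> W x"
  using W1_cond by (auto simp: cond_W1_def)

lemma F0_borel [measurable]: "F0 \<in> borel_measurable borel" and F2_borel [measurable]: "F2 \<in> borel_measurable borel"
  using F0_loc F2(3) by (auto simp: Lp_loc_def)

lemma Z_pos: "0 < Z"
proof -
  have "Z \<noteq> 0"
  proof
    assume "Z = 0"
    then have "AE x in lborel. exp (- Vb x) = 0"
      using integral_nonneg_eq_0_iff_AE[OF exp_int(2)] by (simp add: Z_def)
    then have "AE x in (lborel :: 'a measure). False" by (rule eventually_mono) simp
    then have "emeasure lborel (UNIV :: 'a set) = 0" by (subst (asm) AE_iff_measurable[OF _ refl]) auto
    then show False by simp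
  qed
  moreover have "0 \<le> Z" by (simp add: Z_def)
  ultimately show ?thesis by simp
qed

lemma mub_def: "mub = density lborel (\<lambda>x. ennreal (exp (- Vb x) / Z))"
  by (simp add: ref_measure_def Z_def)

lemma sets_mub [measurable_cong, simp]: "sets mub = sets borel" and space_mub [simp]: "space mub = UNIV"
  by (simp_all add: mub_def)

lemma integrable_mub: "f \<in> borel_measurable borel \<Longrightarrow> integrable mub f \<longleftrightarrow> integrable lborel (\<lambda>x. exp (- Vb x) / Z * f x)"
  and integral_mub: "f \<in> borel_measurable borel \<Longrightarrow> (\<integral>x. f x \<partial>mub) = (\<integral>x. exp (- Vb x) / Z * f x \<partial>lborel)" for f :: "'a \<Rightarrow> real"
  using Z_pos by (auto simp: mub_def integrable_density integral_density)

lemma AE_mub: "AE x in lborel. P x \<Longrightarrow> AE x in mub. P x"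
  unfolding mub_def by (subst AE_density) auto

lemma prob_mub: "prob_space mub"
proof
  have "emeasure mub (space mub) = (\<integral>\<^sup>+x. ennreal (exp (- Vb x) / Z) \<partial>lborel)"
    by (simp add: mub_def emeasure_density)
  also have "\<dots> = ennreal (\<integral>x. exp (- Vb x) / Z \<partial>lborel)"
    using exp_int(2) Z_pos by (intro nn_integral_eq_integral) auto
  also have "(\<integral>x. exp (- Vb x) / Z \<partial>lborel) = 1" using Z_pos by (simp add: Z_def)
  finally show "emeasure mub (space mub) = 1" by simp
qed

sublocale mub: prob_space mub by (rule prob_mub)

definition "cW = (SUP x. W0 x / W x)"

lemma W0_le: "W0 x \<le> cW * W x"
proof -
  have "W0 x / W x \<le> cW" unfolding cW_def using W1_cond by (intro cSUP_upper) (auto simp: cond_W1_def)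
  then show ?thesis using W_ge[of x] by (simp add: divide_le_eq)
qed

lemma cW_nonneg: "0 \<le> cW"
  using W0_le[of 0] W0_ge[of 0] W_ge[of 0] by (smt (verit) mult_neg_pos)

section \<open>Densities and the weighted distance of measures\<close>

definition "densities = {f \<in> borel_measurable borel. (\<forall>x. 0 \<le> f x) \<and> integrable mub f \<and> (\<integral>x. f x \<partial>mub) = 1 \<and> integrable mub (\<lambda>x. f x * W0 x)}"

lemma densitiesD:
  assumes "f \<in> densities"
  shows "f \<in> borel_measurable borel" "0 \<le> f x" "integrable mub f" "(\<integral>x. f x \<partial>mub) = 1" "integrable mub (\<lambda>x. f x * W0 x)"
  using assms by (auto simp: densities_def)

lemma I_map_integral:
  assumes "f \<in> borel_measurable borel" "\<And>x. 0 \<le> f x" and "h \<in> borel_measurable borel"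
  shows "integrable (I_map Vb f) h \<longleftrightarrow> integrable mub (\<lambda>x. f x * h x)"
    and "(\<integral>x. h x \<partial>I_map Vb f) = (\<integral>x. f x * h x \<partial>mub)"
  using assms by (auto simp: I_map_def integrable_density integral_density)

lemma I_map_prob:
  assumes "f \<in> densities"
  shows "prob_space (I_map Vb f)"
proof
  note f = densitiesD[OF assms]
  have "emeasure (I_map Vb f) (space (I_map Vb f)) = (\<integral>\<^sup>+x. ennreal (f x) \<partial>mub)"
    using f(1) by (simp add: I_map_def emeasure_density)
  also have "\<dots> = 1" using f(2-4) by (subst nn_integral_eq_integral) auto
  finally show "emeasure (I_map Vb f) (space (I_map Vb f)) = 1" .
qed

lemma I_map_prob_wt:
  assumes "f \<in> densities" "U \<in> borel_measurable borel" "integrable mub (\<lambda>x. f x * U x)"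
  shows "I_map Vb f \<in> prob_wt U"
  using I_map_prob[OF assms(1)] I_map_integral(1)[OF densitiesD(1,2)[OF assms(1)] assms(2)] assms(3)
  by (simp add: prob_wt_def) (simp add: I_map_def)

lemma one_density: "(\<lambda>x. 1) \<in> densities"
  using W0_int mub.prob_space by (simp add: densities_def)

lemma I_map_one: "I_map Vb (\<lambda>x. 1) = mub"
  by (simp add: I_map_def density_1)

lemma abs_diff_int:
  assumes "f \<in> densities" "g \<in> densities"
  shows "integrable mub (\<lambda>x. \<bar>f x - g x\<bar> * W0 x)"
proof -
  note [measurable] = densitiesD(1)[OF assms(1)] densitiesD(1)[OF assms(2)]
  have "integrable mub (\<lambda>x. f x * W0 x + g x * W0 x)" using assms by (simp add: densitiesD)
  then show ?thesis
  proof (rule Bochner_Integration.integrable_bound)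
    have "\<bar>f x - g x\<bar> * W0 x \<le> (f x + g x) * W0 x" for x
      using densitiesD(2)[OF assms(1), of x] densitiesD(2)[OF assms(2), of x] W0_ge[of x] by (intro mult_right_mono) auto
    then have "norm (\<bar>f x - g x\<bar> * W0 x) \<le> norm (f x * W0 x + g x * W0 x)" for x
      using W0_ge[of x] densitiesD(2)[OF assms(1), of x] densitiesD(2)[OF assms(2), of x]
      by (simp add: abs_mult distrib_right)
    then show "AE x in mub. norm (\<bar>f x - g x\<bar> * W0 x) \<le> norm (f x * W0 x + g x * W0 x)" by simp
  qed measurable
qed

text \<open>The interaction is continuous with respect to \<open>wt_dist\<close>, and this bound by
  the L^1(W0 mub) distance of densities is what makes that space suitable for Schauder's theorem.
  The lower bound comes from the test function 0, the upper one also showing that the supremum is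
  finite.\<close>

lemma wt_dist_bounds:
  assumes f: "f \<in> densities" and g: "g \<in> densities"
  shows "wt_dist W0 (I_map Vb f) (I_map Vb g) \<le> (\<integral>x. \<bar>f x - g x\<bar> * W0 x \<partial>mub)"
    and "0 \<le> wt_dist W0 (I_map Vb f) (I_map Vb g)"
proof -
  define H where "H = {h \<in> borel_measurable borel. \<forall>x. \<bar>h x\<bar> \<le> W0 x}"
  define v where "v h = (\<integral>x. h x \<partial>I_map Vb f) - (\<integral>x. h x \<partial>I_map Vb g)" for h :: "'a \<Rightarrow> real"
  have z: "(\<lambda>x. 0) \<in> H" unfolding H_def using W0_ge by (auto intro: order_trans[OF zero_le_one])
  have le: "v h \<le> (\<integral>x. \<bar>f x - g x\<bar> * W0 x \<partial>mub)" if h: "h \<in> H" for h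
  proof -
    have hb: "h \<in> borel_measurable borel" "\<And>x. \<bar>h x\<bar> \<le> W0 x" using h by (auto simp: H_def)
    have bd: "integrable mub (\<lambda>x. k x * h x)" if k: "k \<in> densities" for k
    proof (rule Bochner_Integration.integrable_bound[OF densitiesD(5)[OF k]])
      show "(\<lambda>x. k x * h x) \<in> borel_measurable mub" using densitiesD(1)[OF k] hb(1) by measurable
      have "norm (k x * h x) \<le> norm (k x * W0 x)" for x
        using mult_left_mono[OF hb(2)[of x] densitiesD(2)[OF k, of x]] densitiesD(2)[OF k, of x] W0_ge[of x] by (simp add: abs_mult)
      then show "AE x in mub. norm (k x * h x) \<le> norm (k x * W0 x)" by simp
    qed
    have "v h = (\<integral>x. f x * h x \<partial>mub) - (\<integral>x. g x * h x \<partial>mub)"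
      unfolding v_def using I_map_integral(2)[OF densitiesD(1,2)[OF f] hb(1)] I_map_integral(2)[OF densitiesD(1,2)[OF g] hb(1)] by simp
    also have "\<dots> = (\<integral>x. f x * h x - g x * h x \<partial>mub)"
      by (rule Bochner_Integration.integral_diff[symmetric, OF bd[OF f] bd[OF g]])
    also have "\<dots> \<le> (\<integral>x. \<bar>f x - g x\<bar> * W0 x \<partial>mub)"
    proof (rule integral_mono[OF _ abs_diff_int[OF f g]])
      show "integrable mub (\<lambda>x. f x * h x - g x * h x)" using bd[OF f] bd[OF g] by simp
      show "f x * h x - g x * h x \<le> \<bar>f x - g x\<bar> * W0 x" for x
      proof -
        have "f x * h x - g x * h x \<le> \<bar>f x - g x\<bar> * \<bar>h x\<bar>" by (simp add: left_diff_distrib[symmetric] abs_mult[symmetric])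
        also have "\<dots> \<le> \<bar>f x - g x\<bar> * W0 x" using hb(2) by (intro mult_left_mono) auto
        finally show ?thesis .
      qed
    qed
    finally show ?thesis .
  qed
  have w: "wt_dist W0 (I_map Vb f) (I_map Vb g) = (SUP h\<in>H. v h)" by (simp add: wt_dist_def H_def v_def)
  show "wt_dist W0 (I_map Vb f) (I_map Vb g) \<le> (\<integral>x. \<bar>f x - g x\<bar> * W0 x \<partial>mub)"
    unfolding w using z le by (intro cSUP_least) auto
  have "v (\<lambda>x. 0) \<le> (SUP h\<in>H. v h)" using le by (intro cSUP_upper z bdd_aboveI2)
  then show "0 \<le> wt_dist W0 (I_map Vb f) (I_map Vb g)" unfolding w by (simp add: v_def)
qed

section \<open>Level sets of the W moment and Gibbs densities over them\<close>

definition "trap M = {f \<in> densities. integrable mub (\<lambda>x. f x * W x) \<and> (\<integral>x. f x * W x \<partial>mub) \<le> M}"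

lemma trapI:
  assumes "f \<in> borel_measurable borel" "\<And>x. 0 \<le> f x" "integrable mub f" "(\<integral>x. f x \<partial>mub) = 1"
    "integrable mub (\<lambda>x. f x * W x)" "(\<integral>x. f x * W x \<partial>mub) \<le> M"
  shows "f \<in> trap M"
proof -
  have "integrable mub (\<lambda>x. f x * W0 x)"
  proof (rule Bochner_Integration.integrable_bound)
    show "integrable mub (\<lambda>x. cW * (f x * W x))" using assms(5) by simp
    have "norm (f x * W0 x) \<le> norm (cW * (f x * W x))" for x
      using mult_left_mono[OF W0_le[of x] assms(2)[of x]] assms(2)[of x] W0_ge[of x] W_ge[of x] cW_nonneg
      by (simp add: abs_mult mult_ac)
    then show "AE x in mub. norm (f x * W0 x) \<le> norm (cW * (f x * W x))" by simp
  qed (use assms(1) in measurable)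
  then show ?thesis using assms by (simp add: trap_def densities_def)
qed

lemma trapD:
  assumes "f \<in> trap M"
  shows "f \<in> densities" "integrable mub (\<lambda>x. f x * W x)" "(\<integral>x. f x * W x \<partial>mub) \<le> M"
    "I_map Vb f \<in> prob_wt W" "I_map Vb f \<in> prob_wt W0" "wt_norm W (I_map Vb f) \<le> M" "0 \<le> wt_norm W (I_map Vb f)"
    "wt_norm W0 (I_map Vb f) \<le> cW * M" "0 \<le> wt_norm W0 (I_map Vb f)"
proof -
  show d: "f \<in> densities" and i: "integrable mub (\<lambda>x. f x * W x)" and le: "(\<integral>x. f x * W x \<partial>mub) \<le> M"
    using assms by (auto simp: trap_def)
  show "I_map Vb f \<in> prob_wt W" by (rule I_map_prob_wt[OF d W_borel i])
  show "I_map Vb f \<in> prob_wt W0" by (rule I_map_prob_wt[OF d W0_borel densitiesD(5)[OF d]])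
  have e: "wt_norm W (I_map Vb f) = (\<integral>x. f x * W x \<partial>mub)" "wt_norm W0 (I_map Vb f) = (\<integral>x. f x * W0 x \<partial>mub)"
    unfolding wt_norm_def by (intro I_map_integral densitiesD[OF d] W_borel W0_borel)+
  show "wt_norm W (I_map Vb f) \<le> M" using le e by simp
  have p: "0 \<le> f x * W x" "0 \<le> f x * W0 x" for x
    using densitiesD(2)[OF d, of x] W_ge[of x] W0_ge[of x] by auto
  show "0 \<le> wt_norm W (I_map Vb f)" "0 \<le> wt_norm W0 (I_map Vb f)" unfolding e using p by (auto intro!: Bochner_Integration.integral_nonneg)
  have "(\<integral>x. f x * W0 x \<partial>mub) \<le> (\<integral>x. cW * (f x * W x) \<partial>mub)"
  proof (rule integral_mono[OF densitiesD(5)[OF d]])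
    show "integrable mub (\<lambda>x. cW * (f x * W x))" using i by simp
    show "f x * W0 x \<le> cW * (f x * W x)" for x
      using mult_left_mono[OF W0_le[of x] densitiesD(2)[OF d, of x]] by (simp add: mult_ac)
  qed
  also have "\<dots> \<le> cW * M" using mult_left_mono[OF le cW_nonneg] by simp
  finally show "wt_norm W0 (I_map Vb f) \<le> cW * M" unfolding e .
qed

lemma trap_pos: "f \<in> trap M \<Longrightarrow> 0 \<le> M"
  using trapD(6,7) by (meson order_trans)

lemma trap_convex:
  assumes f: "f \<in> trap M" and g: "g \<in> trap M" and t: "0 \<le> t" "t \<le> (1::real)"
  shows "(\<lambda>x. (1 - t) * f x + t * g x) \<in> trap M"
proof (rule trapI)
  note df = densitiesD[OF trapD(1)[OF f]] and dg = densitiesD[OF trapD(1)[OF g]]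
  show "(\<lambda>x. (1 - t) * f x + t * g x) \<in> borel_measurable borel" using df(1) dg(1) by measurable
  show "0 \<le> (1 - t) * f x + t * g x" for x using df(2)[of x] dg(2)[of x] t by simp
  show "integrable mub (\<lambda>x. (1 - t) * f x + t * g x)" using df(3) dg(3) by simp
  show "(\<integral>x. (1 - t) * f x + t * g x \<partial>mub) = 1" using df(3,4) dg(3,4) by simp
  have e: "((1 - t) * f x + t * g x) * W x = (1 - t) * (f x * W x) + t * (g x * W x)" for x by (simp add: algebra_simps)
  show "integrable mub (\<lambda>x. ((1 - t) * f x + t * g x) * W x)" unfolding e using trapD(2)[OF f] trapD(2)[OF g] by simp
  have "(\<integral>x. (1 - t) * (f x * W x) + t * (g x * W x) \<partial>mub) = (1 - t) * (\<integral>x. f x * W x \<partial>mub) + t * (\<integral>x. g x * W x \<partial>mub)"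
    using trapD(2)[OF f] trapD(2)[OF g] by simp
  also have "\<dots> \<le> (1 - t) * M + t * M" using trapD(3)[OF f] trapD(3)[OF g] t by (intro add_mono mult_left_mono) auto
  also have "\<dots> = M" by (simp add: algebra_simps)
  finally show "(\<integral>x. ((1 - t) * f x + t * g x) * W x \<partial>mub) \<le> M" unfolding e .
qed

text \<open>On the level M the interaction satisfies |V| <= |C| + \<beta> M F0: |C| comes from the
  bound at the reference measure, and F1 is evaluated at the largest possible distance from it.
  Condition (H3) at this \<beta> turns the envelope into the upper bound \<open>KK M\<close> for
  \<psi>; \<open>lo M\<close> is the matching lower bound, and its integral \<open>c0 M\<close>
  bounds the normalising constant from below.\<close>

definition "\<beta> M = \<bar>C\<bar> + F1 (cW * M + (\<integral>x. W0 x \<partial>mub))"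
definition "KK M = exp (\<bar>C\<bar> + F4 (\<beta> M))"
definition "lo M x = exp (- V0 x - (\<bar>C\<bar> + \<beta> M * F0 x) + Vb x)"
definition "c0 M = (\<integral>x. lo M x \<partial>mub)"

lemma W0_integral_nonneg: "0 \<le> (\<integral>x. W0 x \<partial>mub)"
  using W0_ge by (intro Bochner_Integration.integral_nonneg) (meson order_trans zero_le_one)

lemma \<beta>_nonneg: "0 \<le> M \<Longrightarrow> 0 \<le> \<beta> M"
  unfolding \<beta>_def using cW_nonneg W0_integral_nonneg by (intro add_nonneg_nonneg F1(1)) auto

text \<open>The reference measure is the image of the constant density 1, so its distance from a
  measure in the level set is at most the sum of the two W0 moments.\<close>

lemma V_bound:
  assumes "f \<in> trap M" shows "\<bar>V x (I_map Vb f)\<bar> \<le> \<bar>C\<bar> + \<beta> M * F0 x"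
proof -
  note d = trapD(1)[OF assms]
  have m: "mub \<in> prob_wt W0" using I_map_prob_wt[OF one_density W0_borel] W0_int by (simp add: I_map_one)
  have dist: "wt_dist W0 (I_map Vb f) mub \<le> cW * M + (\<integral>x. W0 x \<partial>mub)"
  proof -
    have "wt_dist W0 (I_map Vb f) mub \<le> (\<integral>x. \<bar>f x - 1\<bar> * W0 x \<partial>mub)"
      using wt_dist_bounds(1)[OF d one_density] by (simp add: I_map_one)
    also have "\<dots> \<le> (\<integral>x. f x * W0 x + W0 x \<partial>mub)"
    proof (rule integral_mono[OF abs_diff_int[OF d one_density]])
      show "integrable mub (\<lambda>x. f x * W0 x + W0 x)" using densitiesD(5)[OF d] W0_int by simp
      have "\<bar>f x - 1\<bar> * W0 x \<le> (f x + 1) * W0 x" for x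
        using densitiesD(2)[OF d, of x] W0_ge[of x] by (intro mult_right_mono) auto
      then show "\<bar>f x - 1\<bar> * W0 x \<le> f x * W0 x + W0 x" for x by (simp add: distrib_right)
    qed
    also have "\<dots> = (\<integral>x. f x * W0 x \<partial>mub) + (\<integral>x. W0 x \<partial>mub)" using densitiesD(5)[OF d] W0_int by simp
    also have "(\<integral>x. f x * W0 x \<partial>mub) \<le> cW * M"
      using trapD(8)[OF assms] unfolding wt_norm_def I_map_integral(2)[OF densitiesD(1,2)[OF d] W0_borel] .
    finally show ?thesis by simp
  qed
  have d0: "0 \<le> wt_dist W0 (I_map Vb f) mub" using wt_dist_bounds(2)[OF d one_density] by (simp add: I_map_one)
  have "F1 (wt_dist W0 (I_map Vb f) mub) \<le> F1 (cW * M + (\<integral>x. W0 x \<partial>mub))"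
    using d0 dist by (intro mono_onD[OF F1(2)]) auto
  then have "F0 x * F1 (wt_dist W0 (I_map Vb f) mub) \<le> F0 x * F1 (cW * M + (\<integral>x. W0 x \<partial>mub))"
    using F0_nonneg by (rule mult_left_mono)
  moreover have "C * (F0 x + 1) \<le> \<bar>C\<bar> * (F0 x + 1)" using F0_nonneg[of x] by (intro mult_right_mono) auto
  ultimately have "\<bar>V x (I_map Vb f)\<bar> \<le> F0 x * F1 (cW * M + (\<integral>x. W0 x \<partial>mub)) + \<bar>C\<bar> * (F0 x + 1)"
    using V_diff[OF trapD(5)[OF assms] m, of x] V_ref[of x] by linarith
  also have "\<dots> = \<bar>C\<bar> + \<beta> M * F0 x" by (simp add: \<beta>_def algebra_simps)
  finally show ?thesis .
qed

abbreviation "\<psi> f x \<equiv> psi V0 Vb V x (I_map Vb f)"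
abbreviation "T f \<equiv> T_hat V0 Vb V (I_map Vb f)"

text \<open>Stated for any number v inside the envelope, since it is also applied to limits of
  interactions that are not known to be the interaction of a measure.\<close>

lemma psi_upper_gen:
  assumes "0 \<le> M" "\<bar>v\<bar> \<le> \<bar>C\<bar> + \<beta> M * F0 x"
  shows "exp (- V0 x - v + Vb x) \<le> KK M" "lo M x \<le> exp (- V0 x - v + Vb x)"
proof -
  have "- V0 x + \<beta> M * F0 x \<le> - Vb x + F4 (\<beta> M)" by (rule F4(2)[OF \<beta>_nonneg[OF assms(1)]])
  moreover have "- v \<le> \<bar>C\<bar> + \<beta> M * F0 x" using assms(2) by linarith
  ultimately show "exp (- V0 x - v + Vb x) \<le> KK M" unfolding KK_def exp_le_cancel_iff by linarith
  have "v \<le> \<bar>C\<bar> + \<beta> M * F0 x" using assms(2) by linarith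
  then show "lo M x \<le> exp (- V0 x - v + Vb x)" unfolding lo_def exp_le_cancel_iff by linarith
qed

lemma c0_pos:
  assumes "0 \<le> M" shows "integrable mub (lo M)" "0 < c0 M"
proof -
  have [measurable]: "lo M \<in> borel_measurable borel" unfolding lo_def[abs_def] by measurable
  have "0 \<le> \<bar>C\<bar> + \<beta> M * F0 x" for x using \<beta>_nonneg[OF assms] F0_nonneg by simp
  then have le: "lo M x \<le> KK M" for x
    using psi_upper_gen[OF assms, of 0 x] by simp
  have lo0: "0 < lo M x" for x by (simp add: lo_def)
  show i: "integrable mub (lo M)"
    by (rule mub.integrable_const_bound[of _ "KK M"]) (use le lo0 in \<open>auto simp: less_imp_le\<close>)
  have "c0 M \<noteq> 0"
  proof
    assume "c0 M = 0"
    then have "AE x in mub. lo M x = 0"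
      unfolding c0_def using lo0 by (subst (asm) integral_nonneg_eq_0_iff_AE[OF i]) (auto simp: less_imp_le)
    then have "AE x in mub. False" using lo0 by (auto simp: less_le elim: eventually_mono)
    then show False using mub.AE_False by simp
  qed
  moreover have "0 \<le> c0 M" unfolding c0_def using lo0 by (intro Bochner_Integration.integral_nonneg) (simp add: less_imp_le)
  ultimately show "0 < c0 M" by simp
qed

lemma V_borel: "\<mu> \<in> prob_wt W0 \<Longrightarrow> (\<lambda>x. V x \<mu>) \<in> borel_measurable borel"
  using V_sob by (auto simp: sobolev_loc_def Lp_loc_def)

lemma gibbs_props:
  assumes M: "0 \<le> M" and v [measurable]: "v \<in> borel_measurable borel" and b: "AE x in lborel. \<bar>v x\<bar> \<le> \<bar>C\<bar> + \<beta> M * F0 x"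
  shows "integrable mub (\<lambda>x. exp (- V0 x - v x + Vb x))" "c0 M \<le> (\<integral>x. exp (- V0 x - v x + Vb x) \<partial>mub)"
proof -
  have "AE x in mub. exp (- V0 x - v x + Vb x) \<le> KK M \<and> lo M x \<le> exp (- V0 x - v x + Vb x)"
    by (rule AE_mub) (use b psi_upper_gen[OF M] in \<open>auto elim: eventually_mono\<close>)
  then have ae: "AE x in mub. exp (- V0 x - v x + Vb x) \<le> KK M" "AE x in mub. lo M x \<le> exp (- V0 x - v x + Vb x)" by auto
  show i: "integrable mub (\<lambda>x. exp (- V0 x - v x + Vb x))"
    by (rule mub.integrable_const_bound[of _ "KK M"]) (use ae in auto)
  show "c0 M \<le> (\<integral>x. exp (- V0 x - v x + Vb x) \<partial>mub)"
    unfolding c0_def by (rule integral_mono_AE[OF c0_pos(1)[OF M] i ae(2)])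
qed

lemma T_props:
  assumes f: "f \<in> trap M"
  shows "T f \<in> borel_measurable borel" "0 \<le> T f x" "T f x \<le> KK M / c0 M" "integrable mub (T f)" "(\<integral>x. T f x \<partial>mub) = 1"
    "0 < (\<integral>y. \<psi> f y \<partial>mub)" "\<psi> f x \<le> KK M"
proof -
  note M = trap_pos[OF f]
  have [measurable]: "(\<lambda>x. V x (I_map Vb f)) \<in> borel_measurable borel" by (rule V_borel[OF trapD(5)[OF f]])
  have g: "integrable mub (\<lambda>x. \<psi> f x)" "c0 M \<le> (\<integral>x. \<psi> f x \<partial>mub)"
    unfolding psi_def by (rule gibbs_props[OF M]; simp add: V_bound[OF f])+
  show P: "0 < (\<integral>y. \<psi> f y \<partial>mub)" using g(2) c0_pos(2)[OF M] by linarith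
  show "T f \<in> borel_measurable borel" unfolding T_hat_def[abs_def] psi_def by measurable
  show "0 \<le> T f x" unfolding T_hat_def using P by (simp add: psi_def)
  show pk: "\<psi> f x \<le> KK M" unfolding psi_def by (rule psi_upper_gen(1)[OF M V_bound[OF f]])
  show "T f x \<le> KK M / c0 M" unfolding T_hat_def
    using pk g(2) c0_pos(2)[OF M] by (intro frac_le) (auto simp: KK_def)
  show "integrable mub (T f)" unfolding T_hat_def[abs_def] using g(1) by simp
  show "(\<integral>x. T f x \<partial>mub) = 1" unfolding T_hat_def using P by simp
qed

section \<open>Continuity and compactness of the map\<close>

definition "M0 = density mub (\<lambda>x. ennreal (W0 x))"

lemma M0_integral:
  assumes "f \<in> borel_measurable borel"
  shows "integrable M0 f \<longleftrightarrow> integrable mub (\<lambda>x. f x * W0 x)" "(\<integral>x. f x \<partial>M0) = (\<integral>x. f x * W0 x \<partial>mub)"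
proof -
  have "0 \<le> W0 x" for x using W0_ge[of x] by simp
  then show "integrable M0 f \<longleftrightarrow> integrable mub (\<lambda>x. f x * W0 x)" "(\<integral>x. f x \<partial>M0) = (\<integral>x. f x * W0 x \<partial>mub)"
    using assms by (auto simp: M0_def integrable_density integral_density mult.commute)
qed

lemma sets_M0 [measurable_cong, simp]: "sets M0 = sets borel" and space_M0 [simp]: "space M0 = UNIV"
  by (simp_all add: M0_def)

lemma AE_M0: "AE x in lborel. P x \<Longrightarrow> AE x in M0. P x"
  unfolding M0_def by (subst AE_density) (auto intro: eventually_mono[OF AE_mub])

lemma one_M0: "integrable M0 (\<lambda>x. c :: real)"
  using W0_int by (subst M0_integral) auto

lemma T_density: "f \<in> trap M \<Longrightarrow> T f \<in> densities"
proof -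
  assume f: "f \<in> trap M"
  note [measurable] = T_props(1)[OF f]
  have "integrable mub (\<lambda>x. T f x * W0 x)"
  proof (rule Bochner_Integration.integrable_bound)
    show "integrable mub (\<lambda>x. KK M / c0 M * W0 x)" using W0_int by simp
    have "norm (T f x * W0 x) \<le> norm (KK M / c0 M * W0 x)" for x
    proof -
      have "T f x * W0 x \<le> KK M / c0 M * W0 x"
        using T_props(3)[OF f, of x] W0_ge[of x] by (intro mult_right_mono) auto
      moreover have "0 \<le> T f x * W0 x" using T_props(2)[OF f, of x] W0_ge[of x] by simp
      ultimately show ?thesis by (simp only: real_norm_def abs_of_nonneg order_trans)
    qed
    then show "AE x in mub. norm (T f x * W0 x) \<le> norm (KK M / c0 M * W0 x)" by simp
  qed measurable
  then show ?thesis using T_props[OF f] by (simp add: densities_def)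
qed

text \<open>The common core of continuity and compactness. The limit v inherits the envelope bound,
  the normalising constants converge and stay above c0 M, and the densities are bounded by KK M / c0
  M; as \<open>M0\<close> is finite, this constant is an integrable majorant.\<close>

lemma T_limit:
  assumes X: "\<And>k. X k \<in> trap M" and v [measurable]: "v \<in> borel_measurable borel"
    and lim: "AE x in lborel. (\<lambda>k. V x (I_map Vb (X k))) \<longlonglongrightarrow> v x"
  defines "y \<equiv> \<lambda>x. exp (- V0 x - v x + Vb x) / (\<integral>z. exp (- V0 z - v z + Vb z) \<partial>mub)"
  shows "(\<lambda>k. L1_dist M0 (T (X k)) y) \<longlonglongrightarrow> 0"
    and "y \<in> borel_measurable borel" "0 \<le> y x" "integrable mub y" "(\<integral>x. y x \<partial>mub) = 1"
    and "AE x in lborel. (\<lambda>k. T (X k) x) \<longlonglongrightarrow> y x"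
proof -
  note M = trap_pos[OF X]
  define Y where "Y x = exp (- V0 x - v x + Vb x)" for x
  have y: "y x = Y x / (\<integral>z. Y z \<partial>mub)" for x by (simp add: y_def Y_def)
  have [measurable]: "Y \<in> borel_measurable borel" unfolding Y_def[abs_def] by measurable
  have vb: "AE x in lborel. \<bar>v x\<bar> \<le> \<bar>C\<bar> + \<beta> M * F0 x"
    using lim
  proof eventually_elim
    case (elim x)
    show ?case by (rule LIMSEQ_le_const2[OF tendsto_rabs[OF elim]]) (use V_bound[OF X] in auto)
  qed
  note g = gibbs_props[OF M v vb, folded Y_def]
  have P: "0 < (\<integral>z. Y z \<partial>mub)" using g(2) c0_pos(2)[OF M] by linarith
  show yb: "y \<in> borel_measurable borel" unfolding y[abs_def] by measurable
  show "0 \<le> y x" for x unfolding y using P by (simp add: Y_def)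
  show "integrable mub y" unfolding y[abs_def] using g(1) by simp
  show "(\<integral>x. y x \<partial>mub) = 1" unfolding y using P by simp
  have pl: "AE x in lborel. (\<lambda>k. \<psi> (X k) x) \<longlonglongrightarrow> Y x"
    using lim by eventually_elim (auto simp: psi_def Y_def intro!: tendsto_intros)
  have [measurable]: "(\<lambda>x. V x (I_map Vb (X k))) \<in> borel_measurable borel" for k by (rule V_borel[OF trapD(5)[OF X]])
  have [measurable]: "(\<lambda>x. \<psi> (X k) x) \<in> borel_measurable borel" for k unfolding psi_def by measurable
  have "(\<lambda>k. \<integral>x. \<psi> (X k) x \<partial>mub) \<longlonglongrightarrow> (\<integral>x. Y x \<partial>mub)"
  proof (rule integral_dominated_convergence[where w = "\<lambda>x. KK M"])
    show "AE x in mub. (\<lambda>k. \<psi> (X k) x) \<longlonglongrightarrow> Y x" by (rule AE_mub[OF pl])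
    show "AE x in mub. norm (\<psi> (X k) x) \<le> KK M" for k using T_props(7)[OF X] by (intro AE_I2) (simp add: psi_def)
  qed simp_all
  note il = this
  show tl: "AE x in lborel. (\<lambda>k. T (X k) x) \<longlonglongrightarrow> y x"
    using pl unfolding T_hat_def y by eventually_elim (use P in \<open>auto intro!: tendsto_intros il\<close>)
  have yB: "AE x in lborel. \<bar>y x\<bar> \<le> KK M / c0 M"
    using tl
  proof eventually_elim
    case (elim x)
    show ?case by (rule LIMSEQ_le_const2[OF tendsto_rabs[OF elim]]) (use T_props(2,3)[OF X] in auto)
  qed
  note [measurable] = T_props(1)[OF X]
  have "(\<lambda>k. \<integral>x. \<bar>T (X k) x - y x\<bar> \<partial>M0) \<longlonglongrightarrow> (\<integral>x. 0 \<partial>M0)"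
  proof (rule integral_dominated_convergence[where w = "\<lambda>x. 2 * (KK M / c0 M)"])
    show "AE x in M0. (\<lambda>k. \<bar>T (X k) x - y x\<bar>) \<longlonglongrightarrow> 0"
      using AE_M0[OF tl] by eventually_elim (auto intro!: tendsto_rabs_zero simp: LIM_zero_iff)
    show "AE x in M0. norm \<bar>T (X k) x - y x\<bar> \<le> 2 * (KK M / c0 M)" for k
      using AE_M0[OF yB]
    proof eventually_elim
      case (elim x)
      then show ?case using T_props(2,3)[OF X, of k x] unfolding real_norm_def by linarith
    qed
  qed (use one_M0 yb in \<open>auto simp: measurable_cong_sets[OF sets_M0 refl]\<close>)
  then show "(\<lambda>k. L1_dist M0 (T (X k)) y) \<longlonglongrightarrow> 0" by (simp add: L1_dist_def)
qed

lemma T_continuous: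
  assumes X: "\<And>k. X k \<in> trap M" and z: "z \<in> trap M" and d: "(\<lambda>k. L1_dist M0 (X k) z) \<longlonglongrightarrow> 0"
  shows "(\<lambda>k. L1_dist M0 (T (X k)) (T z)) \<longlonglongrightarrow> 0"
proof -
  note dX = trapD(1)[OF X] and dz = trapD(1)[OF z]
  define \<delta> where "\<delta> k = wt_dist W0 (I_map Vb (X k)) (I_map Vb z)" for k
  have \<delta>0: "0 \<le> \<delta> k" for k unfolding \<delta>_def by (rule wt_dist_bounds(2)[OF dX dz])
  have "\<delta> k \<le> L1_dist M0 (X k) z" for k
  proof -
    note [measurable] = densitiesD(1)[OF dX] densitiesD(1)[OF dz]
    have "L1_dist M0 (X k) z = (\<integral>x. \<bar>X k x - z x\<bar> * W0 x \<partial>mub)"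
      unfolding L1_dist_def by (rule M0_integral(2)) measurable
    then show ?thesis unfolding \<delta>_def using wt_dist_bounds(1)[OF dX dz] by simp
  qed
  then have \<delta>l: "\<delta> \<longlonglongrightarrow> 0" using \<delta>0 by (intro tendsto_sandwich[OF _ _ tendsto_const d]) auto
  \<comment> \<open>The distances may be 0, where the limit from the right gives no direct
    information. Monotonicity covers this case too, by comparison with the value at b / 2.\<close>
  have Fl: "(\<lambda>k. F1 (\<delta> k)) \<longlonglongrightarrow> 0"
  proof (rule LIMSEQ_I)
    fix e :: real assume e: "0 < e"
    have "eventually (\<lambda>r. F1 r < e) (at_right 0)" using e by (intro order_tendstoD(2)[OF F1(3)])
    then obtain b where b: "0 < b" "\<And>r. 0 < r \<Longrightarrow> r < b \<Longrightarrow> F1 r < e" unfolding eventually_at_right_field by auto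
    have "eventually (\<lambda>k. \<delta> k < b / 2) sequentially" using b(1) by (intro order_tendstoD(2)[OF \<delta>l]) simp
    then obtain N where N: "\<And>k. N \<le> k \<Longrightarrow> \<delta> k < b / 2" unfolding eventually_sequentially by auto
    have "norm (F1 (\<delta> k) - 0) < e" if "N \<le> k" for k
    proof -
      have "F1 (\<delta> k) \<le> F1 (b / 2)" using N[OF that] \<delta>0[of k] b(1) by (intro mono_onD[OF F1(2)]) auto
      also have "\<dots> < e" using b by simp
      finally show ?thesis using F1(1)[OF \<delta>0, of k] by simp
    qed
    then show "\<exists>N. \<forall>k\<ge>N. norm (F1 (\<delta> k) - 0) < e" by blast
  qed
  have lim: "(\<lambda>k. V x (I_map Vb (X k))) \<longlonglongrightarrow> V x (I_map Vb z)" for x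
  proof -
    have "(\<lambda>k. F0 x * F1 (\<delta> k)) \<longlonglongrightarrow> F0 x * 0" by (intro tendsto_intros Fl)
    then have "(\<lambda>k. F0 x * F1 (\<delta> k)) \<longlonglongrightarrow> 0" by simp
    moreover have "eventually (\<lambda>k. norm (V x (I_map Vb (X k)) - V x (I_map Vb z)) \<le> F0 x * F1 (\<delta> k)) sequentially"
      using V_diff[OF trapD(5)[OF X] trapD(5)[OF z]] by (intro always_eventually) (simp add: \<delta>_def)
    ultimately have "(\<lambda>k. V x (I_map Vb (X k)) - V x (I_map Vb z)) \<longlonglongrightarrow> 0" by (rule Lim_null_comparison[rotated])
    then show ?thesis by (simp add: LIM_zero_iff)
  qed
  have "T z = (\<lambda>x. exp (- V0 x - V x (I_map Vb z) + Vb x) / (\<integral>u. exp (- V0 u - V u (I_map Vb z) + Vb u) \<partial>mub))"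
    unfolding T_hat_def[abs_def] psi_def ..
  then show ?thesis using T_limit(1)[OF X V_borel[OF trapD(5)[OF z]] AE_I2[OF lim]] by simp
qed

lemma weak_grad_inner: "i \<in> Basis \<Longrightarrow> weak_grad f x \<bullet> i = weak_deriv [i] f x"
  unfolding weak_grad_def by (simp add: inner_sum_left inner_Basis if_distrib cong: if_cong)

lemma V_deriv:
  assumes \<mu>: "\<mu> \<in> prob_wt W0" and i: "i \<in> Basis"
  shows "has_weak_deriv (\<lambda>x. V x \<mu>) [i] (weak_deriv [i] (\<lambda>x. V x \<mu>))"
    and "AE x in lborel. \<bar>weak_deriv [i] (\<lambda>x. V x \<mu>) x\<bar> \<le> F2 x * F3 (wt_norm W0 \<mu>)"
proof -
  have "\<forall>is. set is \<subseteq> Basis \<and> length is \<in> {1..1} \<longrightarrow> (\<exists>g. has_weak_deriv (\<lambda>x. V x \<mu>) is g \<and> g \<in> Lp_loc p)"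
    using V_sob[OF \<mu>] by (simp add: sobolev_loc_def)
  from this[rule_format, of "[i]"] have "\<exists>g. has_weak_deriv (\<lambda>x. V x \<mu>) [i] g" using i by auto
  then show "has_weak_deriv (\<lambda>x. V x \<mu>) [i] (weak_deriv [i] (\<lambda>x. V x \<mu>))"
    unfolding weak_deriv_def by (rule someI_ex)
  show "AE x in lborel. \<bar>weak_deriv [i] (\<lambda>x. V x \<mu>) x\<bar> \<le> F2 x * F3 (wt_norm W0 \<mu>)"
    using V_grad[OF \<mu>]
  proof eventually_elim
    case (elim x)
    have "\<bar>weak_deriv [i] (\<lambda>x. V x \<mu>) x\<bar> \<le> norm (weak_grad (\<lambda>y. V y \<mu>) x)"
      using Basis_le_norm[OF i, of "weak_grad (\<lambda>y. V y \<mu>) x"] by (simp add: weak_grad_inner[OF i])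
    then show ?case using elim by simp
  qed
qed

text \<open>The local bounds come from the envelope |C| + \<beta> M F0 and from F2 F3(cW M), both
  independent of the member of the sequence. The limit y is built from the limit v of the
  interactions, so its membership in the level set has to be proved separately.\<close>

lemma T_compact:
  assumes X: "\<And>k. X k \<in> trap M" and TX: "\<And>f. f \<in> trap M \<Longrightarrow> T f \<in> trap M"
  shows "\<exists>r y. strict_mono (r :: nat \<Rightarrow> nat) \<and> y \<in> trap M \<and> (\<lambda>k. L1_dist M0 (T (X (r k))) y) \<longlonglongrightarrow> 0"
proof -
  note M = trap_pos[OF X]
  define u where "u n = (\<lambda>x. V x (I_map Vb (X n)))" for n
  have [measurable]: "u n \<in> borel_measurable borel" for n unfolding u_def by (rule V_borel[OF trapD(5)[OF X]])
  have "\<exists>r. strict_mono (r :: nat \<Rightarrow> nat) \<and> (AE x in lborel. convergent (\<lambda>k. u (r k) x))"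
  proof (rule sobolev_compact)
    show "has_weak_deriv (u n) [i] (weak_deriv [i] (u n))" if "i \<in> Basis" for n i
      unfolding u_def by (rule V_deriv(1)[OF trapD(5)[OF X] that])
    show "loc_int (\<lambda>x. F3 (cW * M) * F2 x)" by (intro loc_int_cmult Lp_loc_loc_int[OF F2(3) p_ge])
    show "AE x in lborel. \<bar>weak_deriv [i] (u n) x\<bar> \<le> \<bar>F3 (cW * M) * F2 x\<bar>" if "i \<in> Basis" for n i
      using V_deriv(2)[OF trapD(5)[OF X] that, of n]
    proof eventually_elim
      case (elim x)
      have "F3 (wt_norm W0 (I_map Vb (X n))) \<le> F3 (cW * M)"
        using trapD(8,9)[OF X, of n] by (intro mono_onD[OF F3(2)]) auto
      then have "F2 x * F3 (wt_norm W0 (I_map Vb (X n))) \<le> F2 x * F3 (cW * M)" using F2(1) by (rule mult_left_mono)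
      then show ?case using elim unfolding u_def by (simp add: mult.commute)
    qed
    have "loc_int F0" by (rule Lp_loc_loc_int[OF F0_loc]) simp
    moreover have "loc_int (\<lambda>x::'a. \<bar>C\<bar>)" by (rule loc_int_bounded[of _ "\<bar>C\<bar>"]) auto
    ultimately show "loc_int (\<lambda>x. \<bar>C\<bar> + \<beta> M * F0 x)" by (intro loc_int_add loc_int_cmult)
    show "AE x in lborel. \<bar>u n x\<bar> \<le> \<bar>\<bar>C\<bar> + \<beta> M * F0 x\<bar>" for n
      unfolding u_def by (rule AE_I2) (rule order_trans[OF V_bound[OF X] abs_ge_self])
  qed
  then obtain r where r: "strict_mono r" and rc: "AE x in lborel. convergent (\<lambda>k. u (r k) x)" by blast
  \<comment> \<open>Where the sequence diverges, \<open>lim\<close> is some unspecified value; this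
    happens only on a null set.\<close>
  define v where "v x = lim (\<lambda>k. u (r k) x)" for x
  have [measurable]: "v \<in> borel_measurable borel" unfolding v_def[abs_def] by measurable
  have vl: "AE x in lborel. (\<lambda>k. V x (I_map Vb (X (r k)))) \<longlonglongrightarrow> v x"
    using rc by eventually_elim (simp add: v_def convergent_LIMSEQ_iff u_def)
  define y where "y x = exp (- V0 x - v x + Vb x) / (\<integral>z. exp (- V0 z - v z + Vb z) \<partial>mub)" for x
  note L = T_limit[of "\<lambda>k. X (r k)" M v, OF X _ vl, folded y_def]
  have L': "(\<lambda>k. L1_dist M0 (T (X (r k))) y) \<longlonglongrightarrow> 0" "y \<in> borel_measurable borel" "\<And>x. 0 \<le> y x" "integrable mub y" "(\<integral>x. y x \<partial>mub) = 1"
    "AE x in lborel. (\<lambda>k. T (X (r k)) x) \<longlonglongrightarrow> y x"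
    using L unfolding y_def[abs_def] by simp_all
  note [measurable] = L'(2) T_props(1)[OF X]
  note tr = trapD[OF TX[OF X]]
  \<comment> \<open>Convergence in L^1(W0 mub) says nothing about the W moment, but the images
    satisfy the moment bound by \<open>TX\<close>, and Fatou's lemma hands it to their almost
    everywhere limit.\<close>
  have nn: "(\<integral>\<^sup>+x. ennreal (y x * W x) \<partial>mub) \<le> ennreal M"
  proof -
    have "(\<integral>\<^sup>+x. ennreal (y x * W x) \<partial>mub) = (\<integral>\<^sup>+x. liminf (\<lambda>k. ennreal (T (X (r k)) x * W x)) \<partial>mub)"
    proof (rule nn_integral_cong_AE)
      show "AE x in mub. ennreal (y x * W x) = liminf (\<lambda>k. ennreal (T (X (r k)) x * W x))"
        using AE_mub[OF L'(6)]
      proof eventually_elim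
        case (elim x)
        have "(\<lambda>k. ennreal (T (X (r k)) x * W x)) \<longlonglongrightarrow> ennreal (y x * W x)"
          by (intro tendsto_ennrealI tendsto_intros elim)
        then show ?case by (simp add: lim_imp_Liminf)
      qed
    qed
    also have "\<dots> \<le> liminf (\<lambda>k. \<integral>\<^sup>+x. ennreal (T (X (r k)) x * W x) \<partial>mub)" by (rule nn_integral_liminf) measurable
    also have "\<dots> \<le> liminf (\<lambda>k. ennreal M)"
    proof (rule Liminf_mono, rule always_eventually, rule allI)
      fix k
      have "0 \<le> T (X (r k)) x * W x" for x using T_props(2)[OF X, of "r k" x] W_ge[of x] by simp
      then have "(\<integral>\<^sup>+x. ennreal (T (X (r k)) x * W x) \<partial>mub) = ennreal (\<integral>x. T (X (r k)) x * W x \<partial>mub)"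
        by (intro nn_integral_eq_integral tr) auto
      then show "(\<integral>\<^sup>+x. ennreal (T (X (r k)) x * W x) \<partial>mub) \<le> ennreal M" using tr(3)[of "r k"] by (simp add: ennreal_leI)
    qed
    also have "\<dots> = ennreal M" by (simp add: Liminf_const)
    finally show ?thesis .
  qed
  have yW: "0 \<le> y x * W x" for x using L'(3)[of x] W_ge[of x] by simp
  have i: "integrable mub (\<lambda>x. y x * W x)"
    unfolding integrable_iff_bounded using nn yW by (auto intro: le_less_trans)
  have "ennreal (\<integral>x. y x * W x \<partial>mub) \<le> ennreal M"
    using nn nn_integral_eq_integral[OF i] yW by simp
  then have "(\<integral>x. y x * W x \<partial>mub) \<le> M" using M by (simp add: ennreal_le_iff)
  then have "y \<in> trap M" by (intro trapI L' i)
  then show ?thesis using r L'(1) by blast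
qed

text \<open>The definitions give the weighted and the local integrability of the derivatives through
  possibly different representatives, so the two properties are kept apart here and in the
  regularity proof.\<close>

lemma V0_deriv:
  assumes "i \<in> Basis"
  shows "\<exists>g. has_weak_deriv V0 [i] g \<and> g \<in> Lp mub (ennreal q)" "\<exists>g. has_weak_deriv V0 [i] g \<and> g \<in> Lp_loc p"
    and Vb_deriv: "\<exists>g. has_weak_deriv Vb [i] g \<and> g \<in> Lp mub (ennreal q)" "\<exists>g. has_weak_deriv Vb [i] g \<and> g \<in> Lp_loc p"
proof -
  have "V0 \<in> sobolev_wt 1 p (ennreal q) mub" "Vb \<in> sobolev_wt 1 p (ennreal q) mub" using H1 by (auto simp: H1_def)
  moreover have "set [i] \<subseteq> Basis \<and> length [i] \<in> {1..1}" using assms by simp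
  ultimately show "\<exists>g. has_weak_deriv V0 [i] g \<and> g \<in> Lp mub (ennreal q)" "\<exists>g. has_weak_deriv V0 [i] g \<and> g \<in> Lp_loc p"
    "\<exists>g. has_weak_deriv Vb [i] g \<and> g \<in> Lp mub (ennreal q)" "\<exists>g. has_weak_deriv Vb [i] g \<and> g \<in> Lp_loc p"
    unfolding sobolev_wt_def sobolev_loc_def mem_Collect_eq by blast+
qed

lemma W1_deriv:
  assumes "i \<in> Basis"
  shows "\<exists>g. has_weak_deriv W1 [i] g \<and> g \<in> Lp mub p1" "\<exists>h. has_weak_deriv W1 [i, i] h \<and> h \<in> Lp mub p1"
proof -
  have "set [i] \<subseteq> Basis \<and> length [i] \<in> {1..2}" "set [i, i] \<subseteq> Basis \<and> length [i, i] \<in> {1..2}" using assms by simp_all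
  then show "\<exists>g. has_weak_deriv W1 [i] g \<and> g \<in> Lp mub p1" "\<exists>h. has_weak_deriv W1 [i, i] h \<and> h \<in> Lp mub p1"
    using W1_sob unfolding sobolev_wt_def mem_Collect_eq by blast+
qed

lemma p1_ge: "1 \<le> p1"
proof -
  have "1 \<le> conj_exponent q"
  proof (cases "q = 1")
    case False
    then have "1 \<le> q / (q - 1)" using q1 by (simp add: field_simps)
    then have "ennreal 1 \<le> ennreal (q / (q - 1))" by (rule ennreal_leI)
    then show ?thesis using False by (simp add: conj_exponent_def)
  qed (simp add: conj_exponent_def)
  then show ?thesis using p1 by (rule order_trans)
qed

lemma V_deriv_Lp:
  assumes "\<mu> \<in> prob_wt W0" "i \<in> Basis"
  shows "weak_deriv [i] (\<lambda>x. V x \<mu>) \<in> Lp mub (ennreal q)" "weak_deriv [i] (\<lambda>x. V x \<mu>) \<in> Lp_loc p"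
proof -
  have b: "weak_deriv [i] (\<lambda>x. V x \<mu>) \<in> borel_measurable borel"
    using has_weak_deriv_loc_int[OF V_deriv(1)[OF assms]] loc_int_borel by blast
  have "0 \<le> wt_norm W0 \<mu>" unfolding wt_norm_def
    by (rule Bochner_Integration.integral_nonneg) (meson W0_ge order_trans zero_le_one)
  then have F3n: "0 \<le> F3 (wt_norm W0 \<mu>)" by (rule F3(1))
  have ae: "AE x in lborel. \<bar>weak_deriv [i] (\<lambda>x. V x \<mu>) x\<bar> \<le> F3 (wt_norm W0 \<mu>) * \<bar>F2 x\<bar>"
    using V_deriv(2)[OF assms] by eventually_elim (use F2(1) in \<open>simp add: mult.commute\<close>)
  show "weak_deriv [i] (\<lambda>x. V x \<mu>) \<in> Lp mub (ennreal q)"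
    by (rule Lp_mono[OF F2(2) _ AE_mub[OF ae] F3n]) (use b in simp)
  show "weak_deriv [i] (\<lambda>x. V x \<mu>) \<in> Lp_loc p"
    by (rule Lp_loc_mono[OF F2(3) b ae F3n])
qed

end

lemma has_weak_deriv_weak_deriv: "has_weak_deriv u is g \<Longrightarrow> has_weak_deriv u is (weak_deriv is u)"
  unfolding weak_deriv_def by (rule someI[where P = "has_weak_deriv u is"])

context mckean_vlasov begin

section \<open>Stationarity of the Gibbs measure for the generator\<close>

lemma T_mult_integrable:
  assumes f: "f \<in> trap M" and k: "integrable mub k"
  shows "integrable mub (\<lambda>x. T f x * k x)"
proof (rule Bochner_Integration.integrable_bound)
  note [measurable] = T_props(1)[OF f] borel_measurable_integrable[OF k]
  show "integrable mub (\<lambda>x. (KK M / c0 M) * k x)" using k by simp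
  have "norm (T f x * k x) \<le> norm ((KK M / c0 M) * k x)" for x
  proof -
    have "\<bar>T f x\<bar> \<le> \<bar>KK M / c0 M\<bar>" using T_props(2,3)[OF f, of x] by linarith
    then have "\<bar>T f x\<bar> * \<bar>k x\<bar> \<le> \<bar>KK M / c0 M\<bar> * \<bar>k x\<bar>" by (rule mult_right_mono) simp
    then show ?thesis by (simp only: real_norm_def abs_mult)
  qed
  then show "AE x in mub. norm (T f x * k x) \<le> norm ((KK M / c0 M) * k x)" by simp
  show "(\<lambda>x. T f x * k x) \<in> borel_measurable mub" by measurable
qed

text \<open>With respect to Lebesgue measure, exp(-V0 - V) L W1 is the divergence of exp(-V0 - V)
  times the gradient of W1, and it is integrated one coordinate at a time. Derivatives of W1 are
  integrable since p1 >= 1, their products with the drift by Hoelder's inequality, and boundedness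
  of T f carries all this over from the reference measure.\<close>

lemma T_generator_zero:
  assumes f: "f \<in> trap M"
  defines "\<mu> \<equiv> I_map Vb f"
  shows "integrable mub (L_op V0 V \<mu> W1)" "integrable mub (\<lambda>x. T f x * L_op V0 V \<mu> W1 x)" "(\<integral>x. T f x * L_op V0 V \<mu> W1 x \<partial>mub) = 0"
proof -
  have \<mu>: "\<mu> \<in> prob_wt W0" unfolding \<mu>_def by (rule trapD(5)[OF f])
  have [measurable]: "(\<lambda>x. V x \<mu>) \<in> borel_measurable borel" by (rule V_borel[OF \<mu>])
  obtain v where v: "\<And>i. i \<in> Basis \<Longrightarrow> has_weak_deriv V0 [i] (v i) \<and> v i \<in> Lp mub (ennreal q)"
    using V0_deriv(1) by metis
  obtain g where g: "\<And>i. i \<in> Basis \<Longrightarrow> has_weak_deriv W1 [i] (g i) \<and> g i \<in> Lp mub p1" using W1_deriv(1) by metis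
  obtain h where h: "\<And>i. i \<in> Basis \<Longrightarrow> has_weak_deriv W1 [i, i] (h i) \<and> h i \<in> Lp mub p1" using W1_deriv(2) by metis
  define s where "s i x = v i x + weak_deriv [i] (\<lambda>x. V x \<mu>) x" for i x
  define w where "w x = (- 1) * (V0 x + V x \<mu>)" for x
  define d where "d i x = (- 1) * s i x" for i x
  have sw: "has_weak_deriv (\<lambda>x. V0 x + V x \<mu>) [i] (s i)" if "i \<in> Basis" for i
    unfolding s_def[abs_def] using v[OF that] by (intro has_weak_deriv_add V_deriv \<mu> that) auto
  have dw: "has_weak_deriv w [i] (d i)" if "i \<in> Basis" for i
    unfolding w_def[abs_def] d_def[abs_def] by (rule has_weak_deriv_cmult[OF sw[OF that]])
  have dL: "d i \<in> Lp mub (ennreal q)" if "i \<in> Basis" for i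
    unfolding d_def[abs_def] s_def[abs_def] using v[OF that] by (intro Lp_cmult Lp_add V_deriv_Lp \<mu> that) auto
  have gh: "has_weak_deriv (g i) [i] (h i)" if "i \<in> Basis" for i
    by (rule has_weak_deriv_second[OF conjunct1[OF g[OF that]] conjunct1[OF h[OF that]] that])
  have fin: "finite_measure mub" by (rule mub.finite_measure_axioms)
  have i1: "integrable mub (g i)" "integrable mub (h i)" "integrable mub (\<lambda>x. d i x * g i x)" if "i \<in> Basis" for i
    by (rule Lp_integrable[OF fin conjunct2[OF g[OF that]] p1_ge], rule Lp_integrable[OF fin conjunct2[OF h[OF that]] p1_ge],
      rule Lp_conj_mult_integrable[OF fin dL[OF that] conjunct2[OF g[OF that]] q1 p1])
  have mb: "g i \<in> borel_measurable borel" "h i \<in> borel_measurable borel" "d i \<in> borel_measurable borel" if "i \<in> Basis" for i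
    using has_weak_deriv_loc_int[OF gh[OF that]] has_weak_deriv_loc_int[OF dw[OF that]] by (auto simp: loc_int_borel)
  have [measurable]: "w \<in> borel_measurable borel" unfolding w_def[abs_def] by measurable
  define N where "N = (\<integral>y. \<psi> f y \<partial>mub)"
  have N: "0 < N" unfolding N_def by (rule T_props(6)[OF f])
  have psi_w: "\<psi> f x = exp (w x) * exp (Vb x)" for x
    unfolding psi_def w_def \<mu>_def exp_add[symmetric] by simp
  \<comment> \<open>The factor exp(Vb) in \<psi> cancels the reference density, leaving exp(w) with
    w = -(V0 + V) up to a constant.\<close>
  have Tw: "exp (- Vb x) / Z * T f x = exp (w x) / (Z * N)" for x
  proof -
    have "T f x = exp (w x) * exp (Vb x) / N" unfolding T_hat_def N_def[symmetric] by (simp only: psi_w)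
    then show ?thesis by (simp add: exp_minus field_simps)
  qed
  have tr: "integrable lborel (\<lambda>x. k x * exp (w x))" "integrable mub (\<lambda>x. T f x * k x)"
    "(\<integral>x. T f x * k x \<partial>mub) = (\<integral>x. k x * exp (w x) \<partial>lborel) / (Z * N)"
    if k: "integrable mub k" and kb: "k \<in> borel_measurable borel" for k :: "'a \<Rightarrow> real"
  proof -
    note [measurable] = kb T_props(1)[OF f]
    show i: "integrable mub (\<lambda>x. T f x * k x)" by (rule T_mult_integrable[OF f k])
    have e: "exp (- Vb x) / Z * (T f x * k x) = k x * exp (w x) / (Z * N)" for x
      using Tw[of x] by (simp only: mult.assoc[symmetric]) simp
    have m: "(\<lambda>x. T f x * k x) \<in> borel_measurable borel" by measurable
    have "integrable lborel (\<lambda>x. k x * exp (w x) / (Z * N))" using i integrable_mub[OF m] unfolding e by simp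
    then have "integrable lborel (\<lambda>x. (Z * N) * (k x * exp (w x) / (Z * N)))" by (rule integrable_mult_right)
    then show "integrable lborel (\<lambda>x. k x * exp (w x))" using N Z_pos by simp
    show "(\<integral>x. T f x * k x \<partial>mub) = (\<integral>x. k x * exp (w x) \<partial>lborel) / (Z * N)"
      unfolding integral_mub[OF m] e by simp
  qed
  have zero: "(\<integral>x. T f x * (h i x + d i x * g i x) \<partial>mub) = 0" and ihd: "integrable mub (\<lambda>x. h i x + d i x * g i x)" if i: "i \<in> Basis" for i
  proof -
    note [measurable] = mb[OF i]
    show ii: "integrable mub (\<lambda>x. h i x + d i x * g i x)" using i1[OF i] by simp
    have j: "integrable lborel (\<lambda>x. g i x * exp (w x))" "integrable lborel (\<lambda>x. h i x * exp (w x))" "integrable lborel (\<lambda>x. d i x * g i x * exp (w x))"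
      by (rule tr(1)[OF i1(1)[OF i]], measurable, rule tr(1)[OF i1(2)[OF i]], measurable, rule tr(1)[OF i1(3)[OF i]], measurable)
    have "(\<integral>x. (h i x + d i x * g i x) * exp (w x) \<partial>lborel) = (\<integral>x. h i x * exp (w x) \<partial>lborel) + (\<integral>x. d i x * g i x * exp (w x) \<partial>lborel)"
      unfolding distrib_right by (rule Bochner_Integration.integral_add[OF j(2,3)])
    also have "\<dots> = 0" by (rule integral_weighted_divergence_zero[OF gh[OF i] dw[OF i] i j])
    finally show "(\<integral>x. T f x * (h i x + d i x * g i x) \<partial>mub) = 0" by (subst tr(3)[OF ii]) simp_all
  qed
  define lf where "lf x = (\<Sum>i\<in>Basis. h i x + d i x * g i x)" for x
  have [measurable]: "lf \<in> borel_measurable borel" unfolding lf_def[abs_def] using mb by (intro borel_measurable_sum borel_measurable_add borel_measurable_times)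
  have lfi: "integrable mub lf" unfolding lf_def[abs_def] by (rule Bochner_Integration.integrable_sum[OF ihd])
  have lfz: "(\<integral>x. T f x * lf x \<partial>mub) = 0"
  proof -
    have "(\<integral>x. T f x * lf x \<partial>mub) = (\<Sum>i\<in>Basis. \<integral>x. T f x * (h i x + d i x * g i x) \<partial>mub)"
      unfolding lf_def sum_distrib_left
      by (rule Bochner_Integration.integral_sum) (use tr(2)[OF ihd] mb in \<open>auto intro!: borel_measurable_add borel_measurable_times\<close>)
    then show ?thesis using zero by simp
  qed
  have w1: "has_weak_deriv W1 [i] (weak_deriv [i] W1)" "has_weak_deriv W1 [i, i] (weak_deriv [i, i] W1)"
    "has_weak_deriv (\<lambda>x. V0 x + V x \<mu>) [i] (weak_deriv [i] (\<lambda>x. V0 x + V x \<mu>))" if "i \<in> Basis" for i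
    by (rule has_weak_deriv_weak_deriv[OF conjunct1[OF g[OF that]]], rule has_weak_deriv_weak_deriv[OF conjunct1[OF h[OF that]]],
      rule has_weak_deriv_weak_deriv[OF sw[OF that]])
  \<comment> \<open>The generator is built from the representatives chosen by
    \<open>weak_deriv\<close>, while integrability is known for g, h and v. Uniqueness identifies
    the two outside finitely many null sets.\<close>
  have AEs: "AE x in lborel. \<forall>i\<in>Basis. weak_deriv [i] W1 x = g i x \<and> weak_deriv [i, i] W1 x = h i x \<and> weak_deriv [i] (\<lambda>x. V0 x + V x \<mu>) x = s i x"
  proof (rule AE_finite_allI[OF finite_Basis])
    fix i :: 'a assume i: "i \<in> Basis"
    have "AE x in lborel. weak_deriv [i] W1 x = g i x" "AE x in lborel. weak_deriv [i, i] W1 x = h i x"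
      "AE x in lborel. weak_deriv [i] (\<lambda>x. V0 x + V x \<mu>) x = s i x"
      using has_weak_deriv_unique[OF w1(1)[OF i] conjunct1[OF g[OF i]]] has_weak_deriv_unique[OF w1(2)[OF i] conjunct1[OF h[OF i]]]
        has_weak_deriv_unique[OF w1(3)[OF i] sw[OF i]] by this
    then show "AE x in lborel. weak_deriv [i] W1 x = g i x \<and> weak_deriv [i, i] W1 x = h i x \<and> weak_deriv [i] (\<lambda>x. V0 x + V x \<mu>) x = s i x"
      by eventually_elim simp
  qed
  have L: "AE x in lborel. L_op V0 V \<mu> W1 x = lf x"
    using AEs
  proof eventually_elim
    case (elim x)
    have "weak_grad (\<lambda>y. V0 y + V y \<mu>) x \<bullet> weak_grad W1 x
        = (\<Sum>i\<in>Basis. (weak_grad (\<lambda>y. V0 y + V y \<mu>) x \<bullet> i) * (weak_grad W1 x \<bullet> i))"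
      by (rule euclidean_inner)
    also have "\<dots> = (\<Sum>i\<in>Basis. s i x * g i x)" using elim by (intro sum.cong) (auto simp: weak_grad_inner)
    finally have "weak_grad (\<lambda>y. V0 y + V y \<mu>) x \<bullet> weak_grad W1 x = (\<Sum>i\<in>Basis. s i x * g i x)" .
    moreover have "weak_laplace W1 x = (\<Sum>i\<in>Basis. h i x)" unfolding weak_laplace_def using elim by (intro sum.cong) auto
    ultimately show ?case unfolding L_op_def lf_def by (simp add: d_def sum_subtractf)
  qed
  have Lm: "L_op V0 V \<mu> W1 \<in> borel_measurable borel"
  proof -
    have wm: "weak_deriv [i] W1 \<in> borel_measurable borel" "weak_deriv [i, i] W1 \<in> borel_measurable borel"
      "weak_deriv [i] (\<lambda>x. V0 x + V x \<mu>) \<in> borel_measurable borel" if "i \<in> Basis" for i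
      by (rule loc_int_borel[OF conjunct2[OF has_weak_deriv_loc_int[OF w1(1)[OF that]]]],
        rule loc_int_borel[OF conjunct2[OF has_weak_deriv_loc_int[OF w1(2)[OF that]]]],
        rule loc_int_borel[OF conjunct2[OF has_weak_deriv_loc_int[OF w1(3)[OF that]]]])
    show ?thesis
      unfolding L_op_def[abs_def] weak_laplace_def weak_grad_def
      by (intro borel_measurable_diff borel_measurable_sum borel_measurable_inner borel_measurable_scaleR wm measurable_const) auto
  qed
  note [measurable] = Lm T_props(1)[OF f]
  show Li: "integrable mub (L_op V0 V \<mu> W1)"
    by (subst integrable_cong_AE[OF _ _ AE_mub[OF L]]) (use lfi in simp_all)
  show "integrable mub (\<lambda>x. T f x * L_op V0 V \<mu> W1 x)" by (rule tr(2)[OF Li Lm])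
  have "(\<integral>x. T f x * L_op V0 V \<mu> W1 x \<partial>mub) = (\<integral>x. T f x * lf x \<partial>mub)"
  proof (rule integral_cong_AE)
    show "AE x in mub. T f x * L_op V0 V \<mu> W1 x = T f x * lf x" using AE_mub[OF L] by eventually_elim simp
  qed measurable
  then show "(\<integral>x. T f x * L_op V0 V \<mu> W1 x \<partial>mub) = 0" using lfz by simp
qed

section \<open>Invariance of a level set\<close>

lemma G2_slope_pos: "0 < G2 1 - G2 0"
  using strict_mono_onD[OF G(2), of 0 1] by simp

text \<open>Convexity at 1 as a point between 0 and r. The resulting linear growth is used both to
  integrate W and to make G2 positive at infinity.\<close>

lemma G2_slope:
  assumes r: "1 \<le> r"
  shows "r * (G2 1 - G2 0) \<le> G2 r - G2 0"
proof -
  have "G2 ((1 - 1 / r) *\<^sub>R 0 + (1 / r) *\<^sub>R r) \<le> (1 - 1 / r) * G2 0 + (1 / r) * G2 r"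
    using r by (intro convex_onD[OF G(3)]) auto
  then have "G2 1 \<le> (1 - 1 / r) * G2 0 + (1 / r) * G2 r" using r by simp
  then have "r * G2 1 \<le> r * ((1 - 1 / r) * G2 0 + (1 / r) * G2 r)" using r by (intro mult_left_mono) auto
  also have "\<dots> = (r - 1) * G2 0 + G2 r" using r by (simp add: algebra_simps)
  finally show ?thesis by (simp add: algebra_simps)
qed

text \<open>Apart from Jensen's inequality, the work lies in integrability. It is obtained for G2(W)
  and W against the reference measure and then transferred to the new measure by the boundedness of
  T f; the moment bound of f alone would not suffice, as it concerns a different density.\<close>

lemma T_trap:
  assumes f: "f \<in> trap M" and M: "G1 M < G2 M"
  shows "T f \<in> trap M"
proof -
  define \<mu> where "\<mu> = I_map Vb f"
  define m where "m = wt_norm W \<mu>"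
  have m: "0 \<le> m" "m \<le> M" unfolding m_def \<mu>_def using trapD(6,7)[OF f] by auto
  note M0 = trap_pos[OF f]
  have G1m: "G1 m \<le> G1 M" using m M0 by (intro strict_mono_on_leD[OF G(1)]) auto
  have G2mono: "G2 r \<le> G2 t" if "0 \<le> r" "r \<le> t" for r t using that by (intro strict_mono_on_leD[OF G(2)]) auto
  have W0': "0 \<le> W x" for x using W_ge[of x] by simp
  have [measurable]: "(\<lambda>x. G2 (W x)) \<in> borel_measurable borel"
  proof -
    \<comment> \<open>G2 is monotone on the half line only; truncating the argument gives a monotone
      function on all reals without changing G2(W).\<close>
    have "mono (\<lambda>r. G2 (max 0 r))" by (intro monoI G2mono) auto
    then have "(\<lambda>r. G2 (max 0 r)) \<in> borel_measurable borel" by (rule borel_measurable_mono)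
    then have "(\<lambda>x. G2 (max 0 (W x))) \<in> borel_measurable borel" by measurable
    then show ?thesis using W0' by (simp add: max_absorb2)
  qed
  have L: "integrable mub (L_op V0 V \<mu> W1)" "integrable mub (\<lambda>x. T f x * L_op V0 V \<mu> W1 x)"
    "(\<integral>x. T f x * L_op V0 V \<mu> W1 x \<partial>mub) = 0"
    unfolding \<mu>_def by (rule T_generator_zero[OF f])+
  note [measurable] = borel_measurable_integrable[OF L(1)]
  have ae: "AE x in mub. L_op V0 V \<mu> W1 x \<le> G1 m - G2 (W x)"
    unfolding m_def \<mu>_def by (rule AE_mub[OF Lyap[OF trapD(4)[OF f]]])
  \<comment> \<open>Condition (W2) bounds G2(W) only from above; the lower bound is G2(1), because W
    >= 1.\<close>
  have iG: "integrable mub (\<lambda>x. G2 (W x))"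
  proof (rule Bochner_Integration.integrable_bound[of _ "\<lambda>x. \<bar>G2 1\<bar> + \<bar>G1 m\<bar> + \<bar>L_op V0 V \<mu> W1 x\<bar>"])
    show "integrable mub (\<lambda>x. \<bar>G2 1\<bar> + \<bar>G1 m\<bar> + \<bar>L_op V0 V \<mu> W1 x\<bar>)" using L(1) by simp
    show "AE x in mub. norm (G2 (W x)) \<le> norm (\<bar>G2 1\<bar> + \<bar>G1 m\<bar> + \<bar>L_op V0 V \<mu> W1 x\<bar>)"
      using ae
    proof eventually_elim
      case (elim x)
      have "G2 1 \<le> G2 (W x)" using W_ge by (intro G2mono) auto
      then show ?case using elim unfolding real_norm_def by linarith
    qed
  qed measurable
  define s where "s = G2 1 - G2 0"
  have s: "0 < s" unfolding s_def by (rule G2_slope_pos)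
  have slope: "r \<le> (G2 r - G2 0) / s" if "1 \<le> r" for r
    using G2_slope[OF that] s by (simp add: s_def pos_le_divide_eq)
  \<comment> \<open>By its linear growth, G2(W) dominates W on [1, \<infinity>) up to an affine
    change.\<close>
  have iW: "integrable mub W"
  proof (rule Bochner_Integration.integrable_bound[of _ "\<lambda>x. (G2 (W x) - G2 0) / s"])
    show "integrable mub (\<lambda>x. (G2 (W x) - G2 0) / s)" using iG by simp
    have "norm (W x) \<le> norm ((G2 (W x) - G2 0) / s)" for x
      unfolding real_norm_def abs_of_nonneg[OF W0'] by (rule order_trans[OF slope[OF W_ge] abs_ge_self])
    then show "AE x in mub. norm (W x) \<le> norm ((G2 (W x) - G2 0) / s)" by simp
  qed simp
  note iTW = T_mult_integrable[OF f iW] and iTG = T_mult_integrable[OF f iG]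
  have up: "(\<integral>x. T f x * G2 (W x) \<partial>mub) \<le> G1 m"
  proof -
    have iT: "integrable mub (\<lambda>x. G1 m * T f x)" using T_props(4)[OF f] by simp
    have "(\<integral>x. T f x * G2 (W x) \<partial>mub) \<le> (\<integral>x. G1 m * T f x - T f x * L_op V0 V \<mu> W1 x \<partial>mub)"
    proof (rule integral_mono_AE[OF iTG])
      show "integrable mub (\<lambda>x. G1 m * T f x - T f x * L_op V0 V \<mu> W1 x)" using iT L(2) by simp
      show "AE x in mub. T f x * G2 (W x) \<le> G1 m * T f x - T f x * L_op V0 V \<mu> W1 x"
        using ae
      proof eventually_elim
        case (elim x)
        then have "T f x * G2 (W x) \<le> T f x * (G1 m - L_op V0 V \<mu> W1 x)"
          using T_props(2)[OF f, of x] by (intro mult_left_mono) auto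
        then show ?case by (simp add: algebra_simps)
      qed
    qed
    also have "\<dots> = G1 m" using iT L(2,3) T_props(4,5)[OF f] by simp
    finally show ?thesis .
  qed
  note Td = T_density[OF f]
  interpret \<nu>: prob_space "I_map Vb (T f)" by (rule I_map_prob[OF Td])
  note I = I_map_integral[OF densitiesD(1,2)[OF Td]]
  have eW: "(\<integral>x. W x \<partial>I_map Vb (T f)) = (\<integral>x. T f x * W x \<partial>mub)" by (rule I(2)) measurable
  have eG: "(\<integral>x. G2 (W x) \<partial>I_map Vb (T f)) = (\<integral>x. T f x * G2 (W x) \<partial>mub)" by (rule I(2)) measurable
  have jW: "integrable (I_map Vb (T f)) W" using I(1)[OF W_borel] iTW by simp
  have jG: "integrable (I_map Vb (T f)) (\<lambda>x. G2 (W x))" using I(1)[of "\<lambda>x. G2 (W x)"] iTG by simp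
  have "G2 (\<integral>x. W x \<partial>I_map Vb (T f)) \<le> (\<integral>x. G2 (W x) \<partial>I_map Vb (T f))"
  \<comment> \<open>Jensen's inequality is used on the open half line, which contains all values of
    W and on which G2 inherits convexity.\<close>
  proof (rule \<nu>.jensens_inequality[OF jW _ _ jG, where I = "{0<..}" and a = 0])
    have "0 < W x" for x using W_ge[of x] by simp
    then show "AE x in I_map Vb (T f). W x \<in> {0<..}" by simp
    show "convex_on {0<..} G2" by (rule convex_on_subset[OF G(3)]) auto
  qed simp
  also have "\<dots> \<le> G1 M" using up G1m unfolding eG by simp
  also note M
  finally have lt: "G2 (\<integral>x. T f x * W x \<partial>mub) < G2 M" unfolding eW .
  have "(\<integral>x. T f x * W x \<partial>mub) \<le> M"
  proof (rule ccontr)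
    assume "\<not> ?thesis"
    then have "G2 M \<le> G2 (\<integral>x. T f x * W x \<partial>mub)" using M0 by (intro G2mono) auto
    then show False using lt by simp
  qed
  then show ?thesis using T_props[OF f] iTW by (intro trapI) auto
qed

text \<open>The ratio G1 / G2 is eventually below 1; clearing the denominator needs G2 > 0, which
  its linear growth provides. Levels above any B are wanted because small level sets may be
  empty.\<close>

lemma good_level: "\<exists>M\<ge>B. G1 M < G2 M"
proof -
  have 1: "eventually (\<lambda>r. ereal (G1 r / G2 r) < 1) at_top" by (rule Limsup_lessD[OF G(4)])
  note s = G2_slope_pos
  \<comment> \<open>Beyond -G2(0) / (G2(1) - G2(0)) the linear lower bound from
    \<open>G2_slope\<close> is positive; the maximum with 1 keeps that lemma applicable.\<close>
  have "eventually (\<lambda>r. 0 < G2 r) at_top"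
    using eventually_gt_at_top[of "max 1 (- G2 0 / (G2 1 - G2 0))"]
  proof eventually_elim
    case (elim r)
    have a: "r * (G2 1 - G2 0) \<le> G2 r - G2 0" using elim by (intro G2_slope) simp
    have "- G2 0 / (G2 1 - G2 0) < r" using elim by simp
    then have "- G2 0 < r * (G2 1 - G2 0)" by (simp only: pos_divide_less_eq[OF s])
    then show ?case using a by linarith
  qed
  then have "eventually (\<lambda>r. B \<le> r \<and> G1 r < G2 r) at_top"
    using 1 eventually_ge_at_top[of B] by eventually_elim (auto simp: divide_less_eq one_ereal_def)
  then show ?thesis using eventually_happens'[OF trivial_limit_at_top_linorder] by blast
qed

text \<open>The reference measure conditioned on {W <= n} has W moment at most n, and some such set
  has positive mass because W is finite everywhere. The constant density would require W to be
  integrable beforehand, whereas \<open>T_trap\<close> derives this from a density already in a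
  level set.\<close>

lemma trap_nonempty: "\<exists>B. \<forall>M\<ge>B. trap M \<noteq> {}"
proof -
  define A where "A n = {x. W x \<le> real n}" for n
  have [measurable]: "A n \<in> sets borel" for n unfolding A_def by measurable
  have "\<exists>n. mub.prob (A n) \<noteq> 0"
  proof (rule ccontr)
    assume "\<not> ?thesis"
    then have "A n \<in> null_sets mub" for n by (auto simp: mub.emeasure_eq_measure intro!: null_setsI)
    then have "(\<Union>n. A n) \<in> null_sets mub" by (intro null_sets_UN) auto
    moreover have "(\<Union>n. A n) = UNIV" using real_arch_simple by (auto simp: A_def)
    ultimately have "emeasure mub UNIV = 0" by (simp add: null_setsD1)
    then show False using mub.emeasure_space_1 by simp
  qed
  then obtain n where n: "0 < mub.prob (A n)" using measure_nonneg[of mub] by (metis less_eq_real_def)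
  define f where "f x = indicator (A n) x / mub.prob (A n)" for x
  have [measurable]: "f \<in> borel_measurable borel" unfolding f_def[abs_def] by measurable
  have iA: "integrable mub (indicator (A n) :: 'a \<Rightarrow> real)" by (rule mub.integrable_const_bound[of _ 1]) auto
  have fi: "integrable mub f" unfolding f_def[abs_def] using iA by simp
  have f1: "(\<integral>x. f x \<partial>mub) = 1" unfolding f_def using n by simp
  have f0: "0 \<le> f x" for x using n by (simp add: f_def)
  have le: "f x * W x \<le> real n * f x" for x using f0[of x] n by (auto simp: f_def A_def indicator_def divide_right_mono)
  have fW: "integrable mub (\<lambda>x. f x * W x)"
  proof (rule Bochner_Integration.integrable_bound[of _ "\<lambda>x. real n * f x"])
    show "integrable mub (\<lambda>x. real n * f x)" using fi by simp
    have "norm (f x * W x) \<le> norm (real n * f x)" for x using le[of x] f0[of x] W_ge[of x] by (simp add: abs_mult)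
    then show "AE x in mub. norm (f x * W x) \<le> norm (real n * f x)" by simp
  qed measurable
  have "(\<integral>x. f x * W x \<partial>mub) \<le> (\<integral>x. real n * f x \<partial>mub)" by (rule integral_mono[OF fW _ le]) (use fi in simp)
  then have "(\<integral>x. f x * W x \<partial>mub) \<le> real n" using f1 by simp
  then have "f \<in> trap M" if "real n \<le> M" for M using that f0 fi f1 fW by (intro trapI) auto
  then show ?thesis by blast
qed

text \<open>A vanishing distance in L^1(W0 mub) means equality almost everywhere, since W0 >= 1. It
  is recorded as equality of the measures, which is the only information about a density that T
  uses.\<close>

lemma fixed_density: "\<exists>M. \<exists>y\<in>trap M. T y \<in> trap M \<and> I_map Vb (T y) = I_map Vb y"
proof -
  obtain B where B: "\<And>M. B \<le> M \<Longrightarrow> trap M \<noteq> {}" using trap_nonempty by blast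
  obtain M where M: "B \<le> M" "G1 M < G2 M" using good_level by blast
  have TX: "T f \<in> trap M" if "f \<in> trap M" for f by (rule T_trap[OF that M(2)])
  have iM0: "integrable M0 f" if "f \<in> densities" for f
    using M0_integral(1)[OF densitiesD(1)[OF that]] densitiesD(5)[OF that] by simp
  have "\<exists>y\<in>trap M. L1_dist M0 (T y) y = 0"
  proof (rule schauder_L1)
    show "integrable M0 f" if "f \<in> trap M" for f by (rule iM0[OF trapD(1)[OF that]])
    show "trap M \<noteq> {}" by (rule B[OF M(1)])
    show "(\<lambda>x. (1 - t) * f x + t * g x) \<in> trap M" if "f \<in> trap M" "g \<in> trap M" "0 \<le> t" "t \<le> 1" for f g t
      by (rule trap_convex[OF that])
    show "T f \<in> trap M" if "f \<in> trap M" for f by (rule TX[OF that])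
    show "(\<lambda>k. L1_dist M0 (T (X k)) (T z)) \<longlonglongrightarrow> 0"
      if "\<And>k. X k \<in> trap M" "z \<in> trap M" "(\<lambda>k. L1_dist M0 (X k) z) \<longlonglongrightarrow> 0" for X z
      by (rule T_continuous[OF that])
    show "\<exists>r y. strict_mono (r :: nat \<Rightarrow> nat) \<and> y \<in> trap M \<and> (\<lambda>k. L1_dist M0 (T (X (r k))) y) \<longlonglongrightarrow> 0"
      if "\<And>k. X k \<in> trap M" for X
      by (rule T_compact[OF that TX])
  qed
  then obtain y where y: "y \<in> trap M" "L1_dist M0 (T y) y = 0" by blast
  note dy = trapD(1)[OF y(1)] and dT = trapD(1)[OF TX[OF y(1)]]
  note [measurable] = densitiesD(1)[OF dy] densitiesD(1)[OF dT]
  have i: "integrable mub (\<lambda>x. \<bar>T y x - y x\<bar> * W0 x)" by (rule abs_diff_int[OF dT dy])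
  have "(\<integral>x. \<bar>T y x - y x\<bar> * W0 x \<partial>mub) = 0"
    using y(2) M0_integral(2)[of "\<lambda>x. \<bar>T y x - y x\<bar>"] by (simp add: L1_dist_def)
  moreover have nn: "0 \<le> \<bar>T y x - y x\<bar> * W0 x" for x using W0_ge[of x] by simp
  ultimately have "AE x in mub. \<bar>T y x - y x\<bar> * W0 x = 0"
    using integral_nonneg_eq_0_iff_AE[OF i AE_I2[OF nn]] by blast
  then have ae: "AE x in mub. ennreal (T y x) = ennreal (y x)"
  proof eventually_elim
    case (elim x)
    then show ?case using W0_ge[of x] by auto
  qed
  have "density mub (\<lambda>x. ennreal (T y x)) = density mub (\<lambda>x. ennreal (y x))"
    by (rule density_cong[OF _ _ ae]) measurable
  then have "I_map Vb (T y) = I_map Vb y"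
    by (rule trans[OF I_map_def trans[OF _ I_map_def[symmetric]]])
  then show ?thesis using y(1) TX[OF y(1)] by blast
qed

section \<open>Regularity of the fixed point\<close>

lemma T_weak_deriv:
  assumes f: "f \<in> trap M" and i: "i \<in> Basis" and a: "has_weak_deriv V0 [i] a" and b: "has_weak_deriv Vb [i] b"
  defines "d \<equiv> \<lambda>x. (- 1) * (a x + weak_deriv [i] (\<lambda>x. V x (I_map Vb f)) x) + b x"
  shows "has_weak_deriv (T f) [i] (\<lambda>x. d x * T f x)"
proof -
  define N where "N = (\<integral>y. \<psi> f y \<partial>mub)"
  define u where "u x = (- 1) * (V0 x + V x (I_map Vb f)) + Vb x" for x
  have u: "\<psi> f x = exp (u x)" for x by (simp add: psi_def u_def)
  have ud: "has_weak_deriv u [i] d"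
    unfolding u_def[abs_def] d_def
    by (rule has_weak_deriv_add[OF has_weak_deriv_cmult[OF has_weak_deriv_add[OF a V_deriv(1)[OF trapD(5)[OF f] i] i]] b i])
  \<comment> \<open>The logarithm of the bound KK M on \<psi>: being bounded above is the condition
    under which the chain rule for exp applies.\<close>
  have "u x \<le> \<bar>C\<bar> + F4 (\<beta> M)" for x
    using T_props(7)[OF f, of x] unfolding u KK_def exp_le_cancel_iff .
  from has_weak_deriv_cmult[OF weak_deriv_exp[OF ud i this], of "1 / N"]
  have "has_weak_deriv (\<lambda>x. 1 / N * exp (u x)) [i] (\<lambda>x. 1 / N * (d x * exp (u x)))" .
  moreover have "T f = (\<lambda>x. 1 / N * exp (u x))"
    unfolding T_hat_def[abs_def] N_def[symmetric] by (simp add: u)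
  ultimately show ?thesis by (simp add: mult.left_commute)
qed

text \<open>The derivative of T f is d T f with d the derivative of -V0 - V + Vb, and T f is
  bounded, so it inherits the integrability of d. The local and the weighted statement are proved
  separately, each with its own representatives of the derivatives of V0 and Vb.\<close>

lemma T_sobolev:
  assumes f: "f \<in> trap M"
  shows "T f \<in> sobolev_wt 1 p (ennreal q) mub"
proof -
  define B where "B = KK M / c0 M"
  have TB: "\<bar>T f x\<bar> \<le> B" for x using T_props(2,3)[OF f, of x] by (simp add: B_def)
  then have B: "0 \<le> B" by (meson abs_ge_zero order_trans)
  have le: "\<bar>d x * T f x\<bar> \<le> B * \<bar>d x\<bar>" for d :: "'a \<Rightarrow> real" and x
    using mult_right_mono[OF TB[of x], of "\<bar>d x\<bar>"] by (simp add: abs_mult mult.commute)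
  note [measurable] = T_props(1)[OF f]
  have shape: "\<exists>i\<in>Basis. is = [i]" if "set is \<subseteq> Basis \<and> length is \<in> {1..1}" for "is" :: "'a list"
    using that by (cases "is") auto
  have loc: "T f \<in> Lp_loc p" by (rule Lp_loc_bounded[OF T_props(1)[OF f] TB])
  have d1: "\<exists>g. has_weak_deriv (T f) [i] g \<and> g \<in> Lp_loc p" if i: "i \<in> Basis" for i
  proof -
    obtain a where a: "has_weak_deriv V0 [i] a" "a \<in> Lp_loc p" using V0_deriv(2)[OF i] by blast
    obtain b where b: "has_weak_deriv Vb [i] b" "b \<in> Lp_loc p" using Vb_deriv(2)[OF i] by blast
    define d where "d x = (- 1) * (a x + weak_deriv [i] (\<lambda>x. V x (I_map Vb f)) x) + b x" for x
    have d: "d \<in> Lp_loc p" unfolding d_def[abs_def]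
      by (intro Lp_loc_add Lp_loc_cmult a b V_deriv_Lp(2) trapD(5)[OF f] i)
    have [measurable]: "d \<in> borel_measurable borel" using d by (simp add: Lp_loc_def)
    have "(\<lambda>x. d x * T f x) \<in> Lp_loc p" by (rule Lp_loc_mono[OF d _ _ B]) (measurable, rule AE_I2, rule le)
    then show ?thesis using T_weak_deriv[OF f i a(1) b(1)] unfolding d_def by blast
  qed
  have d2: "\<exists>g. has_weak_deriv (T f) [i] g \<and> g \<in> Lp mub (ennreal q)" if i: "i \<in> Basis" for i
  proof -
    obtain a where a: "has_weak_deriv V0 [i] a" "a \<in> Lp mub (ennreal q)" using V0_deriv(1)[OF i] by blast
    obtain b where b: "has_weak_deriv Vb [i] b" "b \<in> Lp mub (ennreal q)" using Vb_deriv(1)[OF i] by blast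
    define d where "d x = (- 1) * (a x + weak_deriv [i] (\<lambda>x. V x (I_map Vb f)) x) + b x" for x
    have d: "d \<in> Lp mub (ennreal q)" unfolding d_def[abs_def]
      by (intro Lp_add Lp_cmult a b V_deriv_Lp(1) trapD(5)[OF f] i)
    note [measurable] = LpD[OF d]
    have "(\<lambda>x. d x * T f x) \<in> Lp mub (ennreal q)" by (rule Lp_mono[OF d _ _ B]) (measurable, rule AE_I2, rule le)
    then show ?thesis using T_weak_deriv[OF f i a(1) b(1)] unfolding d_def by blast
  qed
  show ?thesis
    unfolding sobolev_wt_def sobolev_loc_def mem_Collect_eq
    using loc d1 d2 shape by metis
qed

text \<open>The witness is T y rather than y. Since y and T y define the same measure, T (T y) and T
  y agree at every point, and as a Gibbs density T y is bounded and weakly differentiable; its W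
  moment is finite because T y lies in the level set as well.\<close>

theorem fixed_point:
  "\<exists>f. (\<forall>x. 0 \<le> f x) \<and> integrable mub f \<and> (\<integral>x. f x \<partial>mub) = 1
     \<and> f \<in> sobolev_wt 1 p (ennreal q) mub \<and> f \<in> Lp lborel \<infinity>
     \<and> integrable (density mub (\<lambda>x. ennreal (W x))) f \<and> (\<forall>x. f x = T f x)"
proof -
  obtain M y where y: "y \<in> trap M" "T y \<in> trap M" "I_map Vb (T y) = I_map Vb y" using fixed_density by blast
  note T = T_props[OF y(1)]
  have "\<forall>x. T y x = T (T y) x" unfolding y(3) by simp
  moreover have "T y \<in> Lp lborel \<infinity>"
  proof -
    have "\<bar>T y x\<bar> \<le> KK M / c0 M" for x using T(2,3)[of x] by simp
    then show ?thesis using T(1) by (auto simp: Lp_def)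
  qed
  moreover have "integrable (density mub (\<lambda>x. ennreal (W x))) (T y)"
  proof -
    have "0 \<le> W x" for x using W_ge[of x] by simp
    then show ?thesis using trapD(2)[OF y(2)] T(1) by (simp add: integrable_density mult.commute)
  qed
  ultimately show ?thesis using T(2,4,5) T_sobolev[OF y(1)] by (intro exI[of _ "T y"]) simp
qed

end

theorem theorem2p1:
  fixes V0 Vb W0 W W1 F0 :: "'a::euclidean_space \<Rightarrow> real"
    and V :: "'a \<Rightarrow> 'a measure \<Rightarrow> real"
    and p p1 :: ennreal and q :: real
  assumes "H1 p q V0 Vb"
    and "H2 p q Vb W0 V F0"
    and "H3 V0 Vb F0"
    and "integrable (density (ref_measure Vb) (\<lambda>x. ennreal (W0 x))) F0"
    and "cond_W1 W0 W"
    and "cond_W2 V0 V W W1"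
    and "conj_exponent q \<le> p1"
    and "W1 \<in> sobolev_wt 2 p1 p1 (ref_measure Vb)"
  shows "\<exists>f. (\<forall>x. 0 \<le> f x)
           \<and> integrable (ref_measure Vb) f \<and> (\<integral>x. f x \<partial>ref_measure Vb) = 1
           \<and> f \<in> sobolev_wt 1 p (ennreal q) (ref_measure Vb)
           \<and> f \<in> Lp lborel \<infinity>
           \<and> integrable (density (ref_measure Vb) (\<lambda>x. ennreal (W x))) f
           \<and> (\<forall>x. f x = T_hat V0 Vb V (I_map Vb f) x)"
proof -
  from assms(2) obtain F1 F2 F3 C where H2:
    "W0 \<in> borel_measurable borel" "\<forall>x. 1 \<le> W0 x" "integrable (ref_measure Vb) W0"
    "\<forall>\<mu>\<in>prob_wt W0. (\<lambda>x. V x \<mu>) \<in> sobolev_loc 1 p" "\<forall>x. 0 \<le> F0 x" "F0 \<in> Lp_loc \<infinity>"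
    "\<forall>x. 0 \<le> F2 x" "F2 \<in> Lp (ref_measure Vb) (ennreal q)" "F2 \<in> Lp_loc p"
    "\<forall>r\<ge>0. 0 \<le> F1 r" "mono_on {0..} F1" "(F1 \<longlongrightarrow> 0) (at_right 0)"
    "\<forall>r\<ge>0. 0 \<le> F3 r" "mono_on {0..} F3"
    "\<forall>\<mu>\<in>prob_wt W0. \<forall>\<nu>\<in>prob_wt W0. \<forall>x. \<bar>V x \<mu> - V x \<nu>\<bar> \<le> F0 x * F1 (wt_dist W0 \<mu> \<nu>)"
    "\<forall>x. \<bar>V x (ref_measure Vb)\<bar> \<le> C * (F0 x + 1)"
    "\<forall>\<mu>\<in>prob_wt W0. AE x in lborel. norm (weak_grad (\<lambda>y. V y \<mu>) x) \<le> F2 x * F3 (wt_norm W0 \<mu>)"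
    unfolding H2_def by (elim conjE exE) (rule that)
  from assms(3) obtain F4 where F4: "mono_on {0..} F4" "\<forall>\<beta>\<ge>0. \<forall>x. - V0 x + \<beta> * F0 x \<le> - Vb x + F4 \<beta>"
    unfolding H3_def by blast
  from assms(6) obtain G1 G2 where G: "strict_mono_on {0..} G1" "strict_mono_on {0..} G2" "convex_on {0..} G2"
    "Limsup at_top (\<lambda>r. ereal (G1 r / G2 r)) < 1"
    "\<forall>\<mu>\<in>prob_wt W. AE x in lborel. L_op V0 V \<mu> W1 x \<le> G1 (wt_norm W \<mu>) - G2 (W x)"
    unfolding cond_W2_def by (elim conjE exE) (rule that)
  interpret mckean_vlasov V0 Vb W0 W W1 F0 F2 V p p1 q C F1 F3 F4 G1 G2
    by unfold_locales (use assms(1,5,7,8) H2 F4 G in simp_all)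
  show ?thesis by (rule fixed_point)
qed

end
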